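(* Let $Z$ be a positive random variable with continuous distribution function $G$ such that there exists $\hat{x}\in(0,\infty)$ with $G\in C^2([0,\hat{x}])$ and $\lambda:=G'(0+)>0$. Let $(s_n)_{n\in\mathbb{N}}$ be a sequence in $(0,\infty)$ with $s_n\log n\to\gamma\in[0,\infty)$, and let the edge weights of the complete graph $K_n$ satisfy $X_e\overset{d}{=}Z^{s_n}$. (a) If $\gamma\in[0,2\log2)$, then \[ \frac{W_n-1}{s_n}\overset{d}{\longrightarrow}\log Z\qquad\text{and}\qquad\mathbb{P}(H_n=1)\to1. \] (b) If $\gamma=2\log2$, then \[ W_n\overset{\mathbb{P}}{\longrightarrow}1\qquad\text{and}\qquad\mathbb{P}(H_n\in\{1,2\})\to1. \] (c) If $s_n\log n-\gamma=o((\log n)^{-1/2})$, $\gamma\notin\Gamma$ and $\gamma>2\log2$, then for $k=k(\gamma)$ \[ \frac{k}{g_\gamma(k)s_n}\big[\lambda^{s_n}W_n-g_\gamma(k)\big]+\frac{k-1}{s_n}\big(s_n\log n-\gamma-(s_n\log s_n)/2\big)\overset{d}{\longrightarrow}-\Lambda-\log a_k, \] and $\mathbb{P}(H_n=k)\to1$. (d) If $s_n\log n-\gamma=o((\log n)^{-1/2})$ and $\gamma=\gamma_k\in\Gamma$ for some $k\ge2$, then \[ W_n\overset{\mathbb{P}}{\longrightarrow}g_\gamma(k)\qquad\text{and}\qquad\mathbb{P}(H_n\in\{k,k+1\})\to1. \]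
   Context: For each $n$, let $K_n$ be the complete graph with vertex set $[n]=\{1,\dots,n\}$ and edge set $\mathrm{E}_n$. The edge weights $(X_e)_{e\in \mathrm{E}_n}$ are positive i.i.d. random variables with a continuous distribution function. The weight of a path $p$ is $w(p)=\sum_{e\in p}X_e$. Let $\mathcal{S}_{1,2}$ be the set of self-avoiding paths between vertex $1$ and vertex $2$. $W_n=\min_{p\in\mathcal{S}_{1,2}}w(p)$ is the weight of the (almost surely unique) minimal weight path, and the hopcount $H_n$ is its number of edges. All limits are as $n\to\infty$. Notation: $\mathbb{N}=\{1,2,\dots\}$. For $\gamma\in[0,\infty)$ and $x>0$, $g_\gamma(x)=xe^{-\gamma(1-1/x)}=e^{-\gamma}xe^{\gamma/x}$. For $k\in\mathbb{N}$, $\gamma_k:=k(k+1)\log\frac{k+1}{k}$, and $\Gamma=\{\gamma_k:k\in\mathbb{N}\}$. If $\gamma\notin\Gamma$, the minimizer of $g_\gamma$ on $\mathbb{N}$ is unique and is denoted by $k(\gamma)$ (if $\gamma=\gamma_k$, then $g_\gamma$ has exactly the two minimizers $k$ and $k+1$ on $\mathbb{N}$). $\Lambda$ is a standard Gumbel random variable, i.e. $\mathbb{P}(\Lambda\le t)=e^{-e^{-t}}$ for all $t\in\mathbb{R}$, and $a_k=\frac{(2\pi)^{k/2}}{\sqrt{2\pi k}}$ for $k\in\mathbb{N}$. *)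

theory Defs
  imports "HOL-Probability.Probability" "HOL-Library.Landau_Symbols"
begin

section \<open>First passage percolation on the complete graph\<close>

text \<open>Undirected edges are two-element sets of vertices; a weighting is a function on edges.\<close>

definition complete_edges :: "nat \<Rightarrow> nat set set" where
  "complete_edges n = {e. e \<subseteq> {1..n} \<and> card e = 2}"

text \<open>Self-avoiding paths from 1 to 2 are given by their lists of (pairwise distinct) vertices. In a
  complete graph any two consecutive, hence distinct, vertices are adjacent.\<close>

definition sa_paths :: "nat \<Rightarrow> nat list set" where
  "sa_paths n = {p. p \<noteq> [] \<and> distinct p \<and> set p \<subseteq> {1..n} \<and> hd p = 1 \<and> last p = 2}"

definition path_edges :: "nat list \<Rightarrow> nat set set" where
  "path_edges p = {{p ! i, p ! Suc i} | i. Suc i < length p}"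

definition path_weight :: "(nat set \<Rightarrow> real) \<Rightarrow> nat list \<Rightarrow> real" where
  "path_weight x p = (\<Sum>e\<in>path_edges p. x e)"

definition min_weight :: "nat \<Rightarrow> (nat set \<Rightarrow> real) \<Rightarrow> real" where
  "min_weight n x = Min (path_weight x ` sa_paths n)"

text \<open>If several paths have minimal weight (a null event in the intended model), an arbitrary one
  is chosen. The choice depends only on the set of minimizers, so that the hopcount of a random
  weighting remains measurable.\<close>

definition minimal_path :: "nat \<Rightarrow> (nat set \<Rightarrow> real) \<Rightarrow> nat list" where
  "minimal_path n x = arg_min (path_weight x) (\<lambda>p. p \<in> sa_paths n)"

definition hopcount :: "nat \<Rightarrow> (nat set \<Rightarrow> real) \<Rightarrow> nat" where
  "hopcount n x = card (path_edges (minimal_path n x))"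

section \<open>The limiting constants\<close>

definition g_fun :: "real \<Rightarrow> real \<Rightarrow> real" where
  "g_fun \<gamma> x = x * exp (- \<gamma> * (1 - 1 / x))"

definition gamma_crit :: "nat \<Rightarrow> real" where
  "gamma_crit k = real k * (real k + 1) * ln ((real k + 1) / real k)"

definition Gamma_set :: "real set" where
  "Gamma_set = gamma_crit ` {1..}"

text \<open>Unique minimizer unless \<open>\<gamma> \<in> Gamma_set\<close>, where one of the two minimizers is picked.\<close>

definition k_opt :: "real \<Rightarrow> nat" where
  "k_opt \<gamma> = arg_min (\<lambda>k. g_fun \<gamma> (real k)) (\<lambda>k. 1 \<le> k)"

definition a_const :: "nat \<Rightarrow> real" where
  "a_const k = (2 * pi) powr (real k / 2) / sqrt (2 * pi * real k)"

section \<open>Analytic and probabilistic notions\<close>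

text \<open>Derivatives are taken within \<open>S\<close>, thus one-sided at the endpoints of a closed interval.\<close>

definition C2_on :: "real set \<Rightarrow> (real \<Rightarrow> real) \<Rightarrow> bool" where
  "C2_on S f \<longleftrightarrow> (\<exists>f' f''.
      (\<forall>x\<in>S. (f has_real_derivative f' x) (at x within S)) \<and>
      (\<forall>x\<in>S. (f' has_real_derivative f'' x) (at x within S)) \<and>
      continuous_on S f'')"

text \<open>The random variables of the sequence may live on different probability spaces.\<close>

definition conv_in_prob :: "(nat \<Rightarrow> 'a measure) \<Rightarrow> (nat \<Rightarrow> 'a \<Rightarrow> real) \<Rightarrow> real \<Rightarrow> bool" where
  "conv_in_prob M Y c \<longleftrightarrow>
     (\<forall>\<epsilon>>0. (\<lambda>n. measure (M n) {\<omega> \<in> space (M n). \<bar>Y n \<omega> - c\<bar> > \<epsilon>}) \<longlonglongrightarrow> 0)"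

definition standard_gumbel :: "'a measure \<Rightarrow> ('a \<Rightarrow> real) \<Rightarrow> bool" where
  "standard_gumbel L Y \<longleftrightarrow> prob_space L \<and> Y \<in> borel_measurable L \<and>
     (\<forall>t. measure L {\<omega> \<in> space L. Y \<omega> \<le> t} = exp (- exp (- t)))"

end

theory Submission
  imports Defs "HOL-Real_Asymp.Real_Asymp"
begin

text \<open>
  Put \<open>m = 1 / s\<close>. An edge weight has distribution function \<open>G (y powr m)\<close>, which is about
  \<open>lam * y powr m\<close> below 1, so that a sum of \<open>j\<close> weights has distribution function about
  \<open>lam ^ j * Gamma (m + 1) ^ j / Gamma (j * m + 1) * w powr (j * m)\<close>. By Stirling's formula the
  expected number of paths with \<open>j\<close> edges and weight at most \<open>w\<close> is, up to powers of \<open>m\<close>,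
  \<open>(w / g_fun \<gamma> j) powr (j * m)\<close>. Hence only the lengths that minimize \<open>g_fun \<gamma>\<close> contribute: for the
  others a first moment bound, from an exponential moment, suffices.

  For the optimal length \<open>k \<ge> 2\<close> the threshold \<open>w\<close> is chosen such that the expected number of
  light paths converges to \<open>a_const k * exp t\<close>, and their number is asymptotically Poisson because
  pairs of light paths sharing an edge are negligible. The optimality of \<open>k\<close> enters through
  \<open>\<gamma> \<ge> gamma_crit (k - 1)\<close>, which gives \<open>\<gamma> / k > 1 - ln 2\<close>. The probability that there is no
  light path then tends to \<open>exp (- a_const k * exp t)\<close>, the tail of the Gumbel limit.
\<close>

section \<open>The Stirling formula for the real Gamma function\<close>

text \<open>On the scale \<open>m = 1 / s n\<close> every count is \<open>exp\<close> of
  \<open>m\<close> times a rate. An exponential moment bound loses only a factor of order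
  \<open>sqrt m\<close> per edge, so it settles every length with a strict gap in the rate; since
  lengths run up to \<open>n - 1\<close>, it has to be uniform in the length. The sharp constant
  \<open>a_const k\<close> needs the true distribution function of a sum, but only for one length,
  and at levels below 1, where \<open>y powr m\<close> is small and \<open>G\<close> is nearly
  linear. For \<open>k = 1\<close> the level tends to 1 and all of \<open>G\<close> is seen, which
  is why \<open>ln Z\<close> and not a Gumbel variable appears there.

  The obstacle is a pair of paths sharing \<open>l\<close> edges. The exponential parameter that is
  optimal for one path costs a factor \<open>exp (l * (1 - ln 2) * m)\<close>, while the reduced
  number of such pairs gains \<open>exp (- l * \<gamma> / k * m)\<close>; this is the origin of
  \<open>1 - ln 2\<close>.

  The rate condition on \<open>s\<close> makes the squared relative deviation \<open>d\<close> of
  the threshold \<open>o(s)\<close>, so that \<open>(1 + d) powr (k * m)\<close> may be replaced by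
  \<open>exp (k * m * d)\<close>.\<close>

definition stirling_rem :: "real \<Rightarrow> real" where
  "stirling_rem x = ln (Gamma x) - (x - 1/2) * ln x + x"

text \<open>The increment is \<open>1 - (x + 1/2) * (ln (x + 1) - ln x)\<close>, which is of order
  \<open>1 / x\<^sup>2\<close>. The majorant \<open>1 / (x - 1) - 1 / x\<close> is chosen because it
  telescopes when unit steps are added up.\<close>

lemma stirling_rem_Suc_bound:
  "\<exists>x0\<ge>2. \<forall>x\<ge>x0. \<bar>stirling_rem (x + 1) - stirling_rem x\<bar> \<le> 1 / (x - 1) - 1 / x"
proof -
  have "((\<lambda>x::real. x\<^sup>2 * (1 - (x + 1/2) * (ln (x + 1) - ln x))) \<longlongrightarrow> -1/12) at_top"
    by real_asymp
  then have "eventually (\<lambda>x::real. x\<^sup>2 * (1 - (x + 1/2) * (ln (x + 1) - ln x)) > -1) at_top"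
    "eventually (\<lambda>x::real. x\<^sup>2 * (1 - (x + 1/2) * (ln (x + 1) - ln x)) < 1) at_top"
    by (auto elim: order_tendstoD)
  then have "eventually (\<lambda>x::real. \<bar>1 - (x + 1/2) * (ln (x + 1) - ln x)\<bar> \<le> 1 / x\<^sup>2) at_top"
    using eventually_gt_at_top[of 0]
  proof eventually_elim
    case (elim x)
    then have "\<bar>x\<^sup>2 * (1 - (x + 1/2) * (ln (x + 1) - ln x))\<bar> \<le> 1" by linarith
    then have "x\<^sup>2 * \<bar>1 - (x + 1/2) * (ln (x + 1) - ln x)\<bar> \<le> 1" by (simp add: abs_mult)
    then show ?case using elim(3) by (subst pos_le_divide_eq) (auto simp: mult.commute)
  qed
  then obtain x1 where x1: "\<And>x::real. x \<ge> x1 \<Longrightarrow> \<bar>1 - (x + 1/2) * (ln (x + 1) - ln x)\<bar> \<le> 1 / x\<^sup>2"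
    by (auto simp: eventually_at_top_linorder)
  have "\<bar>stirling_rem (x + 1) - stirling_rem x\<bar> \<le> 1 / (x - 1) - 1 / x" if "x \<ge> max 2 x1" for x
  proof -
    have x: "x \<ge> 2" "x \<ge> x1" using that by auto
    have "Gamma x > 0" using x by simp
    moreover have "Gamma (x + 1) = x * Gamma x" using x by (subst Gamma_plus1) (auto simp: nonpos_Ints_def)
    ultimately have "ln (Gamma (x + 1)) = ln x + ln (Gamma x)" using x ln_mult_pos[of x "Gamma x"] by simp
    then have "stirling_rem (x + 1) - stirling_rem x = 1 - (x + 1/2) * (ln (x + 1) - ln x)"
      by (simp add: stirling_rem_def algebra_simps add_divide_distrib)
    also have "\<bar>\<dots>\<bar> \<le> 1 / x\<^sup>2" using x1 x by blast
    also have "\<dots> \<le> 1 / (x - 1) - 1 / x" using x by (simp add: field_simps power2_eq_square)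
    finally show ?thesis .
  qed
  then show ?thesis by (intro exI[of _ "max 2 x1"]) auto
qed

text \<open>Unit steps only compare arguments that differ by an integer. Euler's limit for the Gamma
  function compares \<open>z + n + 1\<close> with \<open>1 + n\<close> for real \<open>z\<close> and
  so links different fractional parts.\<close>

lemma stirling_rem_shift_tendsto:
  assumes z: "z > 0"
  shows "(\<lambda>n. stirling_rem (z + real n + 1) - stirling_rem (1 + real n)) \<longlonglongrightarrow> 0"
proof -
  have "Gamma_series z \<longlonglongrightarrow> Gamma z" by (rule Gamma_series_LIMSEQ)
  then have "(\<lambda>n. ln (Gamma_series z n)) \<longlonglongrightarrow> ln (Gamma z)"
    using z by (intro tendsto_ln) (auto simp: less_imp_neq[OF Gamma_real_pos, symmetric])
  moreover have "eventually (\<lambda>n. ln (Gamma_series z n) =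
      z * ln (real n) + ln (Gamma (1 + real n)) - ln (Gamma (z + real n + 1)) + ln (Gamma z)) at_top"
    using eventually_gt_at_top[of 0]
  proof eventually_elim
    case (elim n)
    have "z \<notin> \<int>\<^sub>\<le>\<^sub>0" using z by (auto simp: nonpos_Ints_def)
    then have "pochhammer z (n + 1) = Gamma (z + real n + 1) / Gamma z"
      by (subst pochhammer_Gamma) (auto simp: add_ac)
    moreover have "Gamma (z + real n + 1) > 0" "Gamma z > 0" "Gamma (1 + real n) > 0"
      using z by (auto intro!: Gamma_real_pos)
    ultimately show ?case using elim
      by (simp add: Gamma_series_def ln_mult ln_div Gamma_fact[symmetric] less_imp_neq[symmetric] del: of_nat_Suc)
  qed
  ultimately have "(\<lambda>n. z * ln (real n) + ln (Gamma (1 + real n)) - ln (Gamma (z + real n + 1)) + ln (Gamma z)) \<longlonglongrightarrow> ln (Gamma z)"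
    by (rule Lim_transform_eventually)
  from tendsto_diff[OF tendsto_const[of "ln (Gamma z)"] this]
  have 1: "(\<lambda>n. ln (Gamma (z + real n + 1)) - ln (Gamma (1 + real n)) - z * ln (real n)) \<longlonglongrightarrow> 0"
    by (simp add: algebra_simps)
  have 2: "(\<lambda>n. z * ln (real n) - (z + real n + 1/2) * ln (z + real n + 1) + (real n + 1/2) * ln (1 + real n) + z) \<longlonglongrightarrow> 0"
    using z by real_asymp
  from tendsto_add[OF 1 2] show ?thesis
    by (simp add: stirling_rem_def algebra_simps)
qed

text \<open>The telescoped steps bound the drift beyond \<open>x\<close> by
  \<open>1 / (x - 1)\<close>. Together with the shift limit this bounds the difference of the values
  at any two large arguments, so the limit along the integers is a limit along the reals.\<close>

lemma stirling_rem_convergent: "\<exists>\<rho>. (stirling_rem \<longlongrightarrow> \<rho>) at_top"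
proof -
  obtain x0 where x0: "x0 \<ge> 2" and D: "\<And>x. x \<ge> x0 \<Longrightarrow> \<bar>stirling_rem (x + 1) - stirling_rem x\<bar> \<le> 1 / (x - 1) - 1 / x"
    using stirling_rem_Suc_bound by blast
  have step: "\<bar>stirling_rem (x + real n) - stirling_rem x\<bar> \<le> 1 / (x - 1) - 1 / (x + real n - 1)" if "x \<ge> x0" for x n
  proof (induction n)
    case (Suc n)
    have "\<bar>stirling_rem (x + real n + 1) - stirling_rem (x + real n)\<bar> \<le> 1 / (x + real n - 1) - 1 / (x + real n)"
      using D[of "x + real n"] that by simp
    with Suc show ?case by (simp add: add_ac)
  qed simp
  have step': "\<bar>stirling_rem (x + real n) - stirling_rem x\<bar> \<le> 1 / (x - 1)" if "x \<ge> x0" for x n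
    using step[OF that, of n] x0 that by (smt (verit) divide_nonneg_nonneg of_nat_0_le_iff)
  have shift: "(\<lambda>n. stirling_rem (x + real n) - stirling_rem (y + real n)) \<longlonglongrightarrow> 0" if "x \<ge> x0" "y \<ge> x0" for x y
  proof -
    have "(\<lambda>n. stirling_rem (x + real n) - stirling_rem (1 + real n)) \<longlonglongrightarrow> 0"
      "(\<lambda>n. stirling_rem (y + real n) - stirling_rem (1 + real n)) \<longlonglongrightarrow> 0"
      using stirling_rem_shift_tendsto[of "x - 1"] stirling_rem_shift_tendsto[of "y - 1"] that x0
      by (simp_all add: algebra_simps)
    from tendsto_diff[OF this] show ?thesis by simp
  qed
  have close: "\<bar>stirling_rem x - stirling_rem y\<bar> \<le> 1 / (x - 1) + 1 / (y - 1)" if "x \<ge> x0" "y \<ge> x0" for x y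
  proof -
    have "(\<lambda>n. \<bar>stirling_rem (x + real n) - stirling_rem (y + real n)\<bar> + (1 / (x - 1) + 1 / (y - 1))) \<longlonglongrightarrow> \<bar>0\<bar> + (1 / (x - 1) + 1 / (y - 1))"
      by (intro tendsto_intros shift that)
    then have "\<bar>stirling_rem x - stirling_rem y\<bar> \<le> \<bar>0\<bar> + (1 / (x - 1) + 1 / (y - 1))"
    proof (rule LIMSEQ_le_const)
      have "\<bar>stirling_rem x - stirling_rem y\<bar> \<le> \<bar>stirling_rem (x + real n) - stirling_rem (y + real n)\<bar> + (1 / (x - 1) + 1 / (y - 1))" for n
        using step'[OF that(1), of n] step'[OF that(2), of n] by linarith
      then show "\<exists>N. \<forall>n\<ge>N. \<bar>stirling_rem x - stirling_rem y\<bar> \<le> \<bar>stirling_rem (x + real n) - stirling_rem (y + real n)\<bar> + (1 / (x - 1) + 1 / (y - 1))"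
        by blast
    qed
    then show ?thesis by simp
  qed
  have "Cauchy (\<lambda>n. stirling_rem (real n))"
  proof (rule CauchyI)
    fix e :: real assume e: "e > 0"
    define K where "K = nat \<lceil>x0 + 2 / e + 1\<rceil>"
    have K: "real n \<ge> x0 \<and> 1 / (real n - 1) < e / 2" if "n \<ge> K" for n
    proof -
      have "real n \<ge> x0 + 2 / e + 1" using that unfolding K_def by linarith
      moreover have "2 / e > 0" using e by simp
      ultimately have "real n \<ge> x0" "real n - 1 > 2 / e" using x0 by linarith+
      moreover have "1 / (real n - 1) < e / 2"
        using frac_less2[of 1 1 "2 / e" "real n - 1"] \<open>real n - 1 > 2 / e\<close> \<open>2 / e > 0\<close> e by simp
      ultimately show ?thesis by blast
    qed
    show "\<exists>M. \<forall>m\<ge>M. \<forall>n\<ge>M. norm (stirling_rem (real m) - stirling_rem (real n)) < e"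
    proof (intro exI allI impI)
      fix m n assume "m \<ge> K" "n \<ge> K"
      from K[OF this(1)] K[OF this(2)] close[of "real m" "real n"]
      show "norm (stirling_rem (real m) - stirling_rem (real n)) < e" by (auto simp del: One_nat_def)
    qed
  qed
  then obtain \<rho> where \<rho>: "(\<lambda>n. stirling_rem (real n)) \<longlonglongrightarrow> \<rho>"
    using Cauchy_convergent_iff convergent_def by blast
  have lim: "\<bar>stirling_rem x - \<rho>\<bar> \<le> 1 / (x - 1)" if "x \<ge> x0" for x
  proof -
    have "(\<lambda>n. \<bar>stirling_rem x - stirling_rem (real n)\<bar>) \<longlonglongrightarrow> \<bar>stirling_rem x - \<rho>\<bar>"
      by (intro tendsto_intros \<rho>)
    moreover have "(\<lambda>n. 1 / (x - 1) + 1 / (real n - 1)) \<longlonglongrightarrow> 1 / (x - 1) + 0"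
      by (intro tendsto_intros) real_asymp
    moreover have "eventually (\<lambda>n. \<bar>stirling_rem x - stirling_rem (real n)\<bar> \<le> 1 / (x - 1) + 1 / (real n - 1)) at_top"
      using eventually_ge_at_top[of "nat \<lceil>x0\<rceil>"]
      by eventually_elim (intro close that, linarith)
    ultimately have "\<bar>stirling_rem x - \<rho>\<bar> \<le> 1 / (x - 1) + 0"
      using tendsto_le sequentially_bot by blast
    then show ?thesis by simp
  qed
  have "((\<lambda>x. stirling_rem x - \<rho>) \<longlongrightarrow> 0) at_top"
  proof (rule Lim_null_comparison)
    show "eventually (\<lambda>x. norm (stirling_rem x - \<rho>) \<le> 1 / (x - 1)) at_top"
      using eventually_ge_at_top[of x0] by eventually_elim (simp add: lim)
    show "((\<lambda>x::real. 1 / (x - 1)) \<longlongrightarrow> 0) at_top" by real_asymp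
  qed
  then show ?thesis using LIM_zero_iff by blast
qed

text \<open>Convergence leaves the constant open. Legendre's duplication formula makes
  \<open>stirling_rem z + stirling_rem (z + 1/2) - stirling_rem (2 * z)\<close> elementary, and its
  limit is \<rho> + \<rho> - \<rho> = \<rho>.\<close>

lemma stirling_rem_tendsto: "(stirling_rem \<longlongrightarrow> ln (2 * pi) / 2) at_top"
proof -
  obtain \<rho> where \<rho>: "(stirling_rem \<longlongrightarrow> \<rho>) at_top" using stirling_rem_convergent by blast
  have "((\<lambda>z. stirling_rem z + stirling_rem (z + 1/2) - stirling_rem (2 * z)) \<longlongrightarrow> \<rho> + \<rho> - \<rho>) at_top"
  proof (intro tendsto_add tendsto_diff \<rho>)
    show "((\<lambda>z. stirling_rem (z + 1/2)) \<longlongrightarrow> \<rho>) at_top"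
      by (rule filterlim_compose[OF \<rho>]) real_asymp
    show "((\<lambda>z. stirling_rem (2 * z)) \<longlongrightarrow> \<rho>) at_top"
      by (rule filterlim_compose[OF \<rho>]) real_asymp
  qed
  moreover have "eventually (\<lambda>z. stirling_rem z + stirling_rem (z + 1/2) - stirling_rem (2 * z) =
      (1 - 2 * z) * ln 2 + ln pi / 2 - (z - 1/2) * ln z - z * ln (z + 1/2) + 1/2 + (2 * z - 1/2) * ln (2 * z)) at_top"
    using eventually_gt_at_top[of 0]
  proof eventually_elim
    case (elim z)
    have nz: "complex_of_real z \<notin> \<int>\<^sub>\<le>\<^sub>0" "complex_of_real z + 1/2 \<notin> \<int>\<^sub>\<le>\<^sub>0"
      using elim by (auto elim!: nonpos_Ints_cases simp: complex_eq_iff)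
    have "complex_of_real (Gamma z * Gamma (z + 1/2)) = of_real (exp ((1 - 2 * z) * ln 2) * sqrt pi * Gamma (2 * z))"
      using Gamma_legendre_duplication[OF nz]
      by (simp add: Gamma_complex_of_real[symmetric] exp_of_real[symmetric])
    then have "Gamma z * Gamma (z + 1/2) = exp ((1 - 2 * z) * ln 2) * sqrt pi * Gamma (2 * z)"
      unfolding of_real_eq_iff .
    then have "ln (Gamma z * Gamma (z + 1/2)) = ln (exp ((1 - 2 * z) * ln 2) * sqrt pi * Gamma (2 * z))" by simp
    moreover have "Gamma z > 0" "Gamma (z + 1/2) > 0" "Gamma (2 * z) > 0"
      using elim by (auto intro!: Gamma_real_pos)
    ultimately have "ln (Gamma z) + ln (Gamma (z + 1/2)) = (1 - 2 * z) * ln 2 + ln pi / 2 + ln (Gamma (2 * z))"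
      by (simp add: ln_mult ln_sqrt)
    then show ?case by (simp add: stirling_rem_def algebra_simps)
  qed
  ultimately have "((\<lambda>z. (1 - 2 * z) * ln 2 + ln pi / 2 - (z - 1/2) * ln z - z * ln (z + 1/2) + 1/2 + (2 * z - 1/2) * ln (2 * z)) \<longlongrightarrow> \<rho>) at_top"
    by (simp cong: filterlim_cong)
  moreover have "((\<lambda>z. (1 - 2 * z) * ln 2 + ln pi / 2 - (z - 1/2) * ln z - z * ln (z + 1/2) + 1/2 + (2 * z - 1/2) * ln (2 * z)) \<longlongrightarrow> ln pi / 2 + ln 2 / 2) at_top"
    by (real_asymp simp: field_simps)
  ultimately have "\<rho> = ln pi / 2 + ln 2 / 2" using tendsto_unique trivial_limit_at_top_linorder by blast
  then show ?thesis using \<rho> by (simp add: ln_mult add_divide_distrib add.commute)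
qed

theorem Gamma_stirling:
  "((\<lambda>x. Gamma (x + 1) / (sqrt (2 * pi * x) * exp (- x) * x powr x)) \<longlongrightarrow> 1) at_top"
proof -
  have "((\<lambda>x. exp (stirling_rem x - ln (2 * pi) / 2)) \<longlongrightarrow> exp (ln (2 * pi) / 2 - ln (2 * pi) / 2)) at_top"
    by (intro tendsto_intros stirling_rem_tendsto)
  moreover have "eventually (\<lambda>x. exp (stirling_rem x - ln (2 * pi) / 2) = Gamma (x + 1) / (sqrt (2 * pi * x) * exp (- x) * x powr x)) at_top"
    using eventually_gt_at_top[of 0]
  proof eventually_elim
    case (elim x)
    have "Gamma (x + 1) = x * Gamma x" using elim by (subst Gamma_plus1) (auto simp: nonpos_Ints_def)
    moreover have "sqrt (2 * pi * x) = exp (ln (2 * pi) / 2) * exp (ln x / 2)"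
      using elim by (simp add: ln_sqrt[symmetric] real_sqrt_mult del: ln_mult)
    moreover have "Gamma x > 0" using elim by simp
    moreover have "x = exp (ln x)" using elim by simp
    ultimately have "Gamma (x + 1) / (sqrt (2 * pi * x) * exp (- x) * x powr x) =
       exp (ln x) * exp (ln (Gamma x)) / (exp (ln (2 * pi) / 2) * exp (ln x / 2) * exp (- x) * exp (x * ln x))"
      using elim by (simp add: powr_def)
    also have "\<dots> = exp (stirling_rem x - ln (2 * pi) / 2)"
      by (simp add: stirling_rem_def exp_add[symmetric] exp_diff[symmetric] algebra_simps)
    finally show ?case by simp
  qed
  ultimately show ?thesis by (simp cong: filterlim_cong)
qed

section \<open>Poisson approximation of void probabilities\<close>

text \<open>Powers of \<open>z\<close> lie in the unit interval, so they differ by at most 1, and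
  unequal sets differ in at least one element. In this way the number of additional events bounds
  the change of the generating function.\<close>

lemma abs_power_card_diff_le:
  fixes z :: real
  assumes "finite B" "A \<subseteq> B" "0 \<le> z" "z \<le> 1"
  shows "\<bar>z ^ card A - z ^ card B\<bar> \<le> real (card (B - A))"
proof (cases "A = B")
  case False
  have "0 \<le> z ^ card A" "z ^ card A \<le> 1" "0 \<le> z ^ card B" "z ^ card B \<le> 1"
    using assms by (auto intro: power_le_one)
  then have "\<bar>z ^ card A - z ^ card B\<bar> \<le> 1" by linarith
  moreover have "card (B - A) > 0" using assms False by (auto simp: card_gt_0_iff)
  ultimately show ?thesis by linarith
qed simp

context prob_space
begin

lemma measurable_card_occurring:
  assumes "finite J" "\<And>j. j \<in> J \<Longrightarrow> A j \<in> events"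
  shows "(\<lambda>\<omega>. card {j \<in> J. \<omega> \<in> A j}) \<in> measurable M (count_space UNIV)"
proof -
  have "(\<lambda>\<omega>. card {j \<in> J. \<omega> \<in> A j}) = (\<lambda>\<omega>. \<Sum>j\<in>J. if \<omega> \<in> A j then 1 else 0)"
    using assms by (auto simp: fun_eq_iff sum.If_cases Int_def)
  moreover have "(\<lambda>\<omega>. \<Sum>j\<in>J. if \<omega> \<in> A j then 1 else 0 :: nat) \<in> measurable M (count_space UNIV)"
    using assms by (intro measurable_sum_nat measurable_If_set) auto
  ultimately show ?thesis by simp
qed

text \<open>At most \<open>card I\<close> events occur, so the expectation is a polynomial in
  \<open>z\<close>. The derivative is split over the events because each of them will be decoupled
  from its own neighbourhood. The truncated \<open>N - 1\<close> is harmless at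
  \<open>N = 0\<close>, where all indicators vanish.\<close>

lemma expectation_power_card_has_derivative:
  fixes A :: "'i \<Rightarrow> 'a set" and z :: real
  assumes I: "finite I" and A: "\<And>i. i \<in> I \<Longrightarrow> A i \<in> events"
  shows "((\<lambda>z. expectation (\<lambda>\<omega>. z ^ card {i \<in> I. \<omega> \<in> A i})) has_real_derivative
      (\<Sum>i\<in>I. expectation (\<lambda>\<omega>. indicator (A i) \<omega> * z ^ (card {i \<in> I. \<omega> \<in> A i} - 1)))) (at z)"
proof -
  define N where "N \<omega> = card {i \<in> I. \<omega> \<in> A i}" for \<omega>
  have N_le: "N \<omega> \<le> card I" for \<omega>
    unfolding N_def using I by (intro card_mono) auto
  have [measurable]: "N \<in> measurable M (count_space UNIV)"
    unfolding N_def[abs_def] by (rule measurable_card_occurring[OF I A])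
  have int: "integrable M (\<lambda>\<omega>. f (N \<omega>))" for f :: "nat \<Rightarrow> real"
  proof (rule integrable_const_bound[where B = "\<Sum>c\<le>card I. \<bar>f c\<bar>"])
    show "AE \<omega> in M. norm (f (N \<omega>)) \<le> (\<Sum>c\<le>card I. \<bar>f c\<bar>)"
      using N_le by (intro AE_I2) (auto intro: member_le_sum[of _ "{..card I}" "\<lambda>c. \<bar>f c\<bar>"])
  qed measurable
  have split: "expectation (\<lambda>\<omega>. f (N \<omega>)) = (\<Sum>c\<le>card I. prob (N -` {c} \<inter> space M) * f c)" for f :: "nat \<Rightarrow> real"
  proof -
    have "expectation (\<lambda>\<omega>. f (N \<omega>)) = expectation (\<lambda>\<omega>. \<Sum>c\<le>card I. indicator (N -` {c} \<inter> space M) \<omega> * f c)"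
    proof (rule Bochner_Integration.integral_cong)
      fix \<omega> assume \<omega>: "\<omega> \<in> space M"
      have "(\<Sum>c\<le>card I. indicator (N -` {c} \<inter> space M) \<omega> * f c) = (\<Sum>c\<le>card I. if c = N \<omega> then f c else 0)"
        using \<omega> by (intro sum.cong) (auto simp: indicator_def)
      also have "\<dots> = f (N \<omega>)" using N_le by simp
      finally show "f (N \<omega>) = (\<Sum>c\<le>card I. indicator (N -` {c} \<inter> space M) \<omega> * f c)" by simp
    qed simp
    also have "\<dots> = (\<Sum>c\<le>card I. expectation (\<lambda>\<omega>. indicator (N -` {c} \<inter> space M) \<omega> * f c))"
      by (rule Bochner_Integration.integral_sum)
        (auto intro!: integrable_mult_left integrable_real_indicator simp: emeasure_eq_measure)
    also have "\<dots> = (\<Sum>c\<le>card I. prob (N -` {c} \<inter> space M) * f c)"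
      by (intro sum.cong) auto
    finally show ?thesis .
  qed
  have "((\<lambda>z. \<Sum>c\<le>card I. prob (N -` {c} \<inter> space M) * z ^ c) has_real_derivative
      (\<Sum>c\<le>card I. prob (N -` {c} \<inter> space M) * (real c * z ^ (c - 1)))) (at z)"
    by (auto intro!: derivative_eq_intros sum.cong)
  moreover have e1: "(\<lambda>z. expectation (\<lambda>\<omega>. z ^ N \<omega>)) = (\<lambda>z. \<Sum>c\<le>card I. prob (N -` {c} \<inter> space M) * z ^ c)"
    by (rule ext) (rule split)
  moreover have e2: "expectation (\<lambda>\<omega>. real (N \<omega>) * z ^ (N \<omega> - 1)) =
      (\<Sum>c\<le>card I. prob (N -` {c} \<inter> space M) * (real c * z ^ (c - 1)))"
    by (rule split)
  ultimately have "((\<lambda>z. expectation (\<lambda>\<omega>. z ^ N \<omega>)) has_real_derivative expectation (\<lambda>\<omega>. real (N \<omega>) * z ^ (N \<omega> - 1))) (at z)"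
    by (simp only:)
  also have "expectation (\<lambda>\<omega>. real (N \<omega>) * z ^ (N \<omega> - 1)) = expectation (\<lambda>\<omega>. \<Sum>i\<in>I. indicator (A i) \<omega> * z ^ (N \<omega> - 1))"
  proof (rule arg_cong[where f = expectation], rule ext)
    fix \<omega>
    have "real (N \<omega>) = (\<Sum>i\<in>I. indicator (A i) \<omega>)"
      using I by (simp add: N_def indicator_def sum.If_cases Int_def)
    then show "real (N \<omega>) * z ^ (N \<omega> - 1) = (\<Sum>i\<in>I. indicator (A i) \<omega> * z ^ (N \<omega> - 1))"
      by (simp add: sum_distrib_right)
  qed
  also have "\<dots> = (\<Sum>i\<in>I. expectation (\<lambda>\<omega>. indicator (A i) \<omega> * z ^ (N \<omega> - 1)))"
  proof (rule Bochner_Integration.integral_sum)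
    fix i assume "i \<in> I"
    then have "A i \<in> events" by (rule A)
    then show "integrable M (\<lambda>\<omega>. indicator (A i) \<omega> * z ^ (N \<omega> - 1))"
      using integrable_mult_indicator[OF _ int[of "\<lambda>c. z ^ (c - 1)"], of "A i"] by simp
  qed
  finally show ?thesis by (simp add: N_def)
qed

text \<open>
  The generating function \<open>\<psi> z = E (z ^ N)\<close> of the number \<open>N\<close> of occurring events almost
  satisfies the Poisson equation \<open>\<psi>' = \<mu> \<psi>\<close>, with an error controlled by the dependence between
  the events; integrating from \<open>z = 1\<close> to \<open>z = 0\<close> gives \<open>\<psi> 0 = P (N = 0)\<close>.
\<close>

theorem poisson_void_probability:
  fixes A :: "'i \<Rightarrow> 'a set" and nb :: "'i \<Rightarrow> 'i set"
  assumes I: "finite I" and A: "\<And>i. i \<in> I \<Longrightarrow> A i \<in> events"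
    and nb: "\<And>i. i \<in> I \<Longrightarrow> i \<in> nb i" "\<And>i. i \<in> I \<Longrightarrow> nb i \<subseteq> I"
    and indep: "\<And>i z. i \<in> I \<Longrightarrow> 0 \<le> z \<Longrightarrow> z \<le> 1 \<Longrightarrow>
      expectation (\<lambda>\<omega>. indicator (A i) \<omega> * z ^ card {j \<in> I - nb i. \<omega> \<in> A j}) =
      prob (A i) * expectation (\<lambda>\<omega>. z ^ card {j \<in> I - nb i. \<omega> \<in> A j})"
  shows "\<bar>prob (space M - (\<Union>i\<in>I. A i)) - exp (- (\<Sum>i\<in>I. prob (A i)))\<bar> \<le>
    (\<Sum>i\<in>I. \<Sum>j\<in>nb i. prob (A i) * prob (A j)) + (\<Sum>i\<in>I. \<Sum>j\<in>nb i - {i}. prob (A i \<inter> A j))"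
    (is "_ \<le> ?B")
proof -
  define \<mu> where "\<mu> = (\<Sum>i\<in>I. prob (A i))"
  define N where "N \<omega> = card {i \<in> I. \<omega> \<in> A i}" for \<omega>
  define N' where "N' i \<omega> = card {j \<in> I - nb i. \<omega> \<in> A j}" for i \<omega>
  define \<psi> where "\<psi> z = expectation (\<lambda>\<omega>. z ^ N \<omega>)" for z :: real
  define \<psi>' where "\<psi>' z = (\<Sum>i\<in>I. expectation (\<lambda>\<omega>. indicator (A i) \<omega> * z ^ (N \<omega> - 1)))" for z :: real
  have deriv: "(\<psi> has_real_derivative \<psi>' z) (at z)" for z
    unfolding \<psi>_def[abs_def] \<psi>'_def N_def using I A by (rule expectation_power_card_has_derivative)
  have [measurable]: "N \<in> measurable M (count_space UNIV)"
    unfolding N_def[abs_def] by (rule measurable_card_occurring[OF I A])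
  have [measurable]: "N' i \<in> measurable M (count_space UNIV)" for i
    unfolding N'_def[abs_def] by (rule measurable_card_occurring) (use I A in auto)
  have int: "integrable M (\<lambda>\<omega>. z ^ f \<omega>)" if "0 \<le> z" "z \<le> 1" "f \<in> measurable M (count_space UNIV)"
    for z :: real and f :: "'a \<Rightarrow> nat"
    using that by (intro integrable_const_bound[where B = 1]) (auto intro!: AE_I2 power_le_one)
  have intA: "integrable M (\<lambda>\<omega>. indicator (A i) \<omega> * z ^ f \<omega>)"
    if "0 \<le> z" "z \<le> 1" "f \<in> measurable M (count_space UNIV)" "i \<in> I"
    for z :: real and f :: "'a \<Rightarrow> nat" and i
    using integrable_mult_indicator[OF _ int[OF that(1-3)], of "A i"] A[OF that(4)] by simp
  have ind_int: "integrable M (indicator B :: _ \<Rightarrow> real)" if "B \<in> events" for B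
    using that by (auto intro!: integrable_real_indicator simp: emeasure_eq_measure)
  \<comment> \<open>For each \<open>i\<close> the count is replaced by \<open>N' i\<close>, which
    omits the neighbours of \<open>i\<close> and thus decouples from \<open>A i\<close>; the
    expectation then factors, and the full count is restored. The two replacements cost
    \<open>bound1\<close> and \<open>bound2\<close>.\<close>
  have near: "\<bar>\<psi>' z - \<mu> * \<psi> z\<bar> \<le> ?B" if z: "0 \<le> z" "z \<le> 1" for z
  proof -
    have one: "\<bar>expectation (\<lambda>\<omega>. indicator (A i) \<omega> * z ^ (N \<omega> - 1)) - prob (A i) * \<psi> z\<bar> \<le>
        (\<Sum>j\<in>nb i. prob (A i) * prob (A j)) + (\<Sum>j\<in>nb i - {i}. prob (A i \<inter> A j))" if i: "i \<in> I" for i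
    proof -
      have fin: "finite (nb i)" using nb(2)[OF i] I finite_subset by blast
      let ?S = "\<lambda>\<omega>. {j \<in> I. \<omega> \<in> A j}" and ?S' = "\<lambda>\<omega>. {j \<in> I - nb i. \<omega> \<in> A j}"
      have finS: "finite (?S \<omega>)" for \<omega> using I by simp
      have count: "real (card {j \<in> K. \<omega> \<in> A j}) = (\<Sum>j\<in>K. indicator (A j) \<omega>)" if "finite K" for K \<omega>
        using that by (simp add: indicator_def sum.If_cases Int_def)
      \<comment> \<open>On \<open>A i\<close> the exponent \<open>N - 1\<close> counts the events
        other than \<open>i\<close>, so only neighbours different from \<open>i\<close> contribute.
        This is why the pair sum runs over \<open>nb i - {i}\<close>.\<close>
      have bound1: "\<bar>indicator (A i) \<omega> * z ^ N' i \<omega> - indicator (A i) \<omega> * z ^ (N \<omega> - 1)\<bar> \<le>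
          (\<Sum>j\<in>nb i - {i}. indicator (A i \<inter> A j) \<omega>)" for \<omega>
      proof (cases "\<omega> \<in> A i")
        case True
        have N1: "N \<omega> - 1 = card (?S \<omega> - {i})" using True i by (simp add: N_def)
        have "\<bar>z ^ N' i \<omega> - z ^ (N \<omega> - 1)\<bar> \<le> real (card ((?S \<omega> - {i}) - ?S' \<omega>))"
          unfolding N1 N'_def using finS z nb(1)[OF i] by (intro abs_power_card_diff_le) auto
        also have "(?S \<omega> - {i}) - ?S' \<omega> = {j \<in> nb i - {i}. \<omega> \<in> A j}" using nb(2)[OF i] by auto
        also have "real (card \<dots>) = (\<Sum>j\<in>nb i - {i}. indicator (A i \<inter> A j) \<omega>)"
          using fin True by (subst count) (auto simp: indicator_def)
        finally show ?thesis using True by simp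
      qed (auto intro!: sum_nonneg)
      have bound2: "\<bar>z ^ N' i \<omega> - z ^ N \<omega>\<bar> \<le> (\<Sum>j\<in>nb i. indicator (A j) \<omega>)" for \<omega>
      proof -
        have "\<bar>z ^ N' i \<omega> - z ^ N \<omega>\<bar> \<le> real (card (?S \<omega> - ?S' \<omega>))"
          unfolding N_def N'_def using finS z by (intro abs_power_card_diff_le) auto
        also have "?S \<omega> - ?S' \<omega> = {j \<in> nb i. \<omega> \<in> A j}" using nb(2)[OF i] by auto
        finally show ?thesis using count[OF fin] by simp
      qed
      have "\<bar>expectation (\<lambda>\<omega>. indicator (A i) \<omega> * z ^ N' i \<omega>) - expectation (\<lambda>\<omega>. indicator (A i) \<omega> * z ^ (N \<omega> - 1))\<bar>
          = \<bar>expectation (\<lambda>\<omega>. indicator (A i) \<omega> * z ^ N' i \<omega> - indicator (A i) \<omega> * z ^ (N \<omega> - 1))\<bar>"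
        using z i by (subst Bochner_Integration.integral_diff) (auto intro!: intA)
      also have "\<dots> \<le> expectation (\<lambda>\<omega>. \<bar>indicator (A i) \<omega> * z ^ N' i \<omega> - indicator (A i) \<omega> * z ^ (N \<omega> - 1)\<bar>)"
        by (rule integral_abs_bound)
      also have "\<dots> \<le> expectation (\<lambda>\<omega>. \<Sum>j\<in>nb i - {i}. indicator (A i \<inter> A j) \<omega>)"
        using z i A nb(2)[OF i]
        by (intro integral_mono bound1 integrable_abs Bochner_Integration.integrable_diff intA Bochner_Integration.integrable_sum ind_int) auto
      also have "\<dots> = (\<Sum>j\<in>nb i - {i}. prob (A i \<inter> A j))"
      proof -
        have "A i \<inter> A j \<inter> space M = A i \<inter> A j" if "j \<in> nb i" for j
          using A[OF i] sets.sets_into_space by blast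
        then show ?thesis using i A nb(2)[OF i]
          by (subst Bochner_Integration.integral_sum) (auto intro!: ind_int sum.cong)
      qed
      finally have e1: "\<bar>expectation (\<lambda>\<omega>. indicator (A i) \<omega> * z ^ N' i \<omega>) - expectation (\<lambda>\<omega>. indicator (A i) \<omega> * z ^ (N \<omega> - 1))\<bar>
         \<le> (\<Sum>j\<in>nb i - {i}. prob (A i \<inter> A j))" .
      have "\<bar>expectation (\<lambda>\<omega>. z ^ N' i \<omega>) - \<psi> z\<bar> = \<bar>expectation (\<lambda>\<omega>. z ^ N' i \<omega> - z ^ N \<omega>)\<bar>"
        unfolding \<psi>_def using z by (subst Bochner_Integration.integral_diff) (auto intro!: int)
      also have "\<dots> \<le> expectation (\<lambda>\<omega>. \<bar>z ^ N' i \<omega> - z ^ N \<omega>\<bar>)" by (rule integral_abs_bound)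
      also have "\<dots> \<le> expectation (\<lambda>\<omega>. \<Sum>j\<in>nb i. indicator (A j) \<omega>)"
        using z A nb(2)[OF i]
        by (intro integral_mono bound2 integrable_abs Bochner_Integration.integrable_diff int Bochner_Integration.integrable_sum ind_int) auto
      also have "\<dots> = (\<Sum>j\<in>nb i. prob (A j))"
      proof -
        have "A j \<inter> space M = A j" if "j \<in> nb i" for j
          using A[of j] nb(2)[OF i] that sets.sets_into_space by blast
        then show ?thesis using A nb(2)[OF i]
          by (subst Bochner_Integration.integral_sum) (auto intro!: ind_int sum.cong)
      qed
      finally have "prob (A i) * \<bar>expectation (\<lambda>\<omega>. z ^ N' i \<omega>) - \<psi> z\<bar> \<le> prob (A i) * (\<Sum>j\<in>nb i. prob (A j))"
        by (intro mult_left_mono) auto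
      then have e2: "\<bar>prob (A i) * expectation (\<lambda>\<omega>. z ^ N' i \<omega>) - prob (A i) * \<psi> z\<bar> \<le> (\<Sum>j\<in>nb i. prob (A i) * prob (A j))"
        by (simp add: sum_distrib_left abs_mult right_diff_distrib[symmetric])
      have e3: "expectation (\<lambda>\<omega>. indicator (A i) \<omega> * z ^ N' i \<omega>) = prob (A i) * expectation (\<lambda>\<omega>. z ^ N' i \<omega>)"
        unfolding N'_def using indep[OF i z] .
      show ?thesis using e1 e2 e3 by linarith
    qed
    have "\<psi>' z - \<mu> * \<psi> z = (\<Sum>i\<in>I. expectation (\<lambda>\<omega>. indicator (A i) \<omega> * z ^ (N \<omega> - 1)) - prob (A i) * \<psi> z)"
      by (simp add: \<psi>'_def \<mu>_def sum_subtractf sum_distrib_right)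
    also have "\<bar>\<dots>\<bar> \<le> (\<Sum>i\<in>I. \<bar>expectation (\<lambda>\<omega>. indicator (A i) \<omega> * z ^ (N \<omega> - 1)) - prob (A i) * \<psi> z\<bar>)"
      by (rule sum_abs)
    also have "\<dots> \<le> (\<Sum>i\<in>I. (\<Sum>j\<in>nb i. prob (A i) * prob (A j)) + (\<Sum>j\<in>nb i - {i}. prob (A i \<inter> A j)))"
      by (intro sum_mono one)
    also have "\<dots> = ?B" by (simp add: sum.distrib)
    finally show ?thesis .
  qed
  have \<mu>0: "\<mu> \<ge> 0" unfolding \<mu>_def by (intro sum_nonneg) auto
  \<comment> \<open>Integrating factor for the equation \<open>\<psi>' = \<mu> * \<psi>\<close>; the
    mean value theorem on the unit interval transfers the error in the equation to the endpoint
    values.\<close>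
  have "((\<lambda>z. exp (- \<mu> * z) * \<psi> z) has_real_derivative exp (- \<mu> * z) * (\<psi>' z - \<mu> * \<psi> z)) (at z)" for z
    by (auto intro!: derivative_eq_intros deriv simp: algebra_simps)
  then obtain z where z: "0 < z" "z < 1"
    "exp (- \<mu> * 1) * \<psi> 1 - exp (- \<mu> * 0) * \<psi> 0 = (1 - 0) * (exp (- \<mu> * z) * (\<psi>' z - \<mu> * \<psi> z))"
    using MVT2[of 0 1 "\<lambda>z. exp (- \<mu> * z) * \<psi> z" "\<lambda>z. exp (- \<mu> * z) * (\<psi>' z - \<mu> * \<psi> z)"] by auto
  have "\<bar>exp (- \<mu>) * \<psi> 1 - \<psi> 0\<bar> = exp (- \<mu> * z) * \<bar>\<psi>' z - \<mu> * \<psi> z\<bar>"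
    using z(3) by (simp add: abs_mult)
  also have "\<dots> \<le> 1 * \<bar>\<psi>' z - \<mu> * \<psi> z\<bar>"
    using \<mu>0 z by (intro mult_right_mono) auto
  also have "\<dots> \<le> ?B" using near[of z] z by simp
  finally have main: "\<bar>exp (- \<mu>) * \<psi> 1 - \<psi> 0\<bar> \<le> ?B" .
  have "\<psi> 1 = 1" by (simp add: \<psi>_def prob_space)
  \<comment> \<open>As \<open>0 ^ 0 = 1\<close>, the random variable \<open>0 ^ N\<close> is the
    indicator that no event occurs.\<close>
  moreover have "\<psi> 0 = expectation (indicator (space M - (\<Union>i\<in>I. A i)))"
    unfolding \<psi>_def
  proof (rule Bochner_Integration.integral_cong)
    fix \<omega> assume "\<omega> \<in> space M"
    moreover have "N \<omega> = 0 \<longleftrightarrow> \<omega> \<notin> (\<Union>i\<in>I. A i)" using I by (auto simp: N_def)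
    ultimately show "(0::real) ^ N \<omega> = indicator (space M - (\<Union>i\<in>I. A i)) \<omega>"
      by (auto simp: indicator_def)
  qed simp
  moreover have "space M - (\<Union>i\<in>I. A i) \<in> events" using I A by auto
  ultimately show ?thesis using main by (simp add: \<mu>_def abs_minus_commute)
qed

end

section \<open>Distribution functions of regular growth\<close>

text \<open>Integration by parts via Fubini: \<open>(w - y) powr a\<close> is the integral of
  \<open>a * u powr (a - 1)\<close> over \<open>u\<close> between 0 and \<open>w - y\<close>. The
  integral against \<open>\<nu>\<close> becomes one against its distribution function, into which
  bounds can be inserted.\<close>

lemma nn_integral_max_powr:
  fixes \<nu> :: "real measure"
  assumes \<nu>: "finite_measure \<nu>" and [measurable_cong, simp]: "sets \<nu> = sets borel"
    and a: "a > 0" and B: "B \<ge> 0"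
  shows "(\<integral>\<^sup>+y. ennreal (B * max 0 (w - y) powr a) \<partial>\<nu>) =
    (\<integral>\<^sup>+u. ennreal (B * a * u powr (a - 1)) * indicator {0..} u * emeasure \<nu> {..w - u} \<partial>lborel)"
proof -
  interpret \<nu>: finite_measure \<nu> by fact
  interpret P: pair_sigma_finite \<nu> lborel ..
  let ?f = "\<lambda>u. ennreal (B * a * u powr (a - 1)) * indicator {0..} u"
  have [simp]: "space \<nu> = UNIV" using sets_eq_imp_space_eq[of \<nu> borel] by simp
  have inner: "(\<integral>\<^sup>+u. ?f u * indicator {z. snd z + fst z \<le> w} (y, u) \<partial>lborel) = ennreal (B * max 0 (w - y) powr a)" for y
  proof -
    let ?c = "max 0 (w - y)"
    have "((\<lambda>u. B * a * u powr (a - 1)) has_integral B * a * (?c powr (a - 1 + 1) / (a - 1 + 1))) {0..?c}"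
      using a by (intro has_integral_mult_right has_integral_powr_from_0) auto
    then have "((\<lambda>u. B * a * u powr (a - 1)) has_integral B * ?c powr a) {0..?c}" using a by simp
    then have "(\<integral>\<^sup>+u. ennreal (B * a * u powr (a - 1)) * indicator {0..?c} u \<partial>lborel) = ennreal (B * ?c powr a)"
      using a B by (intro nn_integral_has_integral_lebesgue') auto
    moreover have "ennreal (B * a * u powr (a - 1)) * indicator {0..?c} u =
        ?f u * indicator {z. snd z + fst z \<le> w} (y, u)" for u
      by (cases "u = 0") (auto simp: indicator_def)
    ultimately show ?thesis by simp
  qed
  have "(\<integral>\<^sup>+y. ennreal (B * max 0 (w - y) powr a) \<partial>\<nu>) =
      (\<integral>\<^sup>+y. \<integral>\<^sup>+u. ?f u * indicator {z. snd z + fst z \<le> w} (y, u) \<partial>lborel \<partial>\<nu>)"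
    by (simp only: inner)
  also have "\<dots> = (\<integral>\<^sup>+u. \<integral>\<^sup>+y. ?f u * indicator {z. snd z + fst z \<le> w} (y, u) \<partial>\<nu> \<partial>lborel)"
    by (intro P.Fubini'[symmetric]) measurable
  also have "\<dots> = (\<integral>\<^sup>+u. ?f u * emeasure \<nu> {..w - u} \<partial>lborel)"
  proof (intro nn_integral_cong)
    fix u :: real
    have "(\<integral>\<^sup>+y. ?f u * indicator {z. snd z + fst z \<le> w} (y, u) \<partial>\<nu>) = (\<integral>\<^sup>+y. ?f u * indicator {..w - u} y \<partial>\<nu>)"
      by (intro nn_integral_cong) (auto simp: indicator_def)
    then show "(\<integral>\<^sup>+y. ?f u * indicator {z. snd z + fst z \<le> w} (y, u) \<partial>\<nu>) = ?f u * emeasure \<nu> {..w - u}"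
      by (simp add: nn_integral_cmult_indicator)
  qed
  finally show ?thesis .
qed

text \<open>The Beta integral rescaled to the interval from 0 to \<open>w\<close>. Written with
  Gamma at arguments shifted by 1, the factor telescopes under repeated convolution.\<close>

lemma nn_integral_beta_scaled:
  assumes a: "a > 0" and b: "b > 0" and w: "w > 0" and C: "C \<ge> 0"
  shows "(\<integral>\<^sup>+u. ennreal (C * a * u powr (a - 1) * (w - u) powr b) * indicator {0..w} u \<partial>lborel) =
    ennreal (C * (Gamma (a + 1) * Gamma (b + 1) / Gamma (a + b + 1)) * w powr (a + b))"
proof -
  have "((\<lambda>t. t powr (a - 1) * (1 - t) powr (b + 1 - 1)) has_integral Beta a (b + 1)) {0..1}"
    using a b by (intro has_integral_Beta_real) auto
  then have "((\<lambda>t. t powr (a - 1) * (1 - t) powr b) has_integral Beta a (b + 1)) (cbox 0 1)" by simp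
  from has_integral_affinity'[OF this, of "1 / w" 0]
  have 1: "((\<lambda>u. (u / w) powr (a - 1) * (1 - u / w) powr b) has_integral w * Beta a (b + 1)) {0..w}"
    using w by (simp add: mult.commute)
  have 2: "((\<lambda>u. C * a * w powr (a - 1 + b) * ((u / w) powr (a - 1) * (1 - u / w) powr b))
      has_integral C * a * w powr (a - 1 + b) * (w * Beta a (b + 1))) {0..w}"
    using 1 by (rule has_integral_mult_right)
  have 3: "C * a * w powr (a - 1 + b) * ((u / w) powr (a - 1) * (1 - u / w) powr b) =
      C * a * u powr (a - 1) * (w - u) powr b" if "u \<in> {0..w}" for u
  proof -
    have "(w - u) powr b = (w * (1 - u / w)) powr b" using w by (simp add: right_diff_distrib)
    also have "\<dots> = w powr b * (1 - u / w) powr b" using w that by (intro powr_mult)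
    finally show ?thesis using w that by (simp add: powr_add powr_divide)
  qed
  have 4: "a * w powr (a - 1 + b) * (w * Beta a (b + 1)) =
      Gamma (a + 1) * Gamma (b + 1) / Gamma (a + b + 1) * w powr (a + b)"
  proof -
    have "w powr (a - 1 + b) * w = w powr (a + b)"
      using w powr_add[of w "a - 1 + b" 1] by simp
    moreover have "Gamma (a + 1) = a * Gamma a" using a by (subst Gamma_plus1) (auto simp: nonpos_Ints_def)
    ultimately show ?thesis by (simp add: Beta_def add_ac mult_ac)
  qed
  have "((\<lambda>u. C * a * u powr (a - 1) * (w - u) powr b) has_integral
      C * a * w powr (a - 1 + b) * (w * Beta a (b + 1))) {0..w}"
    by (rule has_integral_eq[OF 3 2])
  also have "C * a * w powr (a - 1 + b) * (w * Beta a (b + 1)) =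
      C * (Gamma (a + 1) * Gamma (b + 1) / Gamma (a + b + 1)) * w powr (a + b)"
    using arg_cong[OF 4, of "\<lambda>x. C * x"] by (simp only: mult.assoc)
  finally show ?thesis
    using a C by (intro nn_integral_has_integral_lebesgue') auto
qed

section \<open>One convolution step for power bounds on distribution functions\<close>

context
  fixes \<mu> \<nu> :: "real measure" and a b A B w :: real
  assumes dist: "real_distribution \<mu>" "real_distribution \<nu>"
    and pos: "measure \<mu> {..0} = 0" "measure \<nu> {..0} = 0"
    and params: "a > 0" "b > 0" "A \<ge> 0" "B \<ge> 0" "w > 0"
begin

interpretation \<mu>: real_distribution \<mu> by (rule dist)
interpretation \<nu>: real_distribution \<nu> by (rule dist)

private lemma emeasure_convolution_cdf:
  "emeasure (convolution \<nu> \<mu>) {..w} = (\<integral>\<^sup>+y. emeasure \<mu> {..w - y} \<partial>\<nu>)"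
proof -
  have "emeasure (convolution \<nu> \<mu>) {..w} = (\<integral>\<^sup>+y. emeasure \<mu> {x. x + y \<in> {..w}} \<partial>\<nu>)"
    by (rule convolution_emeasure) (auto intro: \<mu>.finite_measure_axioms \<nu>.finite_measure_axioms)
  moreover have "{x. x + y \<in> {..w}} = {..w - y}" for y by auto
  ultimately show ?thesis by simp
qed

private lemma emeasure_nonpos: "emeasure \<nu> {..0} = 0" "y \<le> 0 \<Longrightarrow> emeasure \<mu> {..y} = 0"
proof -
  show "emeasure \<nu> {..0} = 0" using pos by (simp add: \<nu>.emeasure_eq_measure)
  show "emeasure \<mu> {..y} = 0" if "y \<le> 0"
    using pos emeasure_mono[of "{..y}" "{..0}" \<mu>] that by (simp add: \<mu>.emeasure_eq_measure)
qed

private lemma AE_pos: "AE y in \<nu>. y > 0"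
proof (rule AE_I)
  show "{y \<in> space \<nu>. \<not> y > 0} \<subseteq> {..0}" by auto
qed (use emeasure_nonpos in auto)

private abbreviation "h u \<equiv> ennreal (B * a * u powr (a - 1)) * emeasure \<nu> {..w - u}"
private abbreviation "h' u \<equiv> ennreal (A * B * a * u powr (a - 1) * (w - u) powr b)"

private lemma nn_integral_max_powr_eq:
  "(\<integral>\<^sup>+y. ennreal (B * max 0 (w - y) powr a) \<partial>\<nu>) = (\<integral>\<^sup>+u. h u * indicator {0..w} u \<partial>lborel)"
proof -
  have "(\<integral>\<^sup>+y. ennreal (B * max 0 (w - y) powr a) \<partial>\<nu>) =
      (\<integral>\<^sup>+u. ennreal (B * a * u powr (a - 1)) * indicator {0..} u * emeasure \<nu> {..w - u} \<partial>lborel)"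
    using params by (intro nn_integral_max_powr) (auto intro: \<nu>.finite_measure_axioms)
  also have "\<dots> = (\<integral>\<^sup>+u. h u * indicator {0..w} u \<partial>lborel)"
  proof (intro nn_integral_cong)
    fix u :: real
    have "emeasure \<nu> {..w - u} = 0" if "u > w"
      using emeasure_nonpos(1) emeasure_mono[of "{..w - u}" "{..0}" \<nu>] that by simp
    then show "ennreal (B * a * u powr (a - 1)) * indicator {0..} u * emeasure \<nu> {..w - u} = h u * indicator {0..w} u"
      by (cases "u > w") (auto simp: indicator_def)
  qed
  finally show ?thesis .
qed

private lemma nn_integral_h':
  "(\<integral>\<^sup>+u. h' u * indicator {0..w} u \<partial>lborel) =
    ennreal (A * B * (Gamma (a + 1) * Gamma (b + 1) / Gamma (a + b + 1)) * w powr (a + b))"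
  using params by (intro nn_integral_beta_scaled) auto

private lemma h_eq: "h u = ennreal (B * a * u powr (a - 1) * measure \<nu> {..w - u})"
  using params by (simp add: \<nu>.emeasure_eq_measure ennreal_mult)

text \<open>The two bounds enter at different stages: the one on \<open>\<mu>\<close> inside the
  convolution integral and, after integration by parts, the one on \<open>\<nu>\<close>. Bounds up
  to \<open>w\<close> are enough because both laws live on the positive half line.\<close>

lemma measure_convolution_cdf_le:
  assumes \<mu>: "\<And>y. 0 < y \<Longrightarrow> y \<le> w \<Longrightarrow> measure \<mu> {..y} \<le> B * y powr a"
    and \<nu>: "\<And>y. 0 < y \<Longrightarrow> y \<le> w \<Longrightarrow> measure \<nu> {..y} \<le> A * y powr b"
  shows "measure (convolution \<nu> \<mu>) {..w} \<le> A * B * (Gamma (a + 1) * Gamma (b + 1) / Gamma (a + b + 1)) * w powr (a + b)"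
proof -
  have "emeasure (convolution \<nu> \<mu>) {..w} \<le> (\<integral>\<^sup>+y. ennreal (B * max 0 (w - y) powr a) \<partial>\<nu>)"
    unfolding emeasure_convolution_cdf
  proof (intro nn_integral_mono_AE, use AE_pos in eventually_elim)
    case (elim y)
    then show ?case
      using \<mu>[of "w - y"] emeasure_nonpos(2)[of "w - y"]
      by (cases "w - y > 0") (auto simp: \<mu>.emeasure_eq_measure intro!: ennreal_leI)
  qed
  also have "\<dots> \<le> (\<integral>\<^sup>+u. h' u * indicator {0..w} u \<partial>lborel)"
    unfolding nn_integral_max_powr_eq
  proof (intro nn_integral_mono)
    fix u :: real
    have "h u \<le> h' u" if "0 \<le> u" "u \<le> w"
    proof (cases "u = 0 \<or> u = w")
      case False
      have "B * a * u powr (a - 1) * measure \<nu> {..w - u} \<le> B * a * u powr (a - 1) * (A * (w - u) powr b)"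
        using params False that by (intro mult_left_mono \<nu>) auto
      then show ?thesis unfolding h_eq by (intro ennreal_leI) (simp add: mult_ac)
    qed (use emeasure_nonpos(1) in auto)
    then show "h u * indicator {0..w} u \<le> h' u * indicator {0..w} u" by (auto simp: indicator_def)
  qed
  finally show ?thesis unfolding nn_integral_h' using params by (auto simp: measure_def intro!: enn2real_leI)
qed

lemma measure_convolution_cdf_ge:
  assumes \<mu>: "\<And>y. 0 < y \<Longrightarrow> y \<le> w \<Longrightarrow> measure \<mu> {..y} \<ge> B * y powr a"
    and \<nu>: "\<And>y. 0 < y \<Longrightarrow> y \<le> w \<Longrightarrow> measure \<nu> {..y} \<ge> A * y powr b"
  shows "measure (convolution \<nu> \<mu>) {..w} \<ge> A * B * (Gamma (a + 1) * Gamma (b + 1) / Gamma (a + b + 1)) * w powr (a + b)"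
proof -
  have fin: "finite_measure (convolution \<nu> \<mu>)"
    by (rule convolution_finite) (auto intro: \<mu>.finite_measure_axioms \<nu>.finite_measure_axioms)
  have "(\<integral>\<^sup>+u. h' u * indicator {0..w} u \<partial>lborel) \<le> (\<integral>\<^sup>+u. h u * indicator {0..w} u \<partial>lborel)"
  proof (intro nn_integral_mono)
    fix u :: real
    have "h' u \<le> h u" if "0 \<le> u" "u \<le> w"
    proof (cases "u = 0 \<or> u = w")
      case False
      have "B * a * u powr (a - 1) * (A * (w - u) powr b) \<le> B * a * u powr (a - 1) * measure \<nu> {..w - u}"
        using params False that by (intro mult_left_mono \<nu>) auto
      then show ?thesis unfolding h_eq by (intro ennreal_leI) (simp add: mult_ac)
    qed auto
    then show "h' u * indicator {0..w} u \<le> h u * indicator {0..w} u" by (auto simp: indicator_def)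
  qed
  also have "\<dots> \<le> emeasure (convolution \<nu> \<mu>) {..w}"
    unfolding emeasure_convolution_cdf nn_integral_max_powr_eq[symmetric]
  proof (intro nn_integral_mono_AE, use AE_pos in eventually_elim)
    case (elim y)
    then show ?case
      using \<mu>[of "w - y"] by (cases "w - y > 0") (auto simp: \<mu>.emeasure_eq_measure intro!: ennreal_leI)
  qed
  finally show ?thesis
    unfolding nn_integral_h' by (simp add: finite_measure.emeasure_eq_measure[OF fin] ennreal_le_iff)
qed

end

text \<open>The Laplace transform is expressed by the distribution function,
  \<open>exp (- \<theta> * y)\<close> being the integral of
  \<open>\<theta> * exp (- \<theta> * u)\<close> over \<open>u\<close> from \<open>y\<close> on. The
  remaining integral of \<open>u powr m * exp (- \<theta> * u)\<close> is a Gamma integral; it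
  extends over the whole half line, hence the global power bound.\<close>

lemma nn_integral_exp_minus_le:
  fixes \<nu> :: "real measure"
  assumes \<nu>: "real_distribution \<nu>" and pos: "measure \<nu> {..0} = 0"
    and params: "A \<ge> 0" "m > 0" "\<theta> > 0"
    and le: "\<And>y. y > 0 \<Longrightarrow> measure \<nu> {..y} \<le> A * y powr m"
  shows "(\<integral>\<^sup>+y. ennreal (exp (- \<theta> * y)) \<partial>\<nu>) \<le> ennreal (A * Gamma (m + 1) * \<theta> powr (- m))"
proof -
  interpret \<nu>: real_distribution \<nu> by fact
  interpret P: pair_sigma_finite \<nu> lborel ..
  have AE_pos: "AE y in \<nu>. y > 0"
  proof (rule AE_I)
    show "{y \<in> space \<nu>. \<not> y > 0} \<subseteq> {..0}" by auto
  qed (use pos in \<open>auto simp: \<nu>.emeasure_eq_measure\<close>)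
  let ?f = "\<lambda>u. ennreal (\<theta> * exp (- \<theta> * u)) * indicator {0..} u"
  have inner: "(\<integral>\<^sup>+u. ?f u * indicator {z. fst z \<le> snd z} (y, u) \<partial>lborel) = ennreal (exp (- \<theta> * y))" if "y > 0" for y
  proof -
    have "((\<lambda>u. \<theta> * exp (- \<theta> * u)) has_integral \<theta> * (exp (- \<theta> * y) / \<theta>)) {y..}"
      using params by (intro has_integral_mult_right has_integral_exp_minus_to_infinity)
    then have "((\<lambda>u. \<theta> * exp (- \<theta> * u)) has_integral exp (- \<theta> * y)) {y..}" using params by simp
    then have "(\<integral>\<^sup>+u. ennreal (\<theta> * exp (- \<theta> * u)) * indicator {y..} u \<partial>lborel) = ennreal (exp (- \<theta> * y))"
      using params by (intro nn_integral_has_integral_lebesgue') auto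
    moreover have "ennreal (\<theta> * exp (- \<theta> * u)) * indicator {y..} u = ?f u * indicator {z. fst z \<le> snd z} (y, u)" for u
      using that by (auto simp: indicator_def)
    ultimately show ?thesis by simp
  qed
  have "(\<integral>\<^sup>+y. ennreal (exp (- \<theta> * y)) \<partial>\<nu>) = (\<integral>\<^sup>+y. \<integral>\<^sup>+u. ?f u * indicator {z. fst z \<le> snd z} (y, u) \<partial>lborel \<partial>\<nu>)"
    by (intro nn_integral_cong_AE) (use AE_pos inner in \<open>auto elim!: eventually_mono\<close>)
  also have "\<dots> = (\<integral>\<^sup>+u. \<integral>\<^sup>+y. ?f u * indicator {z. fst z \<le> snd z} (y, u) \<partial>\<nu> \<partial>lborel)"
    by (intro P.Fubini'[symmetric]) measurable
  also have "\<dots> = (\<integral>\<^sup>+u. ?f u * emeasure \<nu> {..u} \<partial>lborel)"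
  proof (intro nn_integral_cong)
    fix u :: real
    have "(\<integral>\<^sup>+y. ?f u * indicator {z. fst z \<le> snd z} (y, u) \<partial>\<nu>) = (\<integral>\<^sup>+y. ?f u * indicator {..u} y \<partial>\<nu>)"
      by (intro nn_integral_cong) (auto simp: indicator_def)
    then show "(\<integral>\<^sup>+y. ?f u * indicator {z. fst z \<le> snd z} (y, u) \<partial>\<nu>) = ?f u * emeasure \<nu> {..u}"
      by (simp add: nn_integral_cmult_indicator)
  qed
  also have "\<dots> \<le> (\<integral>\<^sup>+u. ennreal (A * \<theta> * (u powr m * exp (- \<theta> * u))) * indicator {0..} u \<partial>lborel)"
  proof (intro nn_integral_mono)
    fix u :: real
    have "ennreal (\<theta> * exp (- \<theta> * u)) * emeasure \<nu> {..u} \<le> ennreal (A * \<theta> * (u powr m * exp (- \<theta> * u)))" if "u \<ge> 0"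
    proof (cases "u = 0")
      case True
      then show ?thesis using pos by (simp add: \<nu>.emeasure_eq_measure)
    next
      case False
      have "ennreal (\<theta> * exp (- \<theta> * u)) * emeasure \<nu> {..u} = ennreal (\<theta> * exp (- \<theta> * u) * measure \<nu> {..u})"
        using params by (simp add: \<nu>.emeasure_eq_measure ennreal_mult)
      also have "\<dots> \<le> ennreal (\<theta> * exp (- \<theta> * u) * (A * u powr m))"
        using params False that by (intro ennreal_leI mult_left_mono le) auto
      finally show ?thesis by (simp add: mult_ac)
    qed
    then show "?f u * emeasure \<nu> {..u} \<le> ennreal (A * \<theta> * (u powr m * exp (- \<theta> * u))) * indicator {0..} u"
      by (auto simp: indicator_def)
  qed
  also have "\<dots> = (\<integral>\<^sup>+u. ennreal (A * \<theta> powr (- m)) * (ennreal \<theta> *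
      ennreal (indicator {0..} (\<theta> * u) * (\<theta> * u) powr (m + 1 - 1) / exp (\<theta> * u))) \<partial>lborel)"
  proof (intro nn_integral_cong)
    fix u :: real
    show "ennreal (A * \<theta> * (u powr m * exp (- \<theta> * u))) * indicator {0..} u = ennreal (A * \<theta> powr (- m)) * (ennreal \<theta> *
      ennreal (indicator {0..} (\<theta> * u) * (\<theta> * u) powr (m + 1 - 1) / exp (\<theta> * u)))"
    proof (cases "u \<ge> 0")
      case True
      then have "A * \<theta> * (u powr m * exp (- \<theta> * u)) = A * \<theta> powr (- m) * (\<theta> * ((\<theta> * u) powr m / exp (\<theta> * u)))"
        using params by (simp add: powr_mult powr_minus exp_minus field_simps)
      then show ?thesis using True params by (simp add: ennreal_mult[symmetric])
    next
      case False
      then show ?thesis using params by (simp add: indicator_def zero_le_mult_iff)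
    qed
  qed
  also have "\<dots> = ennreal (A * \<theta> powr (- m)) * (ennreal \<theta> *
      (\<integral>\<^sup>+u. ennreal (indicator {0..} (\<theta> * u) * (\<theta> * u) powr (m + 1 - 1) / exp (\<theta> * u)) \<partial>lborel))"
    by (simp add: nn_integral_cmult)
  also have "ennreal \<theta> * (\<integral>\<^sup>+u. ennreal (indicator {0..} (\<theta> * u) * (\<theta> * u) powr (m + 1 - 1) / exp (\<theta> * u)) \<partial>lborel)
      = (\<integral>\<^sup>+u. ennreal (indicator {0..} u * u powr (m + 1 - 1) / exp u) \<partial>lborel)"
    using params nn_integral_real_affine[of "\<lambda>u. ennreal (indicator {0..} u * u powr (m + 1 - 1) / exp u)" \<theta> 0]
    by simp
  also have "\<dots> = ennreal (Gamma (m + 1))"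
    using params by (intro Gamma_conv_nn_integral_real[symmetric]) auto
  finally show ?thesis using params by (simp add: ennreal_mult[symmetric] mult_ac)
qed

section \<open>Paths in the complete graph\<close>

definition k_paths :: "nat \<Rightarrow> nat \<Rightarrow> nat list set" where
  "k_paths n k = {p \<in> sa_paths n. length p = Suc k}"

lemma finite_sa_paths: "finite (sa_paths n)"
proof (rule finite_subset)
  show "sa_paths n \<subseteq> {p. set p \<subseteq> {1..n} \<and> length p \<le> n}"
  proof safe
    fix p assume p: "p \<in> sa_paths n"
    then show "x \<in> {1..n}" if "x \<in> set p" for x using that by (auto simp: sa_paths_def)
    have "length p = card (set p)" using p by (simp add: sa_paths_def distinct_card)
    also have "\<dots> \<le> card {1..n}" using p by (intro card_mono) (auto simp: sa_paths_def)
    finally show "length p \<le> n" by simp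
  qed
  show "finite {p. set p \<subseteq> {1..n} \<and> length p \<le> n}" by (rule finite_lists_length_le) simp
qed

lemma finite_k_paths: "finite (k_paths n k)"
  unfolding k_paths_def using finite_sa_paths by simp

lemma sa_paths_length_ge: "p \<in> sa_paths n \<Longrightarrow> length p \<ge> 2"
  by (cases p rule: list.exhaust[case_names Nil Cons]; cases "tl p") (auto simp: sa_paths_def)

lemma sa_paths_eq_UN_k_paths: "sa_paths n = (\<Union>k\<in>{1..}. k_paths n k)"
proof (intro equalityI subsetI)
  fix p assume p: "p \<in> sa_paths n"
  then have "length p \<ge> 2" by (rule sa_paths_length_ge)
  then have "p \<in> k_paths n (length p - 1)" "length p - 1 \<ge> 1" using p by (auto simp: k_paths_def)
  then show "p \<in> (\<Union>k\<in>{1..}. k_paths n k)" by blast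
qed (auto simp: k_paths_def)

lemma k_paths_empty: "k \<ge> n \<Longrightarrow> k_paths n k = {}"
proof -
  assume "k \<ge> n"
  have "length p \<le> n" if "p \<in> sa_paths n" for p
  proof -
    have "length p = card (set p)" using that by (simp add: sa_paths_def distinct_card)
    also have "\<dots> \<le> card {1..n}" using that by (intro card_mono) (auto simp: sa_paths_def)
    finally show ?thesis by simp
  qed
  then show ?thesis using \<open>k \<ge> n\<close> by (fastforce simp: k_paths_def)
qed

lemma path_edges_eq_image: "path_edges p = (\<lambda>i. {p ! i, p ! Suc i}) ` {i. Suc i < length p}"
  by (auto simp: path_edges_def)

lemma edge_inj:
  assumes "distinct p" "Suc i < length p" "Suc j < length p" "{p ! i, p ! Suc i} = {p ! j, p ! Suc j}"
  shows "i = j"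
  using assms by (auto simp: doubleton_eq_iff nth_eq_iff_index_eq)

lemma card_path_edges: "distinct p \<Longrightarrow> card (path_edges p) = length p - 1"
proof -
  assume p: "distinct p"
  have "inj_on (\<lambda>i. {p ! i, p ! Suc i}) {i. Suc i < length p}"
    using p by (auto simp: inj_on_def dest: edge_inj)
  then have "card (path_edges p) = card {i. Suc i < length p}"
    unfolding path_edges_eq_image by (rule card_image)
  also have "{i. Suc i < length p} = {..<length p - 1}" by auto
  finally show ?thesis by simp
qed

lemma finite_path_edges: "finite (path_edges p)"
proof -
  have "{i. Suc i < length p} = {..<length p - 1}" by auto
  then show ?thesis unfolding path_edges_eq_image by simp
qed

lemma card_path_edges_k_paths: "p \<in> k_paths n k \<Longrightarrow> card (path_edges p) = k"
  by (simp add: k_paths_def sa_paths_def card_path_edges)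

lemma path_edges_subset: "p \<in> sa_paths n \<Longrightarrow> path_edges p \<subseteq> complete_edges n"
proof
  fix e assume p: "p \<in> sa_paths n" and "e \<in> path_edges p"
  then obtain i where i: "Suc i < length p" "e = {p ! i, p ! Suc i}" by (auto simp: path_edges_def)
  then have "p ! i \<noteq> p ! Suc i" using p by (simp add: sa_paths_def nth_eq_iff_index_eq)
  moreover have "p ! i \<in> set p" "p ! Suc i \<in> set p" using i by auto
  then have "p ! i \<in> {1..n}" "p ! Suc i \<in> {1..n}" using p unfolding sa_paths_def by blast+
  ultimately show "e \<in> complete_edges n" using i by (auto simp: complete_edges_def)
qed

lemma k_paths_eq_image:
  assumes "n \<ge> 2" "k \<ge> 1"
  shows "k_paths n k = (\<lambda>xs. 1 # xs @ [2]) ` {xs. length xs = k - 1 \<and> distinct xs \<and> set xs \<subseteq> {3..n}}"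
proof (intro equalityI subsetI)
  fix p assume p: "p \<in> k_paths n k"
  then have len: "length p = Suc k" by (simp add: k_paths_def)
  then obtain x ys where x: "p = x # ys" by (cases p) auto
  then have "ys \<noteq> []" using len assms by auto
  then obtain xs y where y: "ys = xs @ [y]" by (cases ys rule: rev_exhaust) auto
  have "x = 1" "y = 2" using p x y by (auto simp: k_paths_def sa_paths_def)
  moreover have "set xs \<subseteq> {3..n}"
  proof
    fix v assume "v \<in> set xs"
    then have "v \<in> {1..n}" "v \<noteq> 1" "v \<noteq> 2"
      using p x y \<open>x = 1\<close> \<open>y = 2\<close> by (auto simp: k_paths_def sa_paths_def)
    then show "v \<in> {3..n}" by auto
  qed
  ultimately show "p \<in> (\<lambda>xs. 1 # xs @ [2]) ` {xs. length xs = k - 1 \<and> distinct xs \<and> set xs \<subseteq> {3..n}}"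
    using p x y len by (auto simp: k_paths_def sa_paths_def)
next
  fix p assume "p \<in> (\<lambda>xs. 1 # xs @ [2]) ` {xs. length xs = k - 1 \<and> distinct xs \<and> set xs \<subseteq> {3..n}}"
  then obtain xs where "p = 1 # xs @ [2]" "length xs = k - 1" "distinct xs" "set xs \<subseteq> {3..n}" by auto
  then show "p \<in> k_paths n k" using assms by (fastforce simp: k_paths_def sa_paths_def)
qed

lemma card_k_paths_le: "k \<ge> 1 \<Longrightarrow> card (k_paths n k) \<le> n ^ (k - 1)"
proof (cases "n \<ge> 2")
  case True
  assume k: "k \<ge> 1"
  have "card (k_paths n k) \<le> card {xs. length xs = k - 1 \<and> distinct xs \<and> set xs \<subseteq> {3..n}}"
    unfolding k_paths_eq_image[OF True k]
    by (intro card_image_le finite_subset[OF _ finite_lists_length_eq[of "{3..n}" "k - 1"]]) auto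
  also have "\<dots> \<le> card {xs. set xs \<subseteq> {1..n} \<and> length xs = k - 1}"
    by (intro card_mono finite_lists_length_eq) auto
  also have "\<dots> = n ^ (k - 1)" by (subst card_lists_length_eq) auto
  finally show ?thesis .
next
  case False
  assume "k \<ge> 1"
  then have "k_paths n k = {}" using False by (intro k_paths_empty[THEN trans]) auto
  then show ?thesis by simp
qed

lemma card_k_paths_ge: "k \<ge> 1 \<Longrightarrow> n > k \<Longrightarrow> card (k_paths n k) \<ge> (n - k) ^ (k - 1)"
proof -
  assume k: "k \<ge> 1" "n > k"
  have "card (k_paths n k) = card {xs. length xs = k - 1 \<and> distinct xs \<and> set xs \<subseteq> {3..n}}"
    using k by (subst k_paths_eq_image) (auto intro!: card_image simp: inj_on_def)
  also have "\<dots> = \<Prod>{card {3..n} - (k - 1) + 1..card {3..n}}"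
    using k by (intro card_lists_distinct_length_eq) auto
  also have "{card {3..n} - (k - 1) + 1..card {3..n}} = {n - k..n - 2}" using k by auto
  also have "(n - k) ^ card {n - k..n - 2} \<le> \<Prod>{n - k..n - 2}"
    using prod_mono[of "{n - k..n - 2}" "\<lambda>_. n - k" "\<lambda>x. x"] by simp
  also have "card {n - k..n - 2} = k - 1" using k by auto
  finally show ?thesis .
qed

lemma card_k_paths_asymp:
  assumes "k \<ge> 1"
  shows "(\<lambda>n. real (card (k_paths n k)) / real n ^ (k - 1)) \<longlonglongrightarrow> 1"
proof (rule tendsto_sandwich)
  show "eventually (\<lambda>n. ((real n - real k) / real n) ^ (k - 1) \<le> real (card (k_paths n k)) / real n ^ (k - 1)) sequentially"
    using eventually_gt_at_top[of k]
  proof eventually_elim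
    case (elim n)
    have "real ((n - k) ^ (k - 1)) \<le> real (card (k_paths n k))"
      using card_k_paths_ge[OF assms elim] of_nat_le_iff by blast
    then show ?case using elim by (simp add: power_divide divide_right_mono of_nat_diff)
  qed
  show "eventually (\<lambda>n. real (card (k_paths n k)) / real n ^ (k - 1) \<le> 1) sequentially"
    using eventually_gt_at_top[of 0]
  proof eventually_elim
    case (elim n)
    have "real (card (k_paths n k)) \<le> real (n ^ (k - 1))"
      using card_k_paths_le[OF assms] of_nat_le_iff by blast
    then show ?case using elim by simp
  qed
  have "(\<lambda>n. (real n - real k) / real n) \<longlonglongrightarrow> 1" by real_asymp
  from tendsto_power[OF this, of "k - 1"]
  show "(\<lambda>n. ((real n - real k) / real n) ^ (k - 1)) \<longlonglongrightarrow> 1" by simp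
qed simp

section \<open>The overlap of two paths of equal length\<close>

definition new_steps :: "nat list \<Rightarrow> nat list \<Rightarrow> nat" where
  "new_steps p q = card {i. i < length q \<and> q ! i \<notin> set p}"

text \<open>Both paths start at the same vertex, and \<open>q\<close> is forced to follow
  \<open>p\<close>: at each vertex \<open>p\<close> offers only the next and the previous edge, and
  going back would revisit a vertex of \<open>q\<close>.\<close>

lemma path_eqI_of_edges_subset:
  assumes p: "p \<in> k_paths n k" and q: "q \<in> k_paths n k" and sub: "path_edges q \<subseteq> path_edges p"
  shows "p = q"
proof -
  have d: "distinct p" "distinct q" "length p = Suc k" "length q = Suc k" "p ! 0 = q ! 0"
    using p q by (auto simp: k_paths_def sa_paths_def hd_conv_nth)
  have "\<forall>j\<le>i. p ! j = q ! j" if "i \<le> k" for i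
    using that
  proof (induction i)
    case 0
    then show ?case using d by simp
  next
    case (Suc i)
    then have IH: "\<forall>j\<le>i. p ! j = q ! j" and i: "i < k" by auto
    have "{q ! i, q ! Suc i} \<in> path_edges p" using sub i d by (auto simp: path_edges_def)
    then obtain j where j: "j < k" "{q ! i, q ! Suc i} = {p ! j, p ! Suc j}"
      using d by (auto simp: path_edges_def)
    consider "q ! i = p ! j" "q ! Suc i = p ! Suc j" | "q ! i = p ! Suc j" "q ! Suc i = p ! j"
      using j by (auto simp: doubleton_eq_iff)
    then have "p ! Suc i = q ! Suc i"
    proof cases
      case 1
      then have "p ! i = p ! j" using IH by simp
      then have "i = j" using d i j by (simp add: nth_eq_iff_index_eq)
      then show ?thesis using 1 by simp
    next
      case 2
      then have "p ! i = p ! Suc j" using IH by simp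
      then have "i = Suc j" using d i j by (simp add: nth_eq_iff_index_eq)
      then have "q ! Suc i = q ! j" using 2 IH by simp
      then have "Suc i = j" using d i j by (simp add: nth_eq_iff_index_eq)
      then show ?thesis using \<open>i = Suc j\<close> by simp
    qed
    then show ?case using IH by (auto simp: le_Suc_eq)
  qed
  from this[of k] show ?thesis using d by (intro nth_equalityI) auto
qed

text \<open>
  Every step of \<open>q\<close> into or out of a vertex outside \<open>p\<close> is an edge not shared with \<open>p\<close>, and the
  number of such steps exceeds the number of these vertices.
\<close>

lemma shared_edges_le:
  assumes p: "p \<in> k_paths n k" and q: "q \<in> k_paths n k" and ne: "p \<noteq> q"
  shows "card (path_edges p \<inter> path_edges q) + new_steps p q + 1 \<le> k"
proof -
  define Nw where "Nw = {i. i < length q \<and> q ! i \<notin> set p}"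
  define Sh where "Sh = {i. i < k \<and> {q ! i, q ! Suc i} \<in> path_edges p}"
  have d: "distinct p" "distinct q" "length p = Suc k" "length q = Suc k"
    using p q by (auto simp: k_paths_def sa_paths_def)
  have ends: "q ! 0 \<in> set p" "q ! k \<in> set p"
  proof -
    have e: "hd q = hd p" "last q = last p" "p \<noteq> []" "q \<noteq> []" using p q by (auto simp: k_paths_def sa_paths_def)
    have "q ! 0 = hd p" using e by (simp add: hd_conv_nth)
    then show "q ! 0 \<in> set p" using e by simp
    have "q ! k = last p" using e d last_conv_nth[of q] by simp
    then show "q ! k \<in> set p" using e by simp
  qed
  have finN: "finite Nw" by (simp add: Nw_def)
  have finS: "finite Sh" by (simp add: Sh_def)
  have "path_edges p \<inter> path_edges q = (\<lambda>i. {q ! i, q ! Suc i}) ` Sh"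
    using d by (auto simp: Sh_def path_edges_def[of q])
  moreover have "inj_on (\<lambda>i. {q ! i, q ! Suc i}) Sh"
    using d by (auto simp: inj_on_def Sh_def dest: edge_inj)
  ultimately have cardS: "card (path_edges p \<inter> path_edges q) = card Sh" by (simp add: card_image)
  have Sh_old: "q ! i \<in> set p \<and> q ! Suc i \<in> set p" if i: "i \<in> Sh" for i
  proof -
    obtain j where "Suc j < length p" "{q ! i, q ! Suc i} = {p ! j, p ! Suc j}"
      using i unfolding Sh_def path_edges_def mem_Collect_eq by blast
    then have "{q ! i, q ! Suc i} \<subseteq> set p" using nth_mem[of j p] nth_mem[of "Suc j" p] by simp
    then show ?thesis by simp
  qed
  have range: "0 < i \<and> i < k" if "i \<in> Nw" for i
  proof -
    have "i < Suc k" and i: "q ! i \<notin> set p" using that d by (auto simp: Nw_def)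
    moreover have "i \<noteq> 0" "i \<noteq> k" using ends i by metis+
    ultimately show ?thesis by simp
  qed
  show ?thesis
  proof (cases "Nw = {}")
    case False
    define m where "m = Max Nw"
    have m: "m \<in> Nw" using False finN by (simp add: m_def)
    \<comment> \<open>The steps into the new vertices, indexed by their starting positions, together
      with the step out of the last new vertex \<open>m\<close>. The latter is not a step into a new
      vertex, so there is one more unshared step than there are new vertices.\<close>
    let ?T = "insert m ((\<lambda>i. i - 1) ` Nw)"
    have "m \<notin> (\<lambda>i. i - 1) ` Nw"
    proof
      assume "m \<in> (\<lambda>i. i - 1) ` Nw"
      then obtain i where i: "i \<in> Nw" "m = i - 1" by blast
      then have "i = Suc m" using range[OF i(1)] by simp
      moreover have "i \<le> m" unfolding m_def using finN i by simp
      ultimately show False by simp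
    qed
    moreover have "inj_on (\<lambda>i. i - 1) Nw"
    proof (rule inj_onI)
      fix i j assume "i \<in> Nw" "j \<in> Nw" "i - 1 = j - 1"
      then show "i = j" using range[of i] range[of j] by linarith
    qed
    ultimately have cardT: "card ?T = card Nw + 1" using finN by (simp add: card_image)
    have "?T \<subseteq> {..<k}"
    proof
      fix x assume "x \<in> ?T"
      then consider "x = m" | i where "i \<in> Nw" "x = i - 1" by blast
      then show "x \<in> {..<k}" using range[of m] m by cases (auto dest!: range)
    qed
    moreover have "?T \<inter> Sh = {}"
    proof -
      have "m \<notin> Sh" using m Sh_old[of m] by (auto simp: Nw_def)
      moreover have "i - 1 \<notin> Sh" if "i \<in> Nw" for i
        using that range[OF that] Sh_old[of "i - 1"] by (auto simp: Nw_def)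
      ultimately show ?thesis by auto
    qed
    moreover have "Sh \<subseteq> {..<k}" by (auto simp: Sh_def)
    ultimately have "card (?T \<union> Sh) \<le> card {..<k}" by (intro card_mono) auto
    moreover have "card (?T \<union> Sh) = card ?T + card Sh"
      using finN finS \<open>?T \<inter> Sh = {}\<close> by (intro card_Un_disjoint) auto
    ultimately show ?thesis using cardT cardS by (simp add: new_steps_def Nw_def[symmetric])
  next
    case True
    \<comment> \<open>Without new vertices the one unshared edge has to come from
      \<open>p \<noteq> q\<close>.\<close>
    have "\<not> path_edges q \<subseteq> path_edges p" using path_eqI_of_edges_subset[OF p q] ne by blast
    then obtain i where "i < k" "i \<notin> Sh" using d by (auto simp: Sh_def path_edges_def[of q])
    then have "Sh \<subset> {..<k}" by (auto simp: Sh_def)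
    then have "card Sh < card {..<k}" by (intro psubset_card_mono) auto
    then show ?thesis using True cardS by (simp add: new_steps_def Nw_def[symmetric])
  qed
qed

lemma sum_prod_list_lists:
  fixes c :: "'a \<Rightarrow> real"
  assumes "finite A"
  shows "(\<Sum>q | set q \<subseteq> A \<and> length q = L. prod_list (map c q)) = (\<Sum>x\<in>A. c x) ^ L"
proof (induction L)
  case 0
  have "{q. set q \<subseteq> A \<and> length q = 0} = {[]}" by auto
  then show ?case by simp
next
  case (Suc L)
  let ?S = "{q. set q \<subseteq> A \<and> length q = L}"
  have "{q. set q \<subseteq> A \<and> length q = Suc L} = (\<lambda>(x, q). x # q) ` (A \<times> ?S)"
    by (auto simp: image_iff length_Suc_conv)
  moreover have "inj_on (\<lambda>(x, q). x # q) (A \<times> ?S)" by (auto simp: inj_on_def)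
  ultimately have "(\<Sum>q | set q \<subseteq> A \<and> length q = Suc L. prod_list (map c q)) =
      (\<Sum>(x, q)\<in>A \<times> ?S. c x * prod_list (map c q))"
    by (simp add: sum.reindex case_prod_unfold)
  also have "\<dots> = (\<Sum>x\<in>A. c x) * (\<Sum>q\<in>?S. prod_list (map c q))"
    by (simp add: sum_product sum.cartesian_product)
  finally show ?case using Suc by simp
qed

text \<open>This bounds, uniformly in \<open>n\<close>, the number of paths with \<open>j\<close>
  vertices off \<open>p\<close> by a constant times \<open>n ^ j\<close>, for all \<open>j\<close>
  at once. A letter has weight 1 on \<open>p\<close> and \<open>1 / n\<close> off it, so one letter
  has total weight at most \<open>(k + 1) + 1\<close>, and a path has \<open>k + 1\<close>
  letters.\<close>

lemma sum_new_steps_le: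
  assumes p: "p \<in> k_paths n k" and n: "n \<ge> 1"
  shows "(\<Sum>q\<in>k_paths n k. (1 / real n) ^ new_steps p q) \<le> (real k + 2) ^ (k + 1)"
proof -
  define c where "c x = (if x \<in> set p then 1 else 1 / real n)" for x
  have eq: "(1 / real n) ^ new_steps p q = prod_list (map c q)" for q
  proof -
    have "prod_list (map c q) = (\<Prod>i<length q. c (q ! i))"
      by (simp add: prod.list_conv_set_nth atLeast0LessThan)
    also have "\<dots> = (\<Prod>i\<in>{..<length q}. if q ! i \<notin> set p then 1 / real n else 1)"
      by (intro prod.cong) (auto simp: c_def)
    also have "\<dots> = (\<Prod>i\<in>{i \<in> {..<length q}. q ! i \<notin> set p}. 1 / real n)"
      by (subst prod.inter_filter) auto
    also have "{i \<in> {..<length q}. q ! i \<notin> set p} = {i. i < length q \<and> q ! i \<notin> set p}" by auto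
    finally show ?thesis by (simp add: new_steps_def)
  qed
  have "(\<Sum>q\<in>k_paths n k. (1 / real n) ^ new_steps p q) = (\<Sum>q\<in>k_paths n k. prod_list (map c q))"
    by (simp add: eq)
  also have "\<dots> \<le> (\<Sum>q | set q \<subseteq> {1..n} \<and> length q = k + 1. prod_list (map c q))"
  proof (rule sum_mono2)
    show "finite {q. set q \<subseteq> {1..n} \<and> length q = k + 1}" by (rule finite_lists_length_eq) simp
    show "k_paths n k \<subseteq> {q. set q \<subseteq> {1..n} \<and> length q = k + 1}"
      by (auto simp: k_paths_def sa_paths_def)
    show "0 \<le> prod_list (map c q)" for q by (simp flip: eq)
  qed
  also have "\<dots> = (\<Sum>x\<in>{1..n}. c x) ^ (k + 1)" by (rule sum_prod_list_lists) simp
  also have "\<dots> \<le> (real k + 2) ^ (k + 1)"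
  proof (rule power_mono)
    have "(\<Sum>x\<in>{1..n}. c x) \<le> (\<Sum>x\<in>{1..n}. (if x \<in> set p then 1 else 0) + 1 / real n)"
      by (intro sum_mono) (auto simp: c_def)
    also have "\<dots> = real (card ({1..n} \<inter> set p)) + 1"
      using n by (simp add: sum.distrib sum.If_cases)
    also have "card ({1..n} \<inter> set p) \<le> card (set p)" by (intro card_mono) auto
    also have "card (set p) = k + 1" using p by (simp add: k_paths_def sa_paths_def distinct_card)
    finally show "(\<Sum>x\<in>{1..n}. c x) \<le> real k + 2" by simp
    show "0 \<le> (\<Sum>x\<in>{1..n}. c x)" by (intro sum_nonneg) (auto simp: c_def)
  qed
  finally show ?thesis .
qed

section \<open>Weights of paths for a fixed number of vertices\<close>

text \<open>The coefficient in Dirichlet's integral: for \<open>j\<close> independent variables with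
  distribution function \<open>y powr m\<close> near 0, the sum is at most a small \<open>y\<close>
  with probability \<open>dirichlet_coeff m j * y powr (j * m)\<close>.\<close>

definition dirichlet_coeff :: "real \<Rightarrow> nat \<Rightarrow> real" where
  "dirichlet_coeff m j = Gamma (m + 1) ^ j / Gamma (real j * m + 1)"

locale iid_edge_weights = prob_space M for M :: "'a measure" +
  fixes n :: nat and X :: "nat set \<Rightarrow> 'a \<Rightarrow> real" and \<nu> :: "real measure"
  assumes indep: "indep_vars (\<lambda>_. borel) X (complete_edges n)"
    and distr_X: "e \<in> complete_edges n \<Longrightarrow> distr M borel (X e) = \<nu>"
    and \<nu>: "real_distribution \<nu>"
    and \<nu>_pos: "measure \<nu> {..0} = 0"
begin

lemma X_measurable: "e \<in> complete_edges n \<Longrightarrow> X e \<in> borel_measurable M"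
  using indep by (simp add: indep_vars_def2)

lemma AE_X_pos: "e \<in> complete_edges n \<Longrightarrow> AE \<omega> in M. X e \<omega> > 0"
proof -
  assume e: "e \<in> complete_edges n"
  note [measurable] = X_measurable[OF e]
  have "measure (distr M borel (X e)) {..0} = 0" using distr_X[OF e] \<nu>_pos by simp
  then have "prob (X e -` {..0} \<inter> space M) = 0" by (subst (asm) measure_distr) auto
  moreover have "X e -` {..0} \<inter> space M \<in> events" by measurable
  ultimately have "X e -` {..0} \<inter> space M \<in> null_sets M" by (auto simp: null_sets_def emeasure_eq_measure)
  then show ?thesis by (rule AE_I') (auto simp: not_less)
qed

lemma sum_X_measurable: "S \<subseteq> complete_edges n \<Longrightarrow> (\<lambda>\<omega>. \<Sum>e\<in>S. X e \<omega>) \<in> borel_measurable M"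
  using X_measurable by (intro borel_measurable_sum) auto

lemma real_distribution_sum_X:
  "S \<subseteq> complete_edges n \<Longrightarrow> real_distribution (distr M borel (\<lambda>\<omega>. \<Sum>e\<in>S. X e \<omega>))"
  using sum_X_measurable by (intro real_distribution_distr) auto

lemma distr_sum_X_pos:
  assumes "S \<subseteq> complete_edges n" "S \<noteq> {}" "finite S"
  shows "measure (distr M borel (\<lambda>\<omega>. \<Sum>e\<in>S. X e \<omega>)) {..0} = 0"
proof -
  note [measurable] = sum_X_measurable[OF assms(1)]
  have "AE \<omega> in M. \<forall>e\<in>S. X e \<omega> > 0"
    using assms AE_X_pos by (subst AE_finite_all) auto
  then have "AE \<omega> in M. \<omega> \<notin> (\<lambda>\<omega>. \<Sum>e\<in>S. X e \<omega>) -` {..0} \<inter> space M"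
  proof eventually_elim
    case (elim \<omega>)
    then have "(\<Sum>e\<in>S. X e \<omega>) > 0" using assms by (intro sum_pos) auto
    then show ?case by auto
  qed
  then have "prob ((\<lambda>\<omega>. \<Sum>e\<in>S. X e \<omega>) -` {..0} \<inter> space M) = 0"
    by (subst prob_eq_0) auto
  then show ?thesis by (subst measure_distr) auto
qed

lemma distr_insert_sum_X:
  assumes "insert e S \<subseteq> complete_edges n" "e \<notin> S" "finite S"
  shows "distr M borel (\<lambda>\<omega>. \<Sum>e\<in>insert e S. X e \<omega>) = convolution \<nu> (distr M borel (\<lambda>\<omega>. \<Sum>e\<in>S. X e \<omega>))"
proof -
  have "indep_var borel (X e) borel (\<lambda>\<omega>. \<Sum>e\<in>S. X e \<omega>)"
    using assms by (intro indep_vars_sum indep_vars_subset[OF indep]) auto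
  then have "distr M borel (\<lambda>\<omega>. X e \<omega> + (\<Sum>e\<in>S. X e \<omega>)) =
      convolution (distr M borel (X e)) (distr M borel (\<lambda>\<omega>. \<Sum>e\<in>S. X e \<omega>))"
    using assms X_measurable[of e] sum_X_measurable[of S]
    by (intro sum_indep_random_variable) auto
  then show ?thesis using assms distr_X[of e] by simp
qed

text \<open>One convolution per edge, and the Beta factors telescope to
  \<open>dirichlet_coeff\<close>. Bounds on \<open>\<nu>\<close> up to \<open>w\<close> suffice,
  since each summand is positive and hence at most the sum.\<close>

lemma distr_sum_X_cdf_bounds:
  assumes S: "finite S" "S \<noteq> {}" "S \<subseteq> complete_edges n"
    and A: "A \<ge> 0" "A' \<ge> 0" and m: "m > 0"
    and bounds: "\<And>y. 0 < y \<Longrightarrow> y \<le> w \<Longrightarrow> A * y powr m \<le> measure \<nu> {..y} \<and> measure \<nu> {..y} \<le> A' * y powr m"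
  shows "0 < y \<Longrightarrow> y \<le> w \<Longrightarrow>
    A ^ card S * dirichlet_coeff m (card S) * y powr (real (card S) * m) \<le> measure (distr M borel (\<lambda>\<omega>. \<Sum>e\<in>S. X e \<omega>)) {..y} \<and>
    measure (distr M borel (\<lambda>\<omega>. \<Sum>e\<in>S. X e \<omega>)) {..y} \<le> A' ^ card S * dirichlet_coeff m (card S) * y powr (real (card S) * m)"
  using S
proof (induction S arbitrary: y rule: finite_ne_induct)
  case (singleton e)
  have "Gamma (m + 1) > 0" using m by simp
  then show ?case using singleton distr_X[of e] bounds[of y] by (simp add: dirichlet_coeff_def)
next
  case (insert e S)
  let ?s = "real (card S)" and ?\<mu> = "distr M borel (\<lambda>\<omega>. \<Sum>e\<in>S. X e \<omega>)"
  have s: "?s > 0" using insert by (simp add: card_gt_0_iff)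
  have G: "Gamma (?s * m + 1) > 0" "Gamma (m + 1) > 0" using s m by (auto intro!: Gamma_real_pos add_pos_pos)
  have \<mu>: "real_distribution ?\<mu>" "measure ?\<mu> {..0} = 0"
    using insert by (auto intro!: real_distribution_sum_X distr_sum_X_pos)
  have coeff: "C * (C ^ card S * dirichlet_coeff m (card S)) *
      (Gamma (?s * m + 1) * Gamma (m + 1) / Gamma (?s * m + m + 1)) * y powr (?s * m + m) =
      C ^ card (insert e S) * dirichlet_coeff m (card (insert e S)) * y powr (real (card (insert e S)) * m)" for C
    using insert.hyps G by (simp add: dirichlet_coeff_def algebra_simps)
  have nonneg: "0 \<le> C ^ card S * dirichlet_coeff m (card S)" if "C \<ge> 0" for C
    using that G by (auto simp: dirichlet_coeff_def)
  show ?case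
    unfolding distr_insert_sum_X[OF insert.prems(3) insert.hyps(3,1)] coeff[symmetric]
    using \<mu> \<nu> \<nu>_pos A m s insert.IH insert.prems bounds
    by (intro conjI measure_convolution_cdf_ge measure_convolution_cdf_le nonneg) auto
qed

text \<open>Chernoff's bound with one parameter for all edges. The weights \<open>c\<close> serve
  pairs of paths, where a shared edge has to be counted twice.\<close>

lemma prob_le_exp_moment:
  assumes S: "finite S" "S \<subseteq> complete_edges n" and c: "\<And>e. e \<in> S \<Longrightarrow> c e > 0"
    and A: "A \<ge> 0" and m: "m > 0" and \<theta>: "\<theta> > 0"
    and le: "\<And>y. 0 < y \<Longrightarrow> measure \<nu> {..y} \<le> A * y powr m"
    and B: "B \<in> events" "\<And>\<omega>. \<omega> \<in> B \<Longrightarrow> (\<Sum>e\<in>S. c e * X e \<omega>) \<le> v"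
  shows "prob B \<le> exp (\<theta> * v) * (\<Prod>e\<in>S. A * Gamma (m + 1) * (\<theta> * c e) powr (- m))"
proof -
  have G: "Gamma (m + 1) > 0" using m by simp
  have "indep_vars (\<lambda>_. borel) (\<lambda>e \<omega>. ennreal (exp (- (\<theta> * c e) * X e \<omega>))) S"
    by (rule indep_vars_compose2[OF indep_vars_subset[OF indep S(2)]]) measurable
  then have prod: "(\<integral>\<^sup>+\<omega>. (\<Prod>e\<in>S. ennreal (exp (- (\<theta> * c e) * X e \<omega>))) \<partial>M) =
      (\<Prod>e\<in>S. \<integral>\<^sup>+\<omega>. ennreal (exp (- (\<theta> * c e) * X e \<omega>)) \<partial>M)"
    using S(1) by (intro indep_vars_nn_integral) auto
  have one: "(\<integral>\<^sup>+\<omega>. ennreal (exp (- (\<theta> * c e) * X e \<omega>)) \<partial>M) \<le> ennreal (A * Gamma (m + 1) * (\<theta> * c e) powr (- m))"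
    if e: "e \<in> S" for e
  proof -
    have [measurable]: "X e \<in> borel_measurable M" using e S X_measurable by auto
    have "(\<integral>\<^sup>+\<omega>. ennreal (exp (- (\<theta> * c e) * X e \<omega>)) \<partial>M) = (\<integral>\<^sup>+y. ennreal (exp (- (\<theta> * c e) * y)) \<partial>distr M borel (X e))"
      by (subst nn_integral_distr) auto
    also have "distr M borel (X e) = \<nu>" using e S distr_X by auto
    also have "(\<integral>\<^sup>+y. ennreal (exp (- (\<theta> * c e) * y)) \<partial>\<nu>) \<le> ennreal (A * Gamma (m + 1) * (\<theta> * c e) powr (- m))"
      using \<nu> \<nu>_pos A m \<theta> c[OF e] le by (intro nn_integral_exp_minus_le) auto
    finally show ?thesis .
  qed
  have "emeasure M B = (\<integral>\<^sup>+\<omega>. indicator B \<omega> \<partial>M)" using B by simp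
  also have "\<dots> \<le> (\<integral>\<^sup>+\<omega>. ennreal (exp (\<theta> * v)) * (\<Prod>e\<in>S. ennreal (exp (- (\<theta> * c e) * X e \<omega>))) \<partial>M)"
  proof (intro nn_integral_mono)
    fix \<omega>
    have "(\<Prod>e\<in>S. ennreal (exp (- (\<theta> * c e) * X e \<omega>))) = ennreal (exp (- \<theta> * (\<Sum>e\<in>S. c e * X e \<omega>)))"
      using S(1) by (simp add: prod_ennreal exp_sum[symmetric] sum_distrib_left sum_negf mult_ac)
    then have eq: "ennreal (exp (\<theta> * v)) * (\<Prod>e\<in>S. ennreal (exp (- (\<theta> * c e) * X e \<omega>))) =
        ennreal (exp (\<theta> * (v - (\<Sum>e\<in>S. c e * X e \<omega>))))"
      by (simp add: ennreal_mult[symmetric] exp_add[symmetric] algebra_simps)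
    show "indicator B \<omega> \<le> ennreal (exp (\<theta> * v)) * (\<Prod>e\<in>S. ennreal (exp (- (\<theta> * c e) * X e \<omega>)))"
    proof (cases "\<omega> \<in> B")
      case True
      then have "\<theta> * (v - (\<Sum>e\<in>S. c e * X e \<omega>)) \<ge> 0" using B(2) \<theta> by simp
      then have "ennreal 1 \<le> ennreal (exp (\<theta> * (v - (\<Sum>e\<in>S. c e * X e \<omega>))))"
        by (intro ennreal_leI) simp
      then show ?thesis using True eq by simp
    qed simp
  qed
  also have "\<dots> = ennreal (exp (\<theta> * v)) * (\<integral>\<^sup>+\<omega>. (\<Prod>e\<in>S. ennreal (exp (- (\<theta> * c e) * X e \<omega>))) \<partial>M)"
  proof (rule nn_integral_cmult)
    have "(\<lambda>\<omega>. ennreal (exp (- (\<theta> * c e) * X e \<omega>))) \<in> borel_measurable M" if "e \<in> S" for e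
    proof -
      have [measurable]: "X e \<in> borel_measurable M" using that S X_measurable by auto
      show ?thesis by measurable
    qed
    then show "(\<lambda>\<omega>. \<Prod>e\<in>S. ennreal (exp (- (\<theta> * c e) * X e \<omega>))) \<in> borel_measurable M"
      by (rule borel_measurable_prod_ennreal)
  qed
  also have "\<dots> \<le> ennreal (exp (\<theta> * v)) * (\<Prod>e\<in>S. ennreal (A * Gamma (m + 1) * (\<theta> * c e) powr (- m)))"
    unfolding prod by (intro mult_left_mono prod_mono_ennreal one) auto
  also have "\<dots> = ennreal (exp (\<theta> * v) * (\<Prod>e\<in>S. A * Gamma (m + 1) * (\<theta> * c e) powr (- m)))"
    using A G by (subst prod_ennreal) (auto simp: ennreal_mult' intro!: prod_nonneg)
  finally show ?thesis
    using A G by (simp add: emeasure_eq_measure prod_nonneg)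
qed

section \<open>Light paths and pairs of light paths\<close>

definition light :: "nat list \<Rightarrow> real \<Rightarrow> 'a set" where
  "light p w = {\<omega> \<in> space M. path_weight (\<lambda>e. X e \<omega>) p \<le> w}"

lemma path_weight_measurable:
  "p \<in> sa_paths n \<Longrightarrow> (\<lambda>\<omega>. path_weight (\<lambda>e. X e \<omega>) p) \<in> borel_measurable M"
  unfolding path_weight_def using path_edges_subset by (intro sum_X_measurable)

lemma light_events: "p \<in> sa_paths n \<Longrightarrow> light p w \<in> events"
  unfolding light_def using path_weight_measurable[of p] by measurable

lemma prob_light: "p \<in> sa_paths n \<Longrightarrow> prob (light p w) = measure (distr M borel (\<lambda>\<omega>. \<Sum>e\<in>path_edges p. X e \<omega>)) {..w}"
  using path_weight_measurable[of p]
  by (subst measure_distr) (auto simp: light_def path_weight_def intro!: arg_cong[where f = prob])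

lemma prob_light_le:
  assumes p: "p \<in> k_paths n k" and "A \<ge> 0" "m > 0" "\<theta> > 0"
    and le: "\<And>y. 0 < y \<Longrightarrow> measure \<nu> {..y} \<le> A * y powr m"
  shows "prob (light p w) \<le> exp (\<theta> * w) * (A * Gamma (m + 1) * \<theta> powr (- m)) ^ k"
proof -
  have p': "p \<in> sa_paths n" using p by (simp add: k_paths_def)
  have "prob (light p w) \<le> exp (\<theta> * w) * (\<Prod>e\<in>path_edges p. A * Gamma (m + 1) * (\<theta> * 1) powr (- m))"
    using assms light_events[OF p'] path_edges_subset[OF p']
    by (intro prob_le_exp_moment) (auto simp: light_def path_weight_def finite_path_edges)
  then show ?thesis using card_path_edges_k_paths[OF p] by simp
qed

text \<open>Adding the two constraints gives one weighted sum over the union of the edge sets, with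
  weight 2 on shared edges and bound \<open>2 * w\<close>. The union has \<open>2 * k - l\<close>
  edges, and each shared one brings the extra factor \<open>2 powr (- m)\<close>.\<close>

lemma prob_light_Int_le:
  assumes p: "p \<in> k_paths n k" and q: "q \<in> k_paths n k" and "A \<ge> 0" "m > 0" "\<theta> > 0"
    and le: "\<And>y. 0 < y \<Longrightarrow> measure \<nu> {..y} \<le> A * y powr m"
    and l: "card (path_edges p \<inter> path_edges q) = l"
  shows "prob (light p w \<inter> light q w) \<le>
    exp (2 * \<theta> * w) * (A * Gamma (m + 1) * \<theta> powr (- m)) ^ (2 * k - l) * 2 powr (- m * real l)"
proof -
  let ?P = "path_edges p" and ?Q = "path_edges q"
  let ?c = "\<lambda>e. if e \<in> ?P \<inter> ?Q then 2 else (1::real)"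
  have p': "p \<in> sa_paths n" "q \<in> sa_paths n" using p q by (auto simp: k_paths_def)
  have fin: "finite ?P" "finite ?Q" by (rule finite_path_edges)+
  have sum: "(\<Sum>e\<in>?P \<union> ?Q. ?c e * x e) = (\<Sum>e\<in>?P. x e) + (\<Sum>e\<in>?Q. x e)" for x :: "nat set \<Rightarrow> real"
  proof -
    have "(\<Sum>e\<in>?P \<union> ?Q. ?c e * x e) = (\<Sum>e\<in>?P \<union> ?Q. x e + (if e \<in> ?P \<inter> ?Q then x e else 0))"
      by (intro sum.cong) auto
    also have "\<dots> = (\<Sum>e\<in>?P \<union> ?Q. x e) + (\<Sum>e\<in>(?P \<union> ?Q) \<inter> (?P \<inter> ?Q). x e)"
      using fin by (subst sum.inter_restrict) (auto simp: sum.distrib)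
    also have "(?P \<union> ?Q) \<inter> (?P \<inter> ?Q) = ?P \<inter> ?Q" by auto
    finally show ?thesis using fin by (simp add: sum.union_inter)
  qed
  have "prob (light p w \<inter> light q w) \<le>
      exp (\<theta> * (2 * w)) * (\<Prod>e\<in>?P \<union> ?Q. A * Gamma (m + 1) * (\<theta> * ?c e) powr (- m))"
  proof (rule prob_le_exp_moment)
    show "light p w \<inter> light q w \<in> events" using light_events p' by auto
    show "(\<Sum>e\<in>?P \<union> ?Q. ?c e * X e \<omega>) \<le> 2 * w" if "\<omega> \<in> light p w \<inter> light q w" for \<omega>
      using that unfolding sum by (auto simp: light_def path_weight_def)
  qed (use assms fin path_edges_subset[OF p'(1)] path_edges_subset[OF p'(2)] in auto)
  also have "(\<Prod>e\<in>?P \<union> ?Q. A * Gamma (m + 1) * (\<theta> * ?c e) powr (- m)) =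
      (\<Prod>e\<in>?P \<union> ?Q. A * Gamma (m + 1) * \<theta> powr (- m)) * (\<Prod>e\<in>?P \<union> ?Q. if e \<in> ?P \<inter> ?Q then 2 powr (- m) else 1)"
    using assms by (subst prod.distrib[symmetric], intro prod.cong) (auto simp: powr_mult)
  also have "(\<Prod>e\<in>?P \<union> ?Q. if e \<in> ?P \<inter> ?Q then 2 powr (- m) else 1) = (2 powr (- m)) ^ l"
  proof -
    have "(\<Prod>e\<in>?P \<union> ?Q. if e \<in> ?P \<inter> ?Q then 2 powr (- m) else 1) = (\<Prod>e\<in>(?P \<union> ?Q) \<inter> (?P \<inter> ?Q). 2 powr (- m))"
      using fin by (subst prod.inter_restrict) auto
    also have "(?P \<union> ?Q) \<inter> (?P \<inter> ?Q) = ?P \<inter> ?Q" by auto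
    finally show ?thesis using l by simp
  qed
  also have "(2 powr (- m)) ^ l = 2 powr (- m * real l)"
    by (simp add: powr_powr flip: powr_realpow)
  also have "(\<Prod>e\<in>?P \<union> ?Q. A * Gamma (m + 1) * \<theta> powr (- m)) = (A * Gamma (m + 1) * \<theta> powr (- m)) ^ (2 * k - l)"
  proof -
    have "card (?P \<union> ?Q) = 2 * k - l"
      using card_Un_Int[OF fin] l card_path_edges_k_paths[OF p] card_path_edges_k_paths[OF q] by linarith
    then show ?thesis by simp
  qed
  finally show ?thesis by (simp add: mult_ac)
qed

definition some_light :: "nat set \<Rightarrow> real \<Rightarrow> 'a set" where
  "some_light J w = (\<Union>j\<in>J. \<Union>p\<in>k_paths n j. light p w)"

text \<open>No path has more than \<open>n - 1\<close> edges, so the union is finite even for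
  infinite \<open>J\<close>; measurability and the union bound rely on this.\<close>

lemma some_light_eq: "some_light J w = (\<Union>j\<in>J \<inter> {..<n}. \<Union>p\<in>k_paths n j. light p w)"
proof -
  have "j < n" if "p \<in> k_paths n j" for p j using that k_paths_empty[of n j] by (cases "j < n") auto
  then show ?thesis unfolding some_light_def by fastforce
qed

lemma some_light_events: "some_light J w \<in> events"
  unfolding some_light_eq using light_events finite_k_paths
  by (intro sets.finite_UN) (auto simp: k_paths_def)

lemma prob_some_light_le:
  assumes J: "J \<subseteq> {1..}" and B: "\<And>j p. j \<in> J \<Longrightarrow> p \<in> k_paths n j \<Longrightarrow> prob (light p w) \<le> B j"
    and B0: "\<And>j. j \<in> J \<Longrightarrow> 0 \<le> B j"
  shows "prob (some_light J w) \<le> (\<Sum>j\<in>J \<inter> {..<n}. real n ^ (j - 1) * B j)"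
proof -
  have "prob (some_light J w) \<le> (\<Sum>j\<in>J \<inter> {..<n}. prob (\<Union>p\<in>k_paths n j. light p w))"
    unfolding some_light_eq using light_events finite_k_paths
    by (intro finite_measure_subadditive_finite) (auto simp: k_paths_def)
  also have "\<dots> \<le> (\<Sum>j\<in>J \<inter> {..<n}. real n ^ (j - 1) * B j)"
  proof (intro sum_mono)
    fix j assume j: "j \<in> J \<inter> {..<n}"
    have "prob (\<Union>p\<in>k_paths n j. light p w) \<le> (\<Sum>p\<in>k_paths n j. prob (light p w))"
      using light_events finite_k_paths by (intro finite_measure_subadditive_finite) (auto simp: k_paths_def)
    also have "\<dots> \<le> (\<Sum>p\<in>k_paths n j. B j)" using j by (intro sum_mono B) auto
    also have "\<dots> = real (card (k_paths n j)) * B j" by simp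
    also have "\<dots> \<le> real n ^ (j - 1) * B j"
    proof (intro mult_right_mono)
      have "card (k_paths n j) \<le> n ^ (j - 1)" using j J by (intro card_k_paths_le) auto
      then show "real (card (k_paths n j)) \<le> real n ^ (j - 1)" by (metis of_nat_le_iff of_nat_power)
    qed (use B0 j in auto)
    finally show "prob (\<Union>p\<in>k_paths n j. light p w) \<le> real n ^ (j - 1) * B j" .
  qed
  finally show ?thesis .
qed

end

section \<open>Poisson approximation for the paths of one length\<close>

context iid_edge_weights
begin

text \<open>The indicator and the count are functions \<open>f\<close> and \<open>g\<close> of two
  disjoint blocks of edge weights. They are moved to the product spaces over these blocks, where
  independence of blocks applies.\<close>

lemma light_indep_of_disjoint:
  assumes p: "p \<in> sa_paths n" and J: "finite J" "J \<subseteq> sa_paths n"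
    and disj: "\<And>q. q \<in> J \<Longrightarrow> path_edges p \<inter> path_edges q = {}" and z: "0 \<le> z" "z \<le> 1"
  shows "expectation (\<lambda>\<omega>. indicator (light p w) \<omega> * z ^ card {q \<in> J. \<omega> \<in> light q w}) =
    prob (light p w) * expectation (\<lambda>\<omega>. z ^ card {q \<in> J. \<omega> \<in> light q w})"
proof -
  define E where "E = (\<Union>q\<in>J. path_edges q)"
  define f where "f x = (indicator {x. (\<Sum>e\<in>path_edges p. x e) \<le> w} x :: real)" for x :: "nat set \<Rightarrow> real"
  define g where "g x = z ^ (\<Sum>q\<in>J. if (\<Sum>e\<in>path_edges q. x e) \<le> w then 1 else 0)" for x :: "nat set \<Rightarrow> real"
  have [measurable]: "f \<in> borel_measurable (PiM (path_edges p) (\<lambda>_. borel))"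
  proof -
    have [measurable]: "(\<lambda>x. \<Sum>e\<in>path_edges p. x e) \<in> borel_measurable (PiM (path_edges p) (\<lambda>_. borel :: real measure))"
      by (intro borel_measurable_sum measurable_component_singleton)
    show ?thesis unfolding f_def[abs_def] indicator_def by measurable
  qed
  have [measurable]: "g \<in> borel_measurable (PiM E (\<lambda>_. borel))"
  proof -
    have "(\<lambda>x. if (\<Sum>e\<in>path_edges q. x e) \<le> w then 1 else 0 :: nat) \<in> measurable (PiM E (\<lambda>_. borel :: real measure)) (count_space UNIV)"
      if "q \<in> J" for q
    proof -
      have [measurable]: "(\<lambda>x. \<Sum>e\<in>path_edges q. x e) \<in> borel_measurable (PiM E (\<lambda>_. borel :: real measure))"
        using that by (intro borel_measurable_sum measurable_component_singleton) (auto simp: E_def)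
      show ?thesis by measurable
    qed
    then have [measurable]: "(\<lambda>x. \<Sum>q\<in>J. if (\<Sum>e\<in>path_edges q. x e) \<le> w then 1 else 0 :: nat) \<in>
        measurable (PiM E (\<lambda>_. borel :: real measure)) (count_space UNIV)"
      by (rule measurable_sum_nat)
    show ?thesis unfolding g_def[abs_def] by measurable
  qed
  have "indep_var (PiM (path_edges p) (\<lambda>_. borel)) (\<lambda>\<omega>. restrict (\<lambda>e. X e \<omega>) (path_edges p))
      (PiM E (\<lambda>_. borel)) (\<lambda>\<omega>. restrict (\<lambda>e. X e \<omega>) E)"
  proof (rule indep_var_restrict[OF indep])
    show "E \<subseteq> complete_edges n" unfolding E_def using J path_edges_subset by blast
  qed (use disj path_edges_subset[OF p] in \<open>auto simp: E_def\<close>)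
  then have "indep_var borel (f \<circ> (\<lambda>\<omega>. restrict (\<lambda>e. X e \<omega>) (path_edges p)))
      borel (g \<circ> (\<lambda>\<omega>. restrict (\<lambda>e. X e \<omega>) E))"
    by (rule indep_var_compose) measurable
  moreover have "f \<circ> (\<lambda>\<omega>. restrict (\<lambda>e. X e \<omega>) (path_edges p)) = (\<lambda>\<omega>. indicator {\<omega>. path_weight (\<lambda>e. X e \<omega>) p \<le> w} \<omega>)"
    by (auto simp: fun_eq_iff f_def path_weight_def indicator_def)
  moreover have "g \<circ> (\<lambda>\<omega>. restrict (\<lambda>e. X e \<omega>) E) = (\<lambda>\<omega>. z ^ card {q \<in> J. path_weight (\<lambda>e. X e \<omega>) q \<le> w})"
  proof
    fix \<omega>
    have "(\<Sum>e\<in>path_edges q. restrict (\<lambda>e. X e \<omega>) E e) = path_weight (\<lambda>e. X e \<omega>) q" if "q \<in> J" for q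
      using that by (auto simp: path_weight_def E_def intro!: sum.cong)
    then have "(\<Sum>q\<in>J. if (\<Sum>e\<in>path_edges q. restrict (\<lambda>e. X e \<omega>) E e) \<le> w then 1 else 0) =
        (\<Sum>q\<in>J. if path_weight (\<lambda>e. X e \<omega>) q \<le> w then 1 else 0 :: nat)"
      by (intro sum.cong) auto
    also have "\<dots> = card {q \<in> J. path_weight (\<lambda>e. X e \<omega>) q \<le> w}"
      using J by (simp add: sum.If_cases Int_def)
    finally show "(g \<circ> (\<lambda>\<omega>. restrict (\<lambda>e. X e \<omega>) E)) \<omega> = z ^ card {q \<in> J. path_weight (\<lambda>e. X e \<omega>) q \<le> w}"
      by (simp add: g_def)
  qed
  ultimately have ind: "indep_var borel (\<lambda>\<omega>. indicator {\<omega>. path_weight (\<lambda>e. X e \<omega>) p \<le> w} \<omega> :: real)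
      borel (\<lambda>\<omega>. z ^ card {q \<in> J. path_weight (\<lambda>e. X e \<omega>) q \<le> w})" by simp
  have "integrable M (\<lambda>\<omega>. indicator {\<omega>. path_weight (\<lambda>e. X e \<omega>) p \<le> w} \<omega> :: real)"
    using indep_var_rv1[OF ind] by (intro integrable_const_bound[where B = 1]) (auto simp: indicator_def)
  moreover have "integrable M (\<lambda>\<omega>. z ^ card {q \<in> J. path_weight (\<lambda>e. X e \<omega>) q \<le> w})"
    using indep_var_rv2[OF ind] z
    by (intro integrable_const_bound[where B = 1]) (auto intro!: AE_I2 power_le_one)
  ultimately have "expectation (\<lambda>\<omega>. indicator {\<omega>. path_weight (\<lambda>e. X e \<omega>) p \<le> w} \<omega> * z ^ card {q \<in> J. path_weight (\<lambda>e. X e \<omega>) q \<le> w}) =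
      expectation (\<lambda>\<omega>. indicator {\<omega>. path_weight (\<lambda>e. X e \<omega>) p \<le> w} \<omega>) *
      expectation (\<lambda>\<omega>. z ^ card {q \<in> J. path_weight (\<lambda>e. X e \<omega>) q \<le> w})"
    by (rule indep_var_lebesgue_integral[OF ind])
  moreover have "expectation (\<lambda>\<omega>. indicator {\<omega>. path_weight (\<lambda>e. X e \<omega>) p \<le> w} \<omega>) = prob (light p w)"
    by (simp add: light_def Int_def conj_commute)
  moreover have "expectation (\<lambda>\<omega>. indicator {\<omega>. path_weight (\<lambda>e. X e \<omega>) p \<le> w} \<omega> * z ^ card {q \<in> J. path_weight (\<lambda>e. X e \<omega>) q \<le> w}) =
      expectation (\<lambda>\<omega>. indicator (light p w) \<omega> * z ^ card {q \<in> J. \<omega> \<in> light q w})"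
    by (intro Bochner_Integration.integral_cong) (auto simp: light_def indicator_def)
  moreover have "expectation (\<lambda>\<omega>. z ^ card {q \<in> J. path_weight (\<lambda>e. X e \<omega>) q \<le> w}) =
      expectation (\<lambda>\<omega>. z ^ card {q \<in> J. \<omega> \<in> light q w})"
    by (intro Bochner_Integration.integral_cong) (auto simp: light_def)
  ultimately show ?thesis by simp
qed

text \<open>Neighbours are paths with a common edge. A path different from \<open>p\<close> that
  shares \<open>l\<close> edges with it has at most \<open>k - 1 - l\<close> new vertices by
  \<open>shared_edges_le\<close>, which costs \<open>l\<close> powers of \<open>n\<close> compared
  with free pairs. The absolute value is taken because \<open>B l\<close> is constrained only at
  overlaps \<open>l\<close> that occur.\<close>

lemma prob_no_light_path_approx:
  assumes k: "k \<ge> 2" and n: "n \<ge> 2"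
    and P: "\<And>p. p \<in> k_paths n k \<Longrightarrow> prob (light p w) \<le> P"
    and B: "\<And>p q l. p \<in> k_paths n k \<Longrightarrow> q \<in> k_paths n k \<Longrightarrow>
      card (path_edges p \<inter> path_edges q) = l \<Longrightarrow> prob (light p w \<inter> light q w) \<le> B l"
  shows "\<bar>prob (space M - some_light {k} w) - exp (- (\<Sum>p\<in>k_paths n k. prob (light p w)))\<bar> \<le>
    (real k + 2) ^ (k + 1) * ((real n ^ (k - 1) * P)\<^sup>2 / real n +
      (\<Sum>l=1..k-1. real n ^ (2 * (k - 1) - l) * \<bar>B l\<bar>))"
proof -
  let ?I = "k_paths n k"
  define nb where "nb p = {q \<in> ?I. path_edges p \<inter> path_edges q \<noteq> {}}" for p
  let ?N = "real n" and ?C = "(real k + 2) ^ (k + 1)"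
  have n0: "?N > 0" using n by simp
  have sa: "p \<in> sa_paths n" if "p \<in> ?I" for p using that by (simp add: k_paths_def)
  have fin: "finite ?I" by (rule finite_k_paths)
  have fin_nb: "finite (nb p)" for p using fin by (simp add: nb_def)
  have cardI: "real (card ?I) \<le> ?N ^ (k - 1)"
    using card_k_paths_le[of k n] k by (metis of_nat_le_iff of_nat_power One_nat_def Suc_1 Suc_leD)
  have new_self: "new_steps p p = 0" for p by (auto simp: new_steps_def)
  have self: "p \<in> nb p" if "p \<in> ?I" for p
    using that card_path_edges_k_paths[OF that] k by (auto simp: nb_def)
  \<comment> \<open>A factor of at least 1 that is inserted to turn a bound on the number of new
    vertices into the weights summed by \<open>sum_new_steps_le\<close>.\<close>
  have weight: "?N ^ j * (1 / ?N) ^ i \<ge> 1" if "i \<le> j" for i j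
  proof -
    have "?N ^ j * (1 / ?N) ^ i = ?N ^ (j - i)" using that n0 by (simp add: power_diff power_divide)
    also have "\<dots> \<ge> 1" using n by (intro one_le_power) auto
    finally show ?thesis .
  qed
  have b1: "(\<Sum>p\<in>?I. \<Sum>q\<in>nb p. prob (light p w) * prob (light q w)) \<le> ?C * ((?N ^ (k - 1) * P)\<^sup>2 / ?N)"
  proof -
    have "(\<Sum>q\<in>nb p. prob (light p w) * prob (light q w)) \<le> P\<^sup>2 * (?N ^ (k - 2) * ?C)" if p: "p \<in> ?I" for p
    proof -
      have "(\<Sum>q\<in>nb p. prob (light p w) * prob (light q w)) \<le> (\<Sum>q\<in>nb p. P\<^sup>2 * (?N ^ (k - 2) * (1 / ?N) ^ new_steps p q))"
      proof (intro sum_mono)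
        fix q assume q: "q \<in> nb p"
        then have qI: "q \<in> ?I" by (simp add: nb_def)
        have P0: "0 \<le> P" using P[OF p] measure_nonneg order_trans by blast
        \<comment> \<open>Another path with a common edge has at most \<open>k - 2\<close> new
          vertices; \<open>p\<close>, which belongs to its own neighbourhood, has none.\<close>
        have "new_steps p q \<le> k - 2"
        proof (cases "p = q")
          case False
          have "card (path_edges p \<inter> path_edges q) > 0"
            using q finite_path_edges by (simp add: nb_def card_gt_0_iff)
          then show ?thesis using shared_edges_le[OF p qI False] by linarith
        qed (simp add: new_self)
        from weight[OF this] have 1: "1 \<le> ?N ^ (k - 2) * (1 / ?N) ^ new_steps p q" .
        have "prob (light p w) * prob (light q w) \<le> P * P"
          using P[OF p] P[OF qI] P0 by (intro mult_mono) auto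
        also have "\<dots> \<le> P\<^sup>2 * (?N ^ (k - 2) * (1 / ?N) ^ new_steps p q)"
          using mult_left_mono[OF 1, of "P\<^sup>2"] by (simp add: power2_eq_square)
        finally show "prob (light p w) * prob (light q w) \<le> P\<^sup>2 * (?N ^ (k - 2) * (1 / ?N) ^ new_steps p q)" .
      qed
      also have "\<dots> \<le> (\<Sum>q\<in>?I. P\<^sup>2 * (?N ^ (k - 2) * (1 / ?N) ^ new_steps p q))"
        using fin by (intro sum_mono2) (auto simp: nb_def)
      also have "\<dots> = P\<^sup>2 * (?N ^ (k - 2) * (\<Sum>q\<in>?I. (1 / ?N) ^ new_steps p q))"
        by (simp only: sum_distrib_left)
      also have "\<dots> \<le> P\<^sup>2 * (?N ^ (k - 2) * ?C)"
        using sum_new_steps_le[OF p] n by (intro mult_left_mono) auto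
      finally show ?thesis .
    qed
    then have "(\<Sum>p\<in>?I. \<Sum>q\<in>nb p. prob (light p w) * prob (light q w)) \<le> (\<Sum>p\<in>?I. P\<^sup>2 * (?N ^ (k - 2) * ?C))"
      by (rule sum_mono)
    also have "\<dots> = real (card ?I) * (P\<^sup>2 * (?N ^ (k - 2) * ?C))" by simp
    also have "\<dots> \<le> ?N ^ (k - 1) * (P\<^sup>2 * (?N ^ (k - 2) * ?C))"
      using cardI by (intro mult_right_mono) auto
    also have "?N ^ (k - 2) = ?N ^ (k - 1) / ?N"
      using n0 k power_Suc[of ?N "k - 2"] by (simp add: Suc_diff_Suc numeral_2_eq_2)
    also have "?N ^ (k - 1) * (P\<^sup>2 * (?N ^ (k - 1) / ?N * ?C)) = ?C * ((?N ^ (k - 1) * P)\<^sup>2 / ?N)"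
      by (simp add: power2_eq_square)
    finally show ?thesis .
  qed
  have b2: "(\<Sum>p\<in>?I. \<Sum>q\<in>nb p - {p}. prob (light p w \<inter> light q w)) \<le>
      ?C * (\<Sum>l=1..k-1. ?N ^ (2 * (k - 1) - l) * \<bar>B l\<bar>)"
  proof -
    define S where "S = (\<Sum>l=1..k-1. ?N ^ (k - 1 - l) * \<bar>B l\<bar>)"
    have S0: "S \<ge> 0" unfolding S_def by (intro sum_nonneg) auto
    have "(\<Sum>q\<in>nb p - {p}. prob (light p w \<inter> light q w)) \<le> S * ?C" if p: "p \<in> ?I" for p
    proof -
      have "(\<Sum>q\<in>nb p - {p}. prob (light p w \<inter> light q w)) \<le> (\<Sum>q\<in>nb p - {p}. S * (1 / ?N) ^ new_steps p q)"
      proof (intro sum_mono)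
        fix q assume q: "q \<in> nb p - {p}"
        then have qI: "q \<in> ?I" "p \<noteq> q" by (auto simp: nb_def)
        define l where "l = card (path_edges p \<inter> path_edges q)"
        have l: "l \<ge> 1" using q finite_path_edges by (simp add: l_def nb_def card_gt_0_iff Suc_le_eq)
        have new: "l + new_steps p q + 1 \<le> k" unfolding l_def by (rule shared_edges_le[OF p qI])
        have "prob (light p w \<inter> light q w) \<le> \<bar>B l\<bar>" using B[OF p qI(1) l_def[symmetric]] by linarith
        also have "\<dots> \<le> \<bar>B l\<bar> * (?N ^ (k - 1 - l) * (1 / ?N) ^ new_steps p q)"
          using mult_left_mono[OF weight[of "new_steps p q" "k - 1 - l"], of "\<bar>B l\<bar>"] new by simp
        also have "\<dots> = (?N ^ (k - 1 - l) * \<bar>B l\<bar>) * (1 / ?N) ^ new_steps p q" by simp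
        also have "\<dots> \<le> S * (1 / ?N) ^ new_steps p q"
        proof (intro mult_right_mono)
          show "?N ^ (k - 1 - l) * \<bar>B l\<bar> \<le> S" unfolding S_def
            using l new by (intro member_le_sum[of l "{1..k-1}" "\<lambda>l. ?N ^ (k - 1 - l) * \<bar>B l\<bar>"]) auto
        qed auto
        finally show "prob (light p w \<inter> light q w) \<le> S * (1 / ?N) ^ new_steps p q" .
      qed
      also have "\<dots> \<le> (\<Sum>q\<in>?I. S * (1 / ?N) ^ new_steps p q)"
        using fin S0 by (intro sum_mono2) (auto simp: nb_def)
      also have "\<dots> = S * (\<Sum>q\<in>?I. (1 / ?N) ^ new_steps p q)" by (simp only: sum_distrib_left)
      also have "\<dots> \<le> S * ?C" using sum_new_steps_le[OF p] n S0 by (intro mult_left_mono) auto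
      finally show ?thesis .
    qed
    then have "(\<Sum>p\<in>?I. \<Sum>q\<in>nb p - {p}. prob (light p w \<inter> light q w)) \<le> (\<Sum>p\<in>?I. S * ?C)"
      by (rule sum_mono)
    also have "\<dots> = real (card ?I) * (S * ?C)" by simp
    also have "\<dots> \<le> ?N ^ (k - 1) * (S * ?C)" using cardI S0 by (intro mult_right_mono) auto
    also have "\<dots> = ?C * (?N ^ (k - 1) * S)" by simp
    also have "?N ^ (k - 1) * S = (\<Sum>l=1..k-1. ?N ^ (2 * (k - 1) - l) * \<bar>B l\<bar>)"
      unfolding S_def sum_distrib_left
    proof (intro sum.cong refl)
      fix l assume "l \<in> {1..k-1}"
      then have "2 * (k - 1) - l = (k - 1) + (k - 1 - l)" by auto
      then show "?N ^ (k - 1) * (?N ^ (k - 1 - l) * \<bar>B l\<bar>) = ?N ^ (2 * (k - 1) - l) * \<bar>B l\<bar>"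
        by (simp add: power_add)
    qed
    finally show ?thesis .
  qed
  have "\<bar>prob (space M - (\<Union>p\<in>?I. light p w)) - exp (- (\<Sum>p\<in>?I. prob (light p w)))\<bar> \<le>
    (\<Sum>p\<in>?I. \<Sum>q\<in>nb p. prob (light p w) * prob (light q w)) + (\<Sum>p\<in>?I. \<Sum>q\<in>nb p - {p}. prob (light p w \<inter> light q w))"
  proof (rule poisson_void_probability[OF fin])
    fix p z assume "p \<in> ?I" "0 \<le> z" "z \<le> (1::real)"
    then show "expectation (\<lambda>\<omega>. indicator (light p w) \<omega> * z ^ card {q \<in> ?I - nb p. \<omega> \<in> light q w}) =
      prob (light p w) * expectation (\<lambda>\<omega>. z ^ card {q \<in> ?I - nb p. \<omega> \<in> light q w})"
      using sa fin by (intro light_indep_of_disjoint) (auto simp: nb_def)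
  qed (use light_events sa self in \<open>auto simp: nb_def\<close>)
  then show ?thesis using b1 b2 by (simp add: some_light_def distrib_left)
qed

section \<open>Minimal weight and hopcount in terms of light paths\<close>

lemma sa_paths_nonempty: "n \<ge> 2 \<Longrightarrow> sa_paths n \<noteq> {}"
proof -
  assume "n \<ge> 2"
  then have "[1, 2] \<in> sa_paths n" by (simp add: sa_paths_def)
  then show ?thesis by blast
qed

lemma min_weight_le_iff:
  "n \<ge> 2 \<Longrightarrow> min_weight n x \<le> w \<longleftrightarrow> (\<exists>p\<in>sa_paths n. path_weight x p \<le> w)"
  using finite_sa_paths sa_paths_nonempty by (auto simp: min_weight_def Min_le_iff)

lemma min_weight_le_eq_some_light:
  "n \<ge> 2 \<Longrightarrow> {\<omega> \<in> space M. min_weight n (\<lambda>e. X e \<omega>) \<le> w} = some_light {1..} w"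
  by (auto simp: min_weight_le_iff some_light_def light_def sa_paths_eq_UN_k_paths[of n])

lemma min_weight_measurable: "n \<ge> 2 \<Longrightarrow> (\<lambda>\<omega>. min_weight n (\<lambda>e. X e \<omega>)) \<in> borel_measurable M"
  unfolding borel_measurable_iff_le using min_weight_le_eq_some_light some_light_events by auto

lemma minimal_path_in_sa_paths:
  assumes "n \<ge> 2"
  shows "minimal_path n x \<in> sa_paths n" "path_weight x (minimal_path n x) = min_weight n x"
proof -
  have "is_arg_min (path_weight x) (\<lambda>p. p \<in> sa_paths n) (minimal_path n x)"
    unfolding minimal_path_def using ex_is_arg_min_if_finite[OF finite_sa_paths sa_paths_nonempty[OF assms], of "path_weight x"]
    by (auto simp: arg_min_def intro: someI_ex)
  then have *: "minimal_path n x \<in> sa_paths n" "\<And>q. q \<in> sa_paths n \<Longrightarrow> path_weight x (minimal_path n x) \<le> path_weight x q"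
    by (auto simp: is_arg_min_linorder)
  then show "minimal_path n x \<in> sa_paths n" by simp
  show "path_weight x (minimal_path n x) = min_weight n x"
    unfolding min_weight_def using * finite_sa_paths by (intro Min_eqI[symmetric]) auto
qed

lemma minimal_path_in_k_paths: "n \<ge> 2 \<Longrightarrow> minimal_path n x \<in> k_paths n (hopcount n x)"
  using minimal_path_in_sa_paths[of x] sa_paths_length_ge[of "minimal_path n x" n]
  by (auto simp: k_paths_def hopcount_def card_path_edges sa_paths_def)

lemma hopcount_ge_1: "n \<ge> 2 \<Longrightarrow> hopcount n x \<ge> 1"
  using minimal_path_in_k_paths[of x] sa_paths_length_ge[of "minimal_path n x" n] by (auto simp: k_paths_def)

text \<open>The hopcount depends on the sample point only through the set \<open>Mi\<close> of
  minimizers. This set has finitely many possible values, each taken on an event given by finitely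
  many comparisons of path weights.\<close>

lemma hopcount_events:
  assumes n: "n \<ge> 2"
  shows "{\<omega> \<in> space M. hopcount n (\<lambda>e. X e \<omega>) \<in> J} \<in> events"
proof -
  define Mi where "Mi \<omega> = {p \<in> sa_paths n. \<forall>q\<in>sa_paths n. path_weight (\<lambda>e. X e \<omega>) p \<le> path_weight (\<lambda>e. X e \<omega>) q}" for \<omega>
  define h where "h T = card (path_edges (SOME p. p \<in> T))" for T
  have eq: "hopcount n (\<lambda>e. X e \<omega>) = h (Mi \<omega>)" for \<omega>
    by (simp add: hopcount_def minimal_path_def arg_min_def is_arg_min_linorder h_def Mi_def Ball_def)
  have "{\<omega> \<in> space M. Mi \<omega> = T} \<in> events" if "T \<subseteq> sa_paths n" for T
  proof -
    have "{\<omega> \<in> space M. p \<in> Mi \<omega>} \<in> events" if p: "p \<in> sa_paths n" for p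
    proof -
      have "{\<omega> \<in> space M. \<forall>q\<in>sa_paths n. path_weight (\<lambda>e. X e \<omega>) p \<le> path_weight (\<lambda>e. X e \<omega>) q} \<in> events"
        using path_weight_measurable p finite_sa_paths
        by (intro sets.sets_Collect_finite_All borel_measurable_le) auto
      then show ?thesis using p by (simp add: Mi_def)
    qed
    then have "{\<omega> \<in> space M. \<forall>p\<in>sa_paths n. p \<in> Mi \<omega> \<longleftrightarrow> p \<in> T} \<in> events"
      using finite_sa_paths
      by (intro sets.sets_Collect_finite_All sets.sets_Collect) auto
    also have "{\<omega> \<in> space M. \<forall>p\<in>sa_paths n. p \<in> Mi \<omega> \<longleftrightarrow> p \<in> T} = {\<omega> \<in> space M. Mi \<omega> = T}"
      using that by (auto simp: Mi_def)
    finally show ?thesis .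
  qed
  then have "(\<Union>T\<in>{T \<in> Pow (sa_paths n). h T \<in> J}. {\<omega> \<in> space M. Mi \<omega> = T}) \<in> events"
    using finite_sa_paths by (intro sets.finite_UN) auto
  also have "(\<Union>T\<in>{T \<in> Pow (sa_paths n). h T \<in> J}. {\<omega> \<in> space M. Mi \<omega> = T}) = {\<omega> \<in> space M. hopcount n (\<lambda>e. X e \<omega>) \<in> J}"
    unfolding eq by (auto simp: Mi_def)
  finally show ?thesis .
qed

text \<open>If a path with length in \<open>K\<close> is light, then so is the minimal path; if
  moreover no path with length outside \<open>J\<close> is light, the minimal length lies in
  \<open>J\<close>. The level \<open>w\<close> can be chosen freely.\<close>

lemma prob_hopcount_ge:
  assumes n: "n \<ge> 2" and K: "K \<subseteq> {1..}"
  shows "prob {\<omega> \<in> space M. hopcount n (\<lambda>e. X e \<omega>) \<in> J} \<ge> prob (some_light K w) - prob (some_light ({1..} - J) w)"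
proof -
  have "some_light K w \<subseteq> {\<omega> \<in> space M. hopcount n (\<lambda>e. X e \<omega>) \<in> J} \<union> some_light ({1..} - J) w"
  proof
    fix \<omega> assume "\<omega> \<in> some_light K w"
    then have "\<omega> \<in> some_light {1..} w" using K by (auto simp: some_light_def)
    then have \<omega>: "\<omega> \<in> space M" "min_weight n (\<lambda>e. X e \<omega>) \<le> w"
      unfolding min_weight_le_eq_some_light[OF n, symmetric] by auto
    show "\<omega> \<in> {\<omega> \<in> space M. hopcount n (\<lambda>e. X e \<omega>) \<in> J} \<union> some_light ({1..} - J) w"
    proof (cases "hopcount n (\<lambda>e. X e \<omega>) \<in> J")
      case False
      then have "\<omega> \<in> some_light ({1..} - J) w"
        unfolding some_light_def light_def
        using minimal_path_in_k_paths[OF n, of "\<lambda>e. X e \<omega>"] minimal_path_in_sa_paths(2)[OF n, of "\<lambda>e. X e \<omega>"]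
          hopcount_ge_1[OF n, of "\<lambda>e. X e \<omega>"] \<omega> by fastforce
      then show ?thesis by simp
    qed (use \<omega> in auto)
  qed
  then have "prob (some_light K w) \<le> prob ({\<omega> \<in> space M. hopcount n (\<lambda>e. X e \<omega>) \<in> J} \<union> some_light ({1..} - J) w)"
    using hopcount_events[OF n] some_light_events by (intro finite_measure_mono) auto
  also have "\<dots> \<le> prob {\<omega> \<in> space M. hopcount n (\<lambda>e. X e \<omega>) \<in> J} + prob (some_light ({1..} - J) w)"
    using hopcount_events[OF n] some_light_events by (intro measure_Un_le) auto
  finally show ?thesis by simp
qed

lemma prob_min_weight_le_bounds:
  assumes n: "n \<ge> 2" and K: "K \<subseteq> {1..}"
  shows "prob (some_light K w) \<le> prob {\<omega> \<in> space M. min_weight n (\<lambda>e. X e \<omega>) \<le> w}"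
    "prob {\<omega> \<in> space M. min_weight n (\<lambda>e. X e \<omega>) \<le> w} \<le> prob (some_light K w) + prob (some_light ({1..} - K) w)"
proof -
  show "prob (some_light K w) \<le> prob {\<omega> \<in> space M. min_weight n (\<lambda>e. X e \<omega>) \<le> w}"
    unfolding min_weight_le_eq_some_light[OF n] using K some_light_events
    by (intro finite_measure_mono) (auto simp: some_light_def)
  have "{1..} = K \<union> ({1..} - K)" using K by blast
  then have "some_light {1..} w = some_light K w \<union> some_light ({1..} - K) w"
    unfolding some_light_def by (metis UN_Un)
  then show "prob {\<omega> \<in> space M. min_weight n (\<lambda>e. X e \<omega>) \<le> w} \<le> prob (some_light K w) + prob (some_light ({1..} - K) w)"
    unfolding min_weight_le_eq_some_light[OF n] using some_light_events
    by (simp add: measure_Un_le)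
qed

end

section \<open>The function g and the constants of the limit theorem\<close>

lemma g_fun_pos: "k \<ge> 1 \<Longrightarrow> g_fun \<gamma> (real k) > 0"
  by (simp add: g_fun_def)

lemma ln_g_fun: "k \<ge> 1 \<Longrightarrow> ln (g_fun \<gamma> (real k)) = ln (real k) - \<gamma> * (1 - 1 / real k)"
  by (simp add: g_fun_def ln_mult)

text \<open>The origin of the critical values: the logarithmic increment of
  \<open>g_fun \<gamma>\<close> from \<open>k\<close> to \<open>k + 1\<close> is affine in \<gamma>
  and changes sign exactly at \<open>gamma_crit k\<close>.\<close>

lemma ln_g_fun_Suc:
  assumes "k \<ge> 1"
  shows "ln (g_fun \<gamma> (real (Suc k))) - ln (g_fun \<gamma> (real k)) = (gamma_crit k - \<gamma>) / (real k * (real k + 1))"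
proof -
  let ?P = "real k * (real k + 1)"
  have P: "?P > 0" using assms by simp
  have "ln ((real k + 1) / real k) = ln (real k + 1) - ln (real k)"
    using assms by (simp add: ln_div)
  moreover have Suc: "real (Suc k) = real k + 1" by simp
  ultimately have "ln (g_fun \<gamma> (real (Suc k))) - ln (g_fun \<gamma> (real k)) =
      ln ((real k + 1) / real k) - \<gamma> * (1 / real k - 1 / (real k + 1))"
    using ln_g_fun[of "Suc k" \<gamma>] ln_g_fun[of k \<gamma>] assms unfolding Suc by (simp add: algebra_simps)
  also have "1 / real k - 1 / (real k + 1) = 1 / ?P" using assms by (simp add: field_simps)
  also have "ln ((real k + 1) / real k) - \<gamma> * (1 / ?P) = (?P * ln ((real k + 1) / real k) - \<gamma>) / ?P"
    using P by (simp only: diff_divide_distrib) simp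
  finally show ?thesis by (simp only: gamma_crit_def)
qed

lemma
  assumes k: "k \<ge> 1"
  shows g_fun_less_Suc_iff: "g_fun \<gamma> (real k) < g_fun \<gamma> (real (Suc k)) \<longleftrightarrow> \<gamma> < gamma_crit k"
    and g_fun_Suc_less_iff: "g_fun \<gamma> (real (Suc k)) < g_fun \<gamma> (real k) \<longleftrightarrow> gamma_crit k < \<gamma>"
proof -
  let ?d = "(gamma_crit k - \<gamma>) / (real k * (real k + 1))"
  have g: "g_fun \<gamma> (real k) > 0" "g_fun \<gamma> (real (Suc k)) > 0" using k by (auto intro!: g_fun_pos simp del: of_nat_Suc)
  have "0 < ?d \<longleftrightarrow> \<gamma> < gamma_crit k" using k by (subst pos_less_divide_eq) auto
  moreover have "?d < 0 \<longleftrightarrow> gamma_crit k < \<gamma>" using k by (subst pos_divide_less_eq) auto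
  moreover have "ln (g_fun \<gamma> (real (Suc k))) - ln (g_fun \<gamma> (real k)) = ?d" by (rule ln_g_fun_Suc[OF k])
  ultimately show "g_fun \<gamma> (real k) < g_fun \<gamma> (real (Suc k)) \<longleftrightarrow> \<gamma> < gamma_crit k"
    "g_fun \<gamma> (real (Suc k)) < g_fun \<gamma> (real k) \<longleftrightarrow> gamma_crit k < \<gamma>"
    unfolding ln_less_cancel_iff[OF g, symmetric] ln_less_cancel_iff[OF g(2,1), symmetric] by linarith+
qed

lemma ln_succ_div_ge: "k \<ge> 1 \<Longrightarrow> 1 / (real k + 1) \<le> ln ((real k + 1) / real k)"
proof -
  assume k: "k \<ge> 1"
  have "ln (real k / (real k + 1)) \<le> real k / (real k + 1) - 1" using k by (intro ln_le_minus_one) auto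
  moreover have "ln (real k / (real k + 1)) = - ln ((real k + 1) / real k)" using k by (simp add: ln_div)
  moreover have "real k / (real k + 1) - 1 = - (1 / (real k + 1))" using k by (simp add: field_simps)
  ultimately show ?thesis by linarith
qed

text \<open>The estimates \<open>1 / (k + 1) \<le> ln ((k + 1) / k) < 1 / k\<close> place
  \<open>gamma_crit k\<close> in the interval from \<open>k\<close> (included) to
  \<open>k + 1\<close> (excluded), so consecutive values are separated by an integer.\<close>

lemma gamma_crit_less_Suc: "k \<ge> 1 \<Longrightarrow> gamma_crit k < gamma_crit (Suc k)"
proof -
  assume k: "k \<ge> 1"
  have "ln (1 + 1 / real k) < 1 / real k" using k by (intro ln_add_one_self_less_self) simp
  then have "ln ((real k + 1) / real k) < 1 / real k" using k by (simp add: add_divide_distrib)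
  then have "real k * (real k + 1) * ln ((real k + 1) / real k) < real k * (real k + 1) * (1 / real k)"
    using k by (intro mult_strict_left_mono) auto
  then have "gamma_crit k < real k + 1" using k by (simp add: gamma_crit_def)
  also have "real k + 1 = real (Suc k) * (real (Suc k) + 1) * (1 / (real (Suc k) + 1))" by simp
  also have "\<dots> \<le> gamma_crit (Suc k)"
    unfolding gamma_crit_def by (intro mult_left_mono ln_succ_div_ge) auto
  finally show ?thesis .
qed

lemma gamma_crit_less: "1 \<le> i \<Longrightarrow> i < j \<Longrightarrow> gamma_crit i < gamma_crit j"
proof (induction j)
  case (Suc j)
  show ?case
  proof (cases "i = j")
    case False
    then have "gamma_crit i < gamma_crit j" using Suc by auto
    also have "\<dots> < gamma_crit (Suc j)" using Suc False by (intro gamma_crit_less_Suc) auto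
    finally show ?thesis .
  qed (use Suc gamma_crit_less_Suc in auto)
qed simp

lemma gamma_crit_le: "1 \<le> i \<Longrightarrow> i \<le> j \<Longrightarrow> gamma_crit i \<le> gamma_crit j"
  using gamma_crit_less[of i j] by (cases "i = j") auto

lemma gamma_crit_1: "gamma_crit 1 = 2 * ln 2"
  by (simp add: gamma_crit_def)

lemma g_fun_1: "g_fun \<gamma> (real 1) = 1"
  by (simp add: g_fun_def)

lemma g_fun_increasing:
  assumes "1 \<le> i" "\<gamma> < gamma_crit i"
  shows "i < j \<Longrightarrow> g_fun \<gamma> (real i) < g_fun \<gamma> (real j)"
proof (induction j)
  case (Suc j)
  have "\<gamma> < gamma_crit j" using gamma_crit_le[of i j] assms Suc by simp
  then have "g_fun \<gamma> (real j) < g_fun \<gamma> (real (Suc j))" using g_fun_less_Suc_iff[of j] assms Suc by simp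
  then show ?case using Suc by (cases "i = j") auto
qed simp

lemma g_fun_decreasing:
  assumes "1 \<le> i" "gamma_crit j < \<gamma>"
  shows "i \<le> j \<Longrightarrow> g_fun \<gamma> (real (Suc j)) < g_fun \<gamma> (real i)"
  using assms(2)
proof (induction j)
  case (Suc j)
  have "g_fun \<gamma> (real (Suc (Suc j))) < g_fun \<gamma> (real (Suc j))"
    using g_fun_Suc_less_iff[of "Suc j" \<gamma>] Suc.prems by simp
  moreover have "gamma_crit j < \<gamma>" if "i \<le> j"
    using gamma_crit_less_Suc[of j] Suc.prems assms that by simp
  ultimately show ?case using Suc by (cases "i = Suc j") auto
qed (use assms in simp)

text \<open>Since \<open>g_fun \<gamma> j\<close> is at least \<open>j * exp (- \<gamma>)\<close>,
  only finitely many \<open>j\<close> come near \<open>c\<close>. Hence the individual strict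
  inequalities give one multiplicative margin for all of \<open>J\<close>, and even at a level
  slightly above \<open>c\<close>.\<close>

lemma g_fun_gap:
  assumes J: "J \<subseteq> {1..}" and c: "c > 0" and \<gamma>: "\<gamma> \<ge> 0"
    and less: "\<And>j. j \<in> J \<Longrightarrow> c < g_fun \<gamma> (real j)"
  obtains w \<delta> where "w > c" "\<delta> > 0" "\<And>j. j \<in> J \<Longrightarrow> w * exp \<delta> \<le> g_fun \<gamma> (real j)"
proof -
  define n0 where "n0 = nat \<lceil>(c + 1) * exp \<gamma>\<rceil>"
  define c' where "c' = Min (insert (c + 1) ((\<lambda>j. g_fun \<gamma> (real j)) ` (J \<inter> {..<n0})))"
  have "c' > c" unfolding c'_def using less by (subst Min_gr_iff) auto
  have c': "c' \<le> g_fun \<gamma> (real j)" if j: "j \<in> J" for j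
  proof (cases "j < n0")
    case True
    then show ?thesis unfolding c'_def using j by (intro Min_le) auto
  next
    case False
    then have "(c + 1) * exp \<gamma> \<le> real j" unfolding n0_def by linarith
    then have "c + 1 \<le> real j * exp (- \<gamma>)" by (simp add: exp_minus field_simps)
    also have "\<dots> \<le> g_fun \<gamma> (real j)"
      unfolding g_fun_def using \<gamma> by (intro mult_left_mono) (auto simp: algebra_simps)
    finally have "c + 1 \<le> g_fun \<gamma> (real j)" .
    moreover have "c' \<le> c + 1" unfolding c'_def by (intro Min_le) auto
    ultimately show ?thesis by linarith
  qed
  \<comment> \<open>One half of the logarithmic gap between \<open>c\<close> and \<open>c'\<close>
    raises the level from \<open>c\<close> to \<open>w = c * exp \<delta>\<close>, the other half
    remains as margin.\<close>
  define \<delta> where "\<delta> = ln (c' / c) / 2"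
  have "\<delta> > 0" using \<open>c' > c\<close> c by (simp add: \<delta>_def)
  moreover have "c * exp \<delta> > c" using \<open>\<delta> > 0\<close> c by simp
  moreover have "c * exp \<delta> * exp \<delta> = c'"
  proof -
    have "exp \<delta> * exp \<delta> = exp (ln (c' / c))" by (simp add: \<delta>_def exp_add[symmetric])
    then show ?thesis using \<open>c' > c\<close> c by (simp add: mult.assoc)
  qed
  ultimately show ?thesis using c' that[of "c * exp \<delta>" \<delta>] by simp
qed

text \<open>Used with \<open>Suc k\<close> as the optimal length. The bound
  \<open>ln ((k + 1) / k) \<ge> 1 / (k + 1)\<close> makes the quotient at least
  \<open>k / (k + 1)\<close>, hence at least 1/2, and \<open>1 - ln 2\<close> is below 1/2.\<close>

lemma gamma_div_k_gt:
  assumes k: "k \<ge> 1" and \<gamma>: "gamma_crit k \<le> \<gamma>"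
  shows "1 - ln 2 < \<gamma> / real (Suc k)"
proof -
  have "1 - ln 2 < (1 / 2 :: real)" using ln2_ge_two_thirds by simp
  also have "1 / 2 \<le> real k * (1 / (real k + 1))" using k by (simp add: field_simps)
  also have "\<dots> \<le> real k * ln ((real k + 1) / real k)" using k by (intro mult_left_mono ln_succ_div_ge) auto
  also have "\<dots> = gamma_crit k / real (Suc k)" by (simp add: gamma_crit_def divide_simps)
  also have "\<dots> \<le> \<gamma> / real (Suc k)" using \<gamma> by (intro divide_right_mono) auto
  finally show ?thesis .
qed

text \<open>By Stirling's formula the factors \<open>exp (- k * m)\<close> and
  \<open>m powr (k * m)\<close> of numerator and denominator cancel and
  \<open>k powr (- k * m)\<close> remains. The square roots give
  \<open>(2 * pi * m) powr (k / 2) / sqrt (2 * pi * k * m)\<close>, which is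
  \<open>a_const k * m powr ((k - 1) / 2)\<close>; this is where \<open>a_const\<close> comes
  from.\<close>

lemma dirichlet_coeff_asymp:
  assumes k: "k \<ge> 1"
  shows "((\<lambda>m. dirichlet_coeff m k * real k powr (real k * m) * m powr (- (real k - 1) / 2)) \<longlongrightarrow> a_const k) at_top"
proof -
  define \<sigma> where "\<sigma> x = Gamma (x + 1) / (sqrt (2 * pi * x) * exp (- x) * x powr x)" for x :: real
  have \<sigma>: "(\<sigma> \<longlongrightarrow> 1) at_top" unfolding \<sigma>_def[abs_def] by (rule Gamma_stirling)
  have lim: "((\<lambda>m. \<sigma> m ^ k / \<sigma> (real k * m) * a_const k) \<longlongrightarrow> 1 ^ k / 1 * a_const k) at_top"
  proof (intro tendsto_intros \<sigma>)
    have "filterlim (\<lambda>m. real k * m) at_top at_top"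
      using k by (intro filterlim_tendsto_pos_mult_at_top[OF tendsto_const]) (auto simp: filterlim_ident)
    then show "((\<lambda>m. \<sigma> (real k * m)) \<longlongrightarrow> 1) at_top" by (rule filterlim_compose[OF \<sigma>])
  qed simp
  have ev: "eventually (\<lambda>m. \<sigma> m ^ k / \<sigma> (real k * m) * a_const k =
      dirichlet_coeff m k * real k powr (real k * m) * m powr (- (real k - 1) / 2)) at_top"
    using eventually_gt_at_top[of 0]
  proof eventually_elim
    case (elim m)
    have G: "Gamma (x + 1) = \<sigma> x * (sqrt (2 * pi * x) * exp (- x) * x powr x)" "\<sigma> x > 0" if "x > 0" for x
      using that by (auto simp: \<sigma>_def intro!: divide_pos_pos Gamma_real_pos)
    have km: "real k * m > 0" using k elim by simp
    have s1: "sqrt (2 * pi * m) ^ k = (2 * pi) powr (real k / 2) * m powr (real k / 2)"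
    proof -
      have "sqrt (2 * pi * m) ^ k = ((2 * pi * m) powr (1/2)) powr real k"
        using elim by (simp add: powr_half_sqrt powr_realpow)
      also have "\<dots> = (2 * pi * m) powr (real k / 2)" by (simp add: powr_powr)
      finally show ?thesis using elim by (simp add: powr_mult)
    qed
    have s2: "sqrt (2 * pi * (real k * m)) = sqrt (2 * pi * real k) * m powr (1/2)"
      using elim by (simp add: powr_half_sqrt real_sqrt_mult)
    have s3: "(exp (- m) * m powr m) ^ k = exp (- (real k * m)) * m powr (real k * m)"
      using elim by (simp add: power_mult_distrib exp_of_nat_mult[symmetric] powr_realpow[symmetric] powr_powr mult_ac)
    have s4: "(real k * m) powr (real k * m) = real k powr (real k * m) * m powr (real k * m)"
      using elim by (simp add: powr_mult)
    have s5: "m powr (real k / 2) * m powr (- (real k - 1) / 2) = m powr (1/2)"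
      using elim by (simp add: powr_add[symmetric] add_divide_distrib[symmetric])
    have "dirichlet_coeff m k * real k powr (real k * m) * m powr (- (real k - 1) / 2) =
      (\<sigma> m ^ k * (sqrt (2 * pi * m) ^ k * (exp (- m) * m powr m) ^ k)) /
      (\<sigma> (real k * m) * (sqrt (2 * pi * (real k * m)) * exp (- (real k * m)) * (real k * m) powr (real k * m)))
       * real k powr (real k * m) * m powr (- (real k - 1) / 2)"
      unfolding dirichlet_coeff_def G(1)[OF elim] G(1)[OF km] by (simp add: power_mult_distrib mult_ac)
    also have "\<dots> = \<sigma> m ^ k / \<sigma> (real k * m) * ((2 * pi) powr (real k / 2) / sqrt (2 * pi * real k)) *
       ((m powr (real k / 2) * m powr (- (real k - 1) / 2)) / m powr (1/2))"
      unfolding s1 s2 s3 s4 using elim k G(2)[OF km] by (simp add: field_simps)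
    also have "\<dots> = \<sigma> m ^ k / \<sigma> (real k * m) * a_const k"
      unfolding s5 using elim by (simp add: a_const_def)
    finally show ?case by simp
  qed
  from Lim_transform_eventually[OF lim ev] show ?thesis unfolding power_one div_by_1 mult_1_left .
qed

lemma Gamma_upper_asymp:
  "eventually (\<lambda>x::real. Gamma (x + 1) \<le> 2 * (sqrt (2 * pi * x) * exp (- x) * x powr x)) at_top"
proof -
  have "eventually (\<lambda>x. Gamma (x + 1) / (sqrt (2 * pi * x) * exp (- x) * x powr x) < 2) at_top"
    by (rule order_tendstoD(2)[OF Gamma_stirling]) simp
  then show ?thesis
    using eventually_gt_at_top[of 0]
  proof eventually_elim
    case (elim x)
    then have "sqrt (2 * pi * x) * exp (- x) * x powr x > 0" by simp
    then show ?case using elim(1) by (simp only: pos_divide_less_eq less_imp_le)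
  qed
qed

lemma a_const_pos: "k \<ge> 1 \<Longrightarrow> a_const k > 0"
  by (simp add: a_const_def)

text \<open>Both factors tend to 1 with \<open>\<epsilon>\<close>, so one \<open>\<epsilon>\<close>
  that is good enough for the given accuracy can be fixed before \<open>n\<close> grows.\<close>

lemma tendsto_of_relative_bounds:
  fixes x c :: "nat \<Rightarrow> real"
  assumes c: "c \<longlonglongrightarrow> L"
    and bounds: "\<And>\<epsilon>. 0 < \<epsilon> \<Longrightarrow> \<epsilon> < 1 \<Longrightarrow> eventually (\<lambda>n. (1 - \<epsilon>) ^ k * c n \<le> x n \<and> x n \<le> (1 + \<epsilon>) ^ k * c n) sequentially"
  shows "x \<longlonglongrightarrow> L"
proof (rule tendstoI)
  fix e :: real assume e: "e > 0"
  have "((\<lambda>\<epsilon>::real. (1 - \<epsilon>) ^ k * L) \<longlongrightarrow> (1 - 0) ^ k * L) (at_right 0)"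
    "((\<lambda>\<epsilon>::real. (1 + \<epsilon>) ^ k * L) \<longlongrightarrow> (1 + 0) ^ k * L) (at_right 0)" by (intro tendsto_intros)+
  then have "eventually (\<lambda>\<epsilon>::real. L - e < (1 - \<epsilon>) ^ k * L) (at_right 0)"
    "eventually (\<lambda>\<epsilon>::real. (1 + \<epsilon>) ^ k * L < L + e) (at_right 0)"
    using e by (auto intro: order_tendstoD)
  moreover have "eventually (\<lambda>\<epsilon>::real. \<epsilon> \<in> {0<..<1}) (at_right 0)" by (rule eventually_at_right_real) simp
  ultimately have "eventually (\<lambda>\<epsilon>. L - e < (1 - \<epsilon>) ^ k * L \<and> (1 + \<epsilon>) ^ k * L < L + e \<and> 0 < \<epsilon> \<and> \<epsilon> < 1) (at_right 0)"
    by eventually_elim auto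
  then obtain \<epsilon> where \<epsilon>: "L - e < (1 - \<epsilon>) ^ k * L" "(1 + \<epsilon>) ^ k * L < L + e" "0 < \<epsilon>" "\<epsilon> < 1"
    using eventually_happens'[OF trivial_limit_at_right_real] by blast
  have "(\<lambda>n. (1 - \<epsilon>) ^ k * c n) \<longlonglongrightarrow> (1 - \<epsilon>) ^ k * L" "(\<lambda>n. (1 + \<epsilon>) ^ k * c n) \<longlonglongrightarrow> (1 + \<epsilon>) ^ k * L"
    by (intro tendsto_intros c)+
  from order_tendstoD(1)[OF this(1) \<epsilon>(1)] order_tendstoD(2)[OF this(2) \<epsilon>(2)] bounds[OF \<epsilon>(3,4)]
  show "eventually (\<lambda>n. dist (x n) L < e) sequentially"
    by eventually_elim (auto simp: dist_real_def abs_less_iff)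
qed

section \<open>Asymptotic bounds\<close>

text \<open>The smoothness of \<open>G\<close> at 0 enters in the form \<open>G_lin\<close>, which
  \<open>C2_on_quotient_tendsto\<close> supplies.\<close>

locale complete_graph_fpp =
  fixes N :: "'b measure" and Z :: "'b \<Rightarrow> real" and G :: "real \<Rightarrow> real"
    and lam \<gamma> :: real and s :: "nat \<Rightarrow> real"
    and M :: "nat \<Rightarrow> 'a measure" and X :: "nat \<Rightarrow> nat set \<Rightarrow> 'a \<Rightarrow> real"
  assumes N: "prob_space N"
    and Z: "Z \<in> borel_measurable N" "AE \<omega> in N. Z \<omega> > 0"
    and G_def: "G = cdf (distr N borel Z)"
    and G_cont: "continuous_on UNIV G"
    and G_lin: "((\<lambda>x. G x / x) \<longlongrightarrow> lam) (at_right 0)"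
    and lam: "lam > 0"
    and s: "\<And>n. n \<ge> 1 \<Longrightarrow> s n > 0" "\<gamma> \<ge> 0" "(\<lambda>n. s n * ln (real n)) \<longlonglongrightarrow> \<gamma>"
    and M: "\<And>n. n \<ge> 1 \<Longrightarrow> prob_space (M n)"
    and X_indep: "\<And>n. n \<ge> 1 \<Longrightarrow> prob_space.indep_vars (M n) (\<lambda>_. borel) (X n) (complete_edges n)"
    and X_distr: "\<And>n e. n \<ge> 1 \<Longrightarrow> e \<in> complete_edges n \<Longrightarrow>
      distr (M n) borel (X n e) = distr N borel (\<lambda>\<omega>. Z \<omega> powr s n)"
begin

definition \<nu> :: "nat \<Rightarrow> real measure" where
  "\<nu> n = distr N borel (\<lambda>\<omega>. Z \<omega> powr s n)"

definition m :: "nat \<Rightarrow> real" where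
  "m n = 1 / s n"

definition P :: "nat \<Rightarrow> nat set \<Rightarrow> real \<Rightarrow> real" where
  "P n J w = measure (M n) (iid_edge_weights.some_light (M n) n (X n) J w)"

lemma real_distribution_Z: "real_distribution (distr N borel Z)"
  using N Z by (intro prob_space.real_distribution_distr) auto

lemma G_le_1: "G x \<le> 1" and G_at_top: "(G \<longlongrightarrow> 1) at_top"
proof -
  interpret D: real_distribution "distr N borel Z" by (rule real_distribution_Z)
  show "G x \<le> 1" "(G \<longlongrightarrow> 1) at_top"
    unfolding G_def using D.cdf_bounded_prob D.cdf_lim_at_top_prob by auto
qed

lemma G_eq: "G x = measure N {\<omega> \<in> space N. Z \<omega> \<le> x}"
  unfolding G_def cdf_def using Z by (subst measure_distr) (auto intro!: arg_cong[where f = "measure N"])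

lemma powr_le_iff: "z > 0 \<Longrightarrow> y > 0 \<Longrightarrow> a > 0 \<Longrightarrow> z powr a \<le> y \<longleftrightarrow> z \<le> y powr (1 / a)" for z y a :: real
  using powr_mono2[of a z "y powr (1 / a)"] powr_mono2[of "1 / a" "z powr a" y] by (auto simp: powr_powr)

lemma cdf_\<nu>: "n \<ge> 1 \<Longrightarrow> y > 0 \<Longrightarrow> measure (\<nu> n) {..y} = G (y powr m n)"
proof -
  assume n: "n \<ge> 1" and y: "y > 0"
  interpret N: prob_space N by (rule N)
  note [measurable] = Z(1)
  have "measure (\<nu> n) {..y} = measure N {\<omega> \<in> space N. Z \<omega> powr s n \<le> y}"
    unfolding \<nu>_def by (subst measure_distr) (auto intro!: arg_cong[where f = "measure N"])
  also have "\<dots> = measure N {\<omega> \<in> space N. Z \<omega> \<le> y powr m n}"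
  proof (rule N.finite_measure_eq_AE)
    show "AE \<omega> in N. \<omega> \<in> {\<omega> \<in> space N. Z \<omega> powr s n \<le> y} \<longleftrightarrow> \<omega> \<in> {\<omega> \<in> space N. Z \<omega> \<le> y powr m n}"
      using Z(2) by eventually_elim (use powr_le_iff[OF _ y s(1)[OF n]] in \<open>simp add: m_def\<close>)
  qed measurable
  finally show ?thesis by (simp add: G_eq)
qed

lemma \<nu>_nonpos: "n \<ge> 1 \<Longrightarrow> measure (\<nu> n) {..0} = 0"
proof -
  assume n: "n \<ge> 1"
  interpret N: prob_space N by (rule N)
  note [measurable] = Z(1)
  have "measure (\<nu> n) {..0} = measure N {\<omega> \<in> space N. Z \<omega> powr s n \<le> 0}"
    unfolding \<nu>_def by (subst measure_distr) (auto intro!: arg_cong[where f = "measure N"])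
  also have "\<dots> = measure N {}"
  proof (rule N.finite_measure_eq_AE)
    show "AE \<omega> in N. \<omega> \<in> {\<omega> \<in> space N. Z \<omega> powr s n \<le> 0} \<longleftrightarrow> \<omega> \<in> {}"
      using Z(2) by eventually_elim (auto simp: not_le)
  qed measurable
  finally show ?thesis by simp
qed

lemma iid: "n \<ge> 1 \<Longrightarrow> iid_edge_weights (M n) n (X n) (\<nu> n)"
proof -
  assume n: "n \<ge> 1"
  have "(\<lambda>\<omega>. Z \<omega> powr s n) \<in> borel_measurable N" using Z(1) by measurable
  then have "real_distribution (\<nu> n)"
    unfolding \<nu>_def by (rule prob_space.real_distribution_distr[OF N])
  then show ?thesis
    using M[OF n] X_indep[OF n] X_distr[OF n] \<nu>_nonpos[OF n]
    by (intro iid_edge_weights.intro iid_edge_weights_axioms.intro) (simp_all add: \<nu>_def)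
qed

lemma prob_P: "n \<ge> 1 \<Longrightarrow> 0 \<le> P n J w" "n \<ge> 1 \<Longrightarrow> P n J w \<le> 1"
  using prob_space.prob_le_1[OF M] by (auto simp: P_def)

lemma P_mono: "n \<ge> 1 \<Longrightarrow> J \<subseteq> K \<Longrightarrow> v \<le> w \<Longrightarrow> P n J v \<le> P n K w"
proof -
  assume n: "n \<ge> 1" and J: "J \<subseteq> K" and v: "v \<le> w"
  interpret iid_edge_weights "M n" n "X n" "\<nu> n" by (rule iid[OF n])
  have "light p v \<subseteq> light p w" for p using v by (auto simp: light_def)
  then have "some_light J v \<subseteq> some_light K w" unfolding some_light_def using J by (intro UN_mono) auto
  then show ?thesis unfolding P_def using some_light_events by (intro finite_measure_mono) auto
qed

lemma ln_at_top: "filterlim (\<lambda>n. ln (real n)) at_top sequentially"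
  by real_asymp

lemma s_tendsto_0: "s \<longlonglongrightarrow> 0"
proof -
  have "(\<lambda>n. (s n * ln (real n)) / ln (real n)) \<longlonglongrightarrow> 0"
    by (rule real_tendsto_divide_at_top[OF s(3) ln_at_top])
  moreover have "eventually (\<lambda>n. (s n * ln (real n)) / ln (real n) = s n) sequentially"
    using eventually_gt_at_top[of 1] by eventually_elim auto
  ultimately show ?thesis by (rule Lim_transform_eventually)
qed

lemma s_pos: "eventually (\<lambda>n. s n > 0) sequentially"
  using eventually_ge_at_top[of 1] by eventually_elim (rule s(1))

lemma s_at_right: "filterlim s (at_right 0) sequentially"
  using s_tendsto_0 s_pos by (simp add: filterlim_at eventually_conj_iff) (auto elim: eventually_mono)

lemma m_at_top: "filterlim m at_top sequentially"
  unfolding m_def[abs_def] using s_tendsto_0 s_pos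
  by (intro LIM_at_top_divide[OF tendsto_const]) auto

text \<open>Puts \<open>n\<close> on the exponential scale in \<open>m n\<close>, with a rate
  tending to \<gamma>, so that numbers of paths can be compared with powers
  \<open>w powr m n\<close>.\<close>

lemma real_n_eq: "n \<ge> 1 \<Longrightarrow> real n = exp (m n * (s n * ln (real n)))"
  using s(1)[of n] by (simp add: m_def)

text \<open>Near 0 the limit of \<open>G x / x\<close> yields the slope \<open>lam + 1\<close>, and
  from \<open>d\<close> on the trivial bound \<open>G x \<le> 1\<close> yields the slope
  \<open>1 / d\<close>. Exponential moments require the bound on the whole half line.\<close>

lemma G_linear_bound: "\<exists>A>0. \<forall>x>0. G x \<le> A * x"
proof -
  have "eventually (\<lambda>x. G x / x < lam + 1) (at_right 0)"
    by (rule order_tendstoD(2)[OF G_lin]) simp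
  then obtain d where d: "d > 0" "\<And>x. 0 < x \<Longrightarrow> x < d \<Longrightarrow> G x / x < lam + 1"
    by (auto simp: eventually_at_right_field)
  define A where "A = max (lam + 1) (1 / d)"
  have "A > 0" using d lam by (simp add: A_def)
  moreover have "G x \<le> A * x" if x: "x > 0" for x
  proof (cases "x < d")
    case True
    then have "G x \<le> (lam + 1) * x" using d(2)[OF x] x by (simp add: pos_divide_less_eq)
    also have "\<dots> \<le> A * x" using x by (intro mult_right_mono) (auto simp: A_def)
    finally show ?thesis .
  next
    case False
    have "G x \<le> 1 / d * d" using G_le_1 d by simp
    also have "\<dots> \<le> A * x" using False d lam by (intro mult_mono) (auto simp: A_def)
    finally show ?thesis .
  qed
  ultimately show ?thesis by blast
qed

lemma edge_constants:
  obtains A K where "A > 0" "K > 0" "\<And>x. x > 0 \<Longrightarrow> G x \<le> A * x"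
    "eventually (\<lambda>n. A * Gamma (m n + 1) \<le> K * sqrt (m n) * exp (- m n) * m n powr m n) sequentially"
proof -
  obtain A where A: "A > 0" "\<And>x. x > 0 \<Longrightarrow> G x \<le> A * x" using G_linear_bound by blast
  have "eventually (\<lambda>n. Gamma (m n + 1) \<le> 2 * (sqrt (2 * pi * m n) * exp (- m n) * m n powr m n)) sequentially"
    using Gamma_upper_asymp m_at_top by (rule eventually_compose_filterlim)
  then have "eventually (\<lambda>n. A * Gamma (m n + 1) \<le> (A * 2 * sqrt (2 * pi)) * sqrt (m n) * exp (- m n) * m n powr m n) sequentially"
  proof eventually_elim
    case (elim n)
    then have "A * Gamma (m n + 1) \<le> A * (2 * (sqrt (2 * pi * m n) * exp (- m n) * m n powr m n))"
      using A by (intro mult_left_mono) auto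
    then show ?case by (simp add: real_sqrt_mult mult_ac)
  qed
  moreover have "A * 2 * sqrt (2 * pi) > 0" using A by simp
  ultimately show ?thesis using A that by blast
qed

lemma cdf_\<nu>_le:
  assumes "n \<ge> 1" "\<And>x. x > 0 \<Longrightarrow> G x \<le> A * x" "y > 0"
  shows "measure (\<nu> n) {..y} \<le> A * y powr m n"
  using assms cdf_\<nu> by simp

definition light_prob :: "nat \<Rightarrow> nat list \<Rightarrow> real \<Rightarrow> real" where
  "light_prob n p w = measure (M n) (iid_edge_weights.light (M n) (X n) p w)"

definition light_pair_prob :: "nat \<Rightarrow> nat list \<Rightarrow> nat list \<Rightarrow> real \<Rightarrow> real" where
  "light_pair_prob n p q w = measure (M n) (iid_edge_weights.light (M n) (X n) p w \<inter> iid_edge_weights.light (M n) (X n) q w)"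

text \<open>The bound of \<open>prob_light_Int_le\<close> at the parameter
  \<open>\<theta> = k * m n / w\<close>, which is optimal for a single path, with the Gamma factor
  replaced by its Stirling bound.\<close>

definition pair_bound :: "real \<Rightarrow> nat \<Rightarrow> nat \<Rightarrow> real \<Rightarrow> nat \<Rightarrow> real" where
  "pair_bound K k l w n = exp (2 * (real k * m n)) *
    (K * sqrt (m n) * exp (- m n) * (w / real k) powr m n) ^ (2 * k - l) * 2 powr (- m n * real l)"

text \<open>The quantifiers over \<open>j\<close> and \<open>w\<close> stand inside
  \<open>eventually\<close> because lengths and levels vary with \<open>n\<close>; the bound for
  pairs concerns a fixed length \<open>k\<close>.\<close>

definition moment_constant :: "real \<Rightarrow> bool" where
  "moment_constant K \<longleftrightarrow> K > 0 \<and>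
    eventually (\<lambda>n. \<forall>j\<ge>1. \<forall>w>0. \<forall>p\<in>k_paths n j.
      light_prob n p w \<le> (K * sqrt (m n) * (w / real j) powr m n) ^ j) sequentially \<and>
    (\<forall>k\<ge>1. eventually (\<lambda>n. \<forall>w>0. \<forall>l. \<forall>p\<in>k_paths n k. \<forall>q\<in>k_paths n k. card (path_edges p \<inter> path_edges q) = l \<longrightarrow>
      light_pair_prob n p q w \<le> pair_bound K k l w n) sequentially)"

lemma moment_constant_exists: "\<exists>K. moment_constant K"
proof -
  obtain A K where A: "A > 0" "K > 0" "\<And>x. x > 0 \<Longrightarrow> G x \<le> A * x"
    and AK: "eventually (\<lambda>n. A * Gamma (m n + 1) \<le> K * sqrt (m n) * exp (- m n) * m n powr m n) sequentially"
    using edge_constants by blast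
  \<comment> \<open>Stirling's bound for one edge factor at \<open>\<theta> = j * m / w\<close>: the
    factor \<open>m powr m\<close> cancels and \<open>(w / j) powr m\<close> is left.\<close>
  have step: "0 \<le> A * Gamma (m n + 1) * (real j * m n / w) powr (- m n) \<and>
      A * Gamma (m n + 1) * (real j * m n / w) powr (- m n) \<le> K * sqrt (m n) * exp (- m n) * (w / real j) powr m n"
    if AKn: "A * Gamma (m n + 1) \<le> K * sqrt (m n) * exp (- m n) * m n powr m n"
      and "m n > 0" "j \<ge> 1" "w > 0" for n j and w :: real
  proof -
    have G: "Gamma (m n + 1) > 0" using that by simp
    have "A * Gamma (m n + 1) * (real j * m n / w) powr (- m n) \<le>
        K * sqrt (m n) * exp (- m n) * m n powr m n * (real j * m n / w) powr (- m n)"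
      by (rule mult_right_mono[OF AKn]) simp
    also have "m n powr m n * (real j * m n / w) powr (- m n) = (w / real j) powr m n"
    proof -
      have "m n powr m n * (real j * m n / w) powr (- m n) = (m n / (real j * m n / w)) powr m n"
        using powr_divide[of "m n" "real j * m n / w" "m n"] that(2-4) by (simp only: powr_minus_divide) simp
      also have "m n / (real j * m n / w) = w / real j" using that(2-4) by simp
      finally show ?thesis .
    qed
    then have "K * sqrt (m n) * exp (- m n) * m n powr m n * (real j * m n / w) powr (- m n) =
        K * sqrt (m n) * exp (- m n) * (w / real j) powr m n" by (simp only: mult.assoc)
    finally show ?thesis using A G by simp
  qed
  have m_pos: "eventually (\<lambda>n. m n > 0) sequentially"
    using m_at_top by (simp add: filterlim_at_top_dense)
  have "moment_constant K"
    unfolding moment_constant_def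
  proof (intro conjI allI impI)
    show "K > 0" by fact
    show "eventually (\<lambda>n. \<forall>j\<ge>1. \<forall>w>0. \<forall>p\<in>k_paths n j.
      light_prob n p w \<le> (K * sqrt (m n) * (w / real j) powr m n) ^ j) sequentially"
      using AK m_pos eventually_ge_at_top[of 1]
    proof eventually_elim
      case (elim n)
      interpret iid_edge_weights "M n" n "X n" "\<nu> n" by (rule iid) fact
      show ?case
        unfolding light_prob_def light_pair_prob_def pair_bound_def
      proof (intro allI ballI impI)
        fix j :: nat and w :: real and p assume j: "1 \<le> j" and w: "0 < w" and p: "p \<in> k_paths n j"
        \<comment> \<open>The minimizer of
          \<open>exp (\<theta> * w) * \<theta> powr (- j * m)\<close>. Then
          \<open>exp (\<theta> * w)\<close> exactly cancels the \<open>j\<close> factors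
          \<open>exp (- m)\<close> of Stirling's bound.\<close>
        let ?\<theta> = "real j * m n / w"
        have "prob (light p w) \<le> exp (?\<theta> * w) * (A * Gamma (m n + 1) * ?\<theta> powr (- m n)) ^ j"
          using A(1) elim(2) j w by (intro prob_light_le[OF p] cdf_\<nu>_le[OF elim(3) A(3)]) auto
        also have "\<dots> \<le> exp (?\<theta> * w) * (K * sqrt (m n) * exp (- m n) * (w / real j) powr m n) ^ j"
          using step[OF elim(1,2) j w] by (intro mult_left_mono power_mono) auto
        also have "exp (?\<theta> * w) = exp (m n) ^ j" using w by (simp add: exp_of_nat_mult[symmetric])
        also have "exp (m n) ^ j * (K * sqrt (m n) * exp (- m n) * (w / real j) powr m n) ^ j =
            (K * sqrt (m n) * (w / real j) powr m n) ^ j"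
        proof -
          have "exp (m n) * (K * sqrt (m n) * exp (- m n) * (w / real j) powr m n) = K * sqrt (m n) * (w / real j) powr m n"
            by (simp add: exp_minus)
          then show ?thesis by (simp only: power_mult_distrib[symmetric])
        qed
        finally show "prob (light p w) \<le> (K * sqrt (m n) * (w / real j) powr m n) ^ j" .
      qed
    qed
    fix k :: nat assume k: "k \<ge> 1"
    show "eventually (\<lambda>n. \<forall>w>0. \<forall>l. \<forall>p\<in>k_paths n k. \<forall>q\<in>k_paths n k. card (path_edges p \<inter> path_edges q) = l \<longrightarrow>
      light_pair_prob n p q w \<le> pair_bound K k l w n) sequentially"
      using AK m_pos eventually_ge_at_top[of 1]
    proof eventually_elim
      case (elim n)
      interpret iid_edge_weights "M n" n "X n" "\<nu> n" by (rule iid) fact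
      show ?case
        unfolding light_prob_def light_pair_prob_def pair_bound_def
      proof (intro allI ballI impI)
        fix w :: real and l p q assume w: "0 < w" and p: "p \<in> k_paths n k" and q: "q \<in> k_paths n k"
          and l: "card (path_edges p \<inter> path_edges q) = l"
        let ?\<theta> = "real k * m n / w"
        have "prob (light p w \<inter> light q w) \<le>
            exp (2 * ?\<theta> * w) * (A * Gamma (m n + 1) * ?\<theta> powr (- m n)) ^ (2 * k - l) * 2 powr (- m n * real l)"
          using A(1) elim(2) k w
          by (intro prob_light_Int_le[OF p q _ _ _ _ l] cdf_\<nu>_le[OF elim(3) A(3)]) auto
        also have "\<dots> \<le> exp (2 * ?\<theta> * w) * (K * sqrt (m n) * exp (- m n) * (w / real k) powr m n) ^ (2 * k - l) * 2 powr (- m n * real l)"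
          using step[OF elim(1,2) k w] by (intro mult_left_mono mult_right_mono power_mono) auto
        also have "exp (2 * ?\<theta> * w) = exp (2 * (real k * m n))" using w by simp
        finally show "prob (light p w \<inter> light q w) \<le> exp (2 * (real k * m n)) *
          (K * sqrt (m n) * exp (- m n) * (w / real k) powr m n) ^ (2 * k - l) * 2 powr (- m n * real l)" .
      qed
    qed
  qed
  then show ?thesis by blast
qed

end

lemma sum_power_le_twice:
  fixes q :: real
  assumes q: "0 \<le> q" "q \<le> 1/2" and S: "S \<subseteq> {1..<n}"
  shows "(\<Sum>j\<in>S. q ^ j) \<le> 2 * q"
proof (cases "n = 0")
  case False
  have "(\<Sum>j\<in>S. q ^ j) \<le> (\<Sum>j\<in>{1..<n}. q ^ j)" using q S by (intro sum_mono2) auto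
  moreover have "{..<n} = insert 0 {1..<n}" using False by auto
  then have "(\<Sum>j<n. q ^ j) = 1 + (\<Sum>j\<in>{1..<n}. q ^ j)" by simp
  moreover have "(\<Sum>j<n. q ^ j) = (1 - q ^ n) / (1 - q)" using q by (subst sum_gp_strict) auto
  moreover have "(1 - q ^ n) / (1 - q) \<le> 1 / (1 - q)" using q by (intro divide_right_mono) auto
  moreover have "1 / (1 - q) \<le> 1 + 2 * q"
  proof -
    have "q * q \<le> q * (1/2)" using q by (intro mult_left_mono) auto
    then show ?thesis using q by (simp add: pos_divide_le_eq algebra_simps)
  qed
  ultimately show ?thesis by linarith
qed (use S q in auto)

section \<open>First moment bounds for lengths away from the minimum of g\<close>

context complete_graph_fpp
begin

text \<open>The expected number of light paths with \<open>j\<close> edges is at most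
  \<open>q n ^ j\<close>. One half of the margin absorbs the error in \<open>s n * ln n\<close>, the
  other half beats \<open>K * sqrt m\<close>; the geometric series then covers all lengths up to
  \<open>n - 1\<close> at once.\<close>

lemma P_tendsto_0_of_margin:
  assumes w: "w > 0" and \<delta>: "\<delta> > 0" and J: "J \<subseteq> {1..}"
    and margin: "\<And>j. j \<in> J \<Longrightarrow> w * exp \<delta> \<le> g_fun \<gamma> (real j)"
  shows "(\<lambda>n. P n J w) \<longlonglongrightarrow> 0"
proof -
  obtain K where K: "K > 0" and light: "eventually (\<lambda>n. \<forall>j\<ge>1. \<forall>w>0. \<forall>p\<in>k_paths n j.
      light_prob n p w \<le> (K * sqrt (m n) * (w / real j) powr m n) ^ j) sequentially"
    using moment_constant_exists unfolding moment_constant_def by blast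
  define q where "q n = K * sqrt (m n) * exp (- m n * (\<delta> / 2))" for n
  have "((\<lambda>x. K * sqrt x * exp (- x * (\<delta> / 2))) \<longlongrightarrow> 0) at_top"
    using K \<delta> by real_asymp
  then have q0: "q \<longlonglongrightarrow> 0"
    unfolding q_def[abs_def] by (rule filterlim_compose[OF _ m_at_top])
  have m_pos: "eventually (\<lambda>n. m n > 0) sequentially"
    using m_at_top by (simp add: filterlim_at_top_dense)
  have "eventually (\<lambda>n. \<bar>s n * ln (real n) - \<gamma>\<bar> < \<delta> / 2) sequentially"
    using tendstoD[OF s(3), of "\<delta> / 2"] \<delta> by (simp add: dist_real_def)
  moreover have "eventually (\<lambda>n. q n < 1/2) sequentially"
    by (rule order_tendstoD(2)[OF q0]) simp
  ultimately have "eventually (\<lambda>n. P n J w \<le> 2 * q n) sequentially"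
    using light m_pos eventually_ge_at_top[of 1]
  proof eventually_elim
    case (elim n)
    interpret iid_edge_weights "M n" n "X n" "\<nu> n" by (rule iid) fact
    let ?B = "\<lambda>j. (K * sqrt (m n) * (w / real j) powr m n) ^ j"
    have q_nonneg: "q n \<ge> 0" unfolding q_def using K elim by simp
    have "P n J w \<le> (\<Sum>j\<in>J \<inter> {..<n}. real n ^ (j - 1) * ?B j)"
      unfolding P_def using J elim(3)[unfolded light_prob_def] w K elim(4)
      by (intro prob_some_light_le) (auto intro!: zero_le_power)
    also have "\<dots> \<le> (\<Sum>j\<in>J \<inter> {..<n}. q n ^ j)"
    proof (intro sum_mono)
      fix j assume j: "j \<in> J \<inter> {..<n}"
      then have j1: "j \<ge> 1" using J by auto
      let ?g = "s n * ln (real n)"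
      have "real n ^ (j - 1) = exp (m n * ?g) ^ (j - 1)" using real_n_eq[OF elim(5)] by simp
      also have "\<dots> = exp (real (j - 1) * (m n * ?g))" by (rule exp_of_nat_mult[symmetric])
      \<comment> \<open>The factor \<open>n ^ (j - 1)\<close> is spread evenly over the
        \<open>j\<close> edges, which produces the exponent \<open>1 - 1 / j\<close> of
        \<open>g_fun\<close>.\<close>
      also have "\<dots> = exp (real j * (m n * (?g * (1 - 1 / real j))))"
        using j1 by (simp add: of_nat_diff field_simps)
      also have "\<dots> = exp (m n * (?g * (1 - 1 / real j))) ^ j" by (rule exp_of_nat_mult)
      finally have n_pow: "real n ^ (j - 1) = exp (m n * (?g * (1 - 1 / real j))) ^ j" .
      have w_pow: "(w / real j) powr m n = exp (m n * (ln w - ln (real j)))"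
        using w j1 by (simp add: powr_def ln_div)
      have "real n ^ (j - 1) * ?B j =
          (K * sqrt (m n) * exp (m n * (?g * (1 - 1 / real j) + ln w - ln (real j)))) ^ j"
        unfolding n_pow w_pow power_mult_distrib[symmetric]
        by (simp add: exp_add[symmetric] algebra_simps)
      also have "\<dots> \<le> q n ^ j"
      proof (intro power_mono)
        have "ln (w * exp \<delta>) \<le> ln (g_fun \<gamma> (real j))"
          using margin[of j] j w j1 g_fun_pos[OF j1, of \<gamma>] by (subst ln_le_cancel_iff) auto
        then have 1: "ln w + \<delta> \<le> ln (real j) - \<gamma> * (1 - 1 / real j)"
          using w ln_g_fun[OF j1, of \<gamma>] by (simp add: ln_mult)
        have "?g - \<gamma> \<le> \<delta> / 2" using elim(1) by linarith
        then have "(?g - \<gamma>) * (1 - 1 / real j) \<le> \<delta> / 2 * 1"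
          using j1 \<delta> by (intro mult_mono) auto
        then have "?g * (1 - 1 / real j) - \<gamma> * (1 - 1 / real j) \<le> \<delta> / 2"
          by (simp only: left_diff_distrib mult_1_right)
        then have "?g * (1 - 1 / real j) + ln w - ln (real j) \<le> - (\<delta> / 2)"
          using 1 by argo
        then have "m n * (?g * (1 - 1 / real j) + ln w - ln (real j)) \<le> m n * (- (\<delta> / 2))"
          using elim(4) by (intro mult_left_mono) auto
        then show "K * sqrt (m n) * exp (m n * (?g * (1 - 1 / real j) + ln w - ln (real j))) \<le> q n"
          unfolding q_def using K elim(4) by (intro mult_left_mono) auto
        show "0 \<le> K * sqrt (m n) * exp (m n * (?g * (1 - 1 / real j) + ln w - ln (real j)))"
          using K elim(4) by simp
      qed
      finally show "real n ^ (j - 1) * ?B j \<le> q n ^ j" .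
    qed
    also have "\<dots> \<le> 2 * q n"
    proof (rule sum_power_le_twice)
      show "J \<inter> {..<n} \<subseteq> {1..<n}" using J by auto
    qed (use elim q_nonneg in auto)
    finally show ?case .
  qed
  moreover have "eventually (\<lambda>n. 0 \<le> P n J w) sequentially"
    using eventually_ge_at_top[of 1] by eventually_elim (rule prob_P)
  moreover have "(\<lambda>n. 2 * q n) \<longlonglongrightarrow> 0" using tendsto_mult_right_zero[OF q0, of 2] by simp
  ultimately show ?thesis
    using tendsto_sandwich[of "\<lambda>_. 0" "\<lambda>n. P n J w" sequentially "\<lambda>n. 2 * q n" 0] by simp
qed

lemma P_tendsto_0_beyond:
  assumes J: "J \<subseteq> {1..}" and c: "c > 0" and less: "\<And>j. j \<in> J \<Longrightarrow> c < g_fun \<gamma> (real j)"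
  obtains w where "w > c" "(\<lambda>n. P n J w) \<longlonglongrightarrow> 0"
proof -
  obtain w \<delta> where "w > c" "\<delta> > 0" "\<And>j. j \<in> J \<Longrightarrow> w * exp \<delta> \<le> g_fun \<gamma> (real j)"
    using g_fun_gap[OF J c s(2) less] by blast
  then show ?thesis using that P_tendsto_0_of_margin[of w \<delta> J] J c by auto
qed

text \<open>Levels tending to \<open>c\<close> are eventually below the fixed level
  \<open>w > c\<close> of \<open>P_tendsto_0_beyond\<close>, and light paths only increase with the
  level.\<close>

lemma P_tendsto_0:
  assumes J: "J \<subseteq> {1..}" and c: "c > 0" and less: "\<And>j. j \<in> J \<Longrightarrow> c < g_fun \<gamma> (real j)"
    and v: "v \<longlonglongrightarrow> c"
  shows "(\<lambda>n. P n J (v n)) \<longlonglongrightarrow> 0"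
proof -
  obtain w where w: "w > c" "(\<lambda>n. P n J w) \<longlonglongrightarrow> 0" using P_tendsto_0_beyond[OF J c less] by blast
  have "eventually (\<lambda>n. P n J (v n) \<le> P n J w) sequentially"
    using order_tendstoD(2)[OF v w(1)] eventually_ge_at_top[of 1]
    by eventually_elim (auto intro: P_mono)
  moreover have "eventually (\<lambda>n. 0 \<le> P n J (v n)) sequentially"
    using eventually_ge_at_top[of 1] by eventually_elim (rule prob_P)
  ultimately show ?thesis
    using tendsto_sandwich[of "\<lambda>_. 0" "\<lambda>n. P n J (v n)" sequentially "\<lambda>n. P n J w" 0] w by simp
qed

section \<open>From light paths to the laws of the hopcount and of the minimal weight\<close>

definition hop_prob :: "nat \<Rightarrow> nat set \<Rightarrow> real" where
  "hop_prob n J = measure (M n) {\<omega> \<in> space (M n). hopcount n (\<lambda>e. X n e \<omega>) \<in> J}"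

lemma hop_prob_bounds: "n \<ge> 2 \<Longrightarrow> K \<subseteq> {1..} \<Longrightarrow> P n K w - P n ({1..} - J) w \<le> hop_prob n J"
  and hop_prob_le_1: "n \<ge> 2 \<Longrightarrow> hop_prob n J \<le> 1"
proof -
  show "hop_prob n J \<le> 1" if "n \<ge> 2"
    unfolding hop_prob_def using that by (intro prob_space.prob_le_1 M) auto
  assume n: "n \<ge> 2" and K: "K \<subseteq> {1..}"
  interpret iid_edge_weights "M n" n "X n" "\<nu> n" using n by (intro iid) auto
  show "P n K w - P n ({1..} - J) w \<le> hop_prob n J"
    unfolding P_def hop_prob_def by (rule prob_hopcount_ge[OF n K])
qed

text \<open>For given levels the limit of \<open>P n K\<close> may stay below 1, as it does in the
  Gumbel regime. The levels are therefore allowed to depend on \<open>\<eta>\<close>.\<close>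

lemma hop_prob_tendsto_1:
  assumes lower: "\<And>\<eta>. \<eta> > 0 \<Longrightarrow> \<exists>K w L. K \<subseteq> {1..} \<and> (\<lambda>n. P n K (w n)) \<longlonglongrightarrow> L \<and> 1 - \<eta> < L \<and>
      (\<lambda>n. P n ({1..} - J) (w n)) \<longlonglongrightarrow> 0"
  shows "(\<lambda>n. hop_prob n J) \<longlonglongrightarrow> 1"
proof (rule order_tendstoI)
  fix a :: real assume a: "a < 1"
  obtain K w L where K: "K \<subseteq> {1..}" and L: "(\<lambda>n. P n K (w n)) \<longlonglongrightarrow> L" "a < L"
    and 0: "(\<lambda>n. P n ({1..} - J) (w n)) \<longlonglongrightarrow> 0"
    using lower[of "1 - a"] a by auto
  have "(\<lambda>n. P n K (w n) - P n ({1..} - J) (w n)) \<longlonglongrightarrow> L - 0" by (intro tendsto_diff L 0)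
  then have "eventually (\<lambda>n. a < P n K (w n) - P n ({1..} - J) (w n)) sequentially"
    using L(2) by (intro order_tendstoD(1)) auto
  then show "eventually (\<lambda>n. a < hop_prob n J) sequentially"
    using eventually_ge_at_top[of 2]
    by eventually_elim (use hop_prob_bounds[OF _ K] in \<open>force intro: less_le_trans\<close>)
next
  fix a :: real assume a: "1 < a"
  have "eventually (\<lambda>n. n \<ge> (2::nat)) sequentially" by (rule eventually_ge_at_top)
  then show "eventually (\<lambda>n. hop_prob n J < a) sequentially"
    by eventually_elim (rule le_less_trans[OF hop_prob_le_1 a])
qed

definition weight_cdf :: "nat \<Rightarrow> real \<Rightarrow> real" where
  "weight_cdf n w = measure (M n) {\<omega> \<in> space (M n). min_weight n (\<lambda>e. X n e \<omega>) \<le> w}"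

lemma weight_cdf_bounds:
  assumes "n \<ge> 2" "K \<subseteq> {1..}"
  shows "P n K w \<le> weight_cdf n w" "weight_cdf n w \<le> P n K w + P n ({1..} - K) w"
proof -
  interpret iid_edge_weights "M n" n "X n" "\<nu> n" using assms by (intro iid) auto
  show "P n K w \<le> weight_cdf n w" "weight_cdf n w \<le> P n K w + P n ({1..} - K) w"
    unfolding P_def weight_cdf_def by (rule prob_min_weight_le_bounds[OF assms])+
qed

lemma weight_cdf_tendsto:
  assumes K: "K \<subseteq> {1..}" and L: "(\<lambda>n. P n K (w n)) \<longlonglongrightarrow> L" and 0: "(\<lambda>n. P n ({1..} - K) (w n)) \<longlonglongrightarrow> 0"
  shows "(\<lambda>n. weight_cdf n (w n)) \<longlonglongrightarrow> L"
proof (rule tendsto_sandwich)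
  show "eventually (\<lambda>n. P n K (w n) \<le> weight_cdf n (w n)) sequentially"
    using eventually_ge_at_top[of 2] by eventually_elim (rule weight_cdf_bounds[OF _ K])
  show "eventually (\<lambda>n. weight_cdf n (w n) \<le> P n K (w n) + P n ({1..} - K) (w n)) sequentially"
    using eventually_ge_at_top[of 2] by eventually_elim (rule weight_cdf_bounds[OF _ K])
  show "(\<lambda>n. P n K (w n) + P n ({1..} - K) (w n)) \<longlonglongrightarrow> L" using tendsto_add[OF L 0] by simp
qed (rule L)

lemma min_weight_measurable_M: "n \<ge> 2 \<Longrightarrow> (\<lambda>\<omega>. min_weight n (\<lambda>e. X n e \<omega>)) \<in> borel_measurable (M n)"
proof -
  assume n: "n \<ge> 2"
  interpret iid_edge_weights "M n" n "X n" "\<nu> n" using n by (intro iid) auto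
  show ?thesis using n by (rule min_weight_measurable)
qed

text \<open>Paths with lengths in \<open>K\<close> exclude large weights, and the first moment bound
  over all lengths excludes small ones: at a level strictly below \<open>c\<close> there is a gap to
  every \<open>g_fun \<gamma> j\<close>, whether or not \<open>c\<close> is attained more than
  once.\<close>

lemma conv_in_prob_min_weight:
  assumes K: "K \<subseteq> {1..}" and c: "c > 0" and upper: "\<And>\<epsilon>. \<epsilon> > 0 \<Longrightarrow> (\<lambda>n. P n K (c + \<epsilon>)) \<longlonglongrightarrow> 1"
    and ge: "\<And>j. j \<ge> 1 \<Longrightarrow> c \<le> g_fun \<gamma> (real j)"
  shows "conv_in_prob M (\<lambda>n \<omega>. min_weight n (\<lambda>e. X n e \<omega>)) c"
  unfolding conv_in_prob_def
proof (intro allI impI)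
  fix \<epsilon> :: real assume \<epsilon>: "\<epsilon> > 0"
  \<comment> \<open>The maximum keeps the level positive when \<open>\<epsilon>\<close> is
    large.\<close>
  define w where "w = max (c - \<epsilon>) (c / 2)"
  have w: "0 < w" "w < c" using c \<epsilon> by (auto simp: w_def)
  have "(\<lambda>n. P n {1..} w) \<longlonglongrightarrow> 0"
    using w less_le_trans[OF w(2) ge] by (intro P_tendsto_0[of "{1..}" w "\<lambda>_. w"]) auto
  moreover have "(\<lambda>n. 1 - P n K (c + \<epsilon>)) \<longlonglongrightarrow> 1 - 1" by (intro tendsto_intros upper \<epsilon>)
  ultimately have lim: "(\<lambda>n. P n {1..} w + (1 - P n K (c + \<epsilon>))) \<longlonglongrightarrow> 0"
    using tendsto_add by fastforce
  let ?W = "\<lambda>n \<omega>. min_weight n (\<lambda>e. X n e \<omega>)"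
  show "(\<lambda>n. measure (M n) {\<omega> \<in> space (M n). \<epsilon> < \<bar>?W n \<omega> - c\<bar>}) \<longlonglongrightarrow> 0"
  proof (rule tendsto_sandwich[OF _ _ tendsto_const lim])
    show "eventually (\<lambda>n. measure (M n) {\<omega> \<in> space (M n). \<epsilon> < \<bar>?W n \<omega> - c\<bar>} \<le>
        P n {1..} w + (1 - P n K (c + \<epsilon>))) sequentially"
      using eventually_ge_at_top[of 2]
    proof eventually_elim
      case (elim n)
      interpret prob_space "M n" using elim by (intro M) auto
      note [measurable] = min_weight_measurable_M[OF elim]
      have "{\<omega> \<in> space (M n). \<epsilon> < \<bar>?W n \<omega> - c\<bar>} \<subseteq>
          {\<omega> \<in> space (M n). ?W n \<omega> \<le> w} \<union> (space (M n) - {\<omega> \<in> space (M n). ?W n \<omega> \<le> c + \<epsilon>})"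
        by (auto simp: w_def)
      then have "prob {\<omega> \<in> space (M n). \<epsilon> < \<bar>?W n \<omega> - c\<bar>} \<le>
          prob ({\<omega> \<in> space (M n). ?W n \<omega> \<le> w} \<union> (space (M n) - {\<omega> \<in> space (M n). ?W n \<omega> \<le> c + \<epsilon>}))"
        by (intro finite_measure_mono) auto
      also have "\<dots> \<le> prob {\<omega> \<in> space (M n). ?W n \<omega> \<le> w} + prob (space (M n) - {\<omega> \<in> space (M n). ?W n \<omega> \<le> c + \<epsilon>})"
        by (intro measure_Un_le) auto
      also have "\<dots> = weight_cdf n w + (1 - weight_cdf n (c + \<epsilon>))"
        by (subst prob_compl) (auto simp: weight_cdf_def)
      finally have 1: "prob {\<omega> \<in> space (M n). \<epsilon> < \<bar>?W n \<omega> - c\<bar>} \<le> weight_cdf n w + (1 - weight_cdf n (c + \<epsilon>))" .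
      have "weight_cdf n w \<le> P n {1..} w + P n ({1..} - {1..}) w"
        using elim by (intro weight_cdf_bounds) auto
      moreover have "P n ({1..} - {1..}) w = 0"
        using elim iid[of n] by (simp add: P_def iid_edge_weights.some_light_def)
      moreover have "P n K (c + \<epsilon>) \<le> weight_cdf n (c + \<epsilon>)" using elim K by (intro weight_cdf_bounds) auto
      ultimately show ?case using 1 by linarith
    qed
  qed auto
qed

lemma P_one_edge: "n \<ge> 2 \<Longrightarrow> w > 0 \<Longrightarrow> P n {1} w = G (w powr m n)"
proof -
  assume n: "n \<ge> 2" and w: "w > 0"
  interpret iid_edge_weights "M n" n "X n" "\<nu> n" using n by (intro iid) auto
  have "k_paths n 1 = {[1, 2]}"
    using n by (subst k_paths_eq_image) (auto simp: image_iff)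
  moreover have "[1, 2] \<in> sa_paths n" using n by (simp add: sa_paths_def)
  moreover have pe: "path_edges [1, 2] = {{1, 2}}" by (auto simp: path_edges_def)
  ultimately have "P n {1} w = measure (distr (M n) borel (X n {1, 2})) {..w}"
    by (simp add: P_def some_light_def prob_light)
  also have "distr (M n) borel (X n {1, 2}) = \<nu> n"
    using n by (intro distr_X) (auto simp: complete_edges_def)
  finally show ?thesis using n w by (simp add: cdf_\<nu>)
qed

end

section \<open>The Poisson limit for paths of optimal length\<close>

context complete_graph_fpp
begin

text \<open>It compensates what is left of the mean number of light paths: the quotient of
  \<open>n ^ (k - 1)\<close> by \<open>exp (\<gamma> * (k - 1) * m n)\<close>, and the power
  \<open>m n powr ((k - 1) / 2)\<close> from \<open>dirichlet_coeff\<close>.\<close>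

definition centering :: "nat \<Rightarrow> nat \<Rightarrow> real" where
  "centering k n = (real k - 1) / s n * (s n * ln (real n) - \<gamma> - s n * ln (s n) / 2)"

definition deviation :: "nat \<Rightarrow> real \<Rightarrow> nat \<Rightarrow> real" where
  "deviation k t n = s n / real k * (t - centering k n)"

text \<open>The solution \<open>x\<close> of \<open>rescaled k n x = t\<close>;
  \<open>deviation\<close> is its relative distance from
  \<open>lam powr (- s n) * g_fun \<gamma> k\<close>.\<close>

definition threshold :: "nat \<Rightarrow> real \<Rightarrow> nat \<Rightarrow> real" where
  "threshold k t n = lam powr (- s n) * g_fun \<gamma> (real k) * (1 + deviation k t n)"

lemma m_pos: "eventually (\<lambda>n. m n > 0) sequentially"
  using m_at_top by (simp add: filterlim_at_top_dense)

text \<open>Here the rate condition acts: \<open>sqrt (s n) * centering k n\<close> is a combination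
  of \<open>(s n * ln n - \<gamma>) / sqrt (s n)\<close> and \<open>sqrt (s n) * ln (s n)\<close>,
  and both vanish in the limit.\<close>

lemma sqrt_s_centering:
  assumes rate: "(\<lambda>n. (s n * ln (real n) - \<gamma>) / sqrt (s n)) \<longlonglongrightarrow> 0"
  shows "(\<lambda>n. sqrt (s n) * (t - centering k n)) \<longlonglongrightarrow> 0"
proof -
  have "((\<lambda>x::real. sqrt x) \<longlongrightarrow> 0) (at_right 0)" "((\<lambda>x::real. sqrt x * ln x) \<longlongrightarrow> 0) (at_right 0)"
    by real_asymp+
  then have 1: "(\<lambda>n. sqrt (s n)) \<longlonglongrightarrow> 0" "(\<lambda>n. sqrt (s n) * ln (s n)) \<longlonglongrightarrow> 0"
    using s_at_right by (auto intro: filterlim_compose)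
  have "(\<lambda>n. sqrt (s n) * t - (real k - 1) * ((s n * ln (real n) - \<gamma>) / sqrt (s n) - sqrt (s n) * ln (s n) / 2))
      \<longlonglongrightarrow> 0 * t - (real k - 1) * (0 - 0 / 2)"
    by (intro tendsto_intros 1 rate) simp
  moreover have "eventually (\<lambda>n. sqrt (s n) * t - (real k - 1) * ((s n * ln (real n) - \<gamma>) / sqrt (s n) - sqrt (s n) * ln (s n) / 2)
      = sqrt (s n) * (t - centering k n)) sequentially"
    using s_pos
  proof eventually_elim
    case (elim n)
    define r where "r = sqrt (s n)"
    have r: "r > 0" "s n = r * r" using elim by (auto simp: r_def)
    show ?case unfolding centering_def r_def[symmetric]
      using r(1) by (simp only: r(2)) (simp add: field_simps)
  qed
  ultimately show ?thesis using Lim_transform_eventually by fastforce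
qed

text \<open>The deviation is of smaller order than \<open>sqrt (s n)\<close>. The second limit
  controls the error of replacing \<open>(1 + d) powr (k * m n)\<close> by
  \<open>exp (k * m n * d)\<close>.\<close>

lemma deviation_tendsto:
  assumes rate: "(\<lambda>n. (s n * ln (real n) - \<gamma>) / sqrt (s n)) \<longlonglongrightarrow> 0" and k: "k \<ge> 1"
  shows "deviation k t \<longlonglongrightarrow> 0" "(\<lambda>n. m n * (deviation k t n)\<^sup>2) \<longlonglongrightarrow> 0"
proof -
  note 1 = sqrt_s_centering[OF rate, of t k]
  have 2: "(\<lambda>n. sqrt (s n)) \<longlonglongrightarrow> 0" using tendsto_real_sqrt[OF s_tendsto_0] by simp
  have "(\<lambda>n. sqrt (s n) * (sqrt (s n) * (t - centering k n)) / real k) \<longlonglongrightarrow> 0 * 0 / real k"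
    using k by (intro tendsto_intros 1 2) auto
  moreover have "eventually (\<lambda>n. sqrt (s n) * (sqrt (s n) * (t - centering k n)) / real k = deviation k t n) sequentially"
    using s_pos by eventually_elim (simp add: deviation_def mult.assoc[symmetric])
  ultimately show "deviation k t \<longlonglongrightarrow> 0" using Lim_transform_eventually by fastforce
  have "(\<lambda>n. (sqrt (s n) * (t - centering k n) / real k)\<^sup>2) \<longlonglongrightarrow> (0 / real k)\<^sup>2"
    using k by (intro tendsto_intros 1) auto
  moreover have "eventually (\<lambda>n. (sqrt (s n) * (t - centering k n) / real k)\<^sup>2 = m n * (deviation k t n)\<^sup>2) sequentially"
    using s_pos
  proof eventually_elim
    case (elim n)
    have "m n * (s n)\<^sup>2 = (sqrt (s n))\<^sup>2" using elim by (simp add: m_def power2_eq_square)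
    then show ?case by (simp add: deviation_def power_mult_distrib power_divide mult.assoc[symmetric])
  qed
  ultimately show "(\<lambda>n. m n * (deviation k t n)\<^sup>2) \<longlonglongrightarrow> 0" using Lim_transform_eventually by fastforce
qed

lemma threshold_tendsto:
  assumes rate: "(\<lambda>n. (s n * ln (real n) - \<gamma>) / sqrt (s n)) \<longlonglongrightarrow> 0" and k: "k \<ge> 1"
  shows "threshold k t \<longlonglongrightarrow> g_fun \<gamma> (real k)"
proof -
  have "(\<lambda>n. lam powr (- s n) * g_fun \<gamma> (real k) * (1 + deviation k t n)) \<longlonglongrightarrow>
      lam powr (- 0) * g_fun \<gamma> (real k) * (1 + 0)"
    using lam by (intro tendsto_intros s_tendsto_0 deviation_tendsto[OF rate k]) auto
  then show ?thesis using lam by (simp add: threshold_def[abs_def])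
qed

text \<open>The leading term of the expected number of light paths, with \<open>n ^ (k - 1)\<close>
  for the number of paths and with \<open>G\<close> replaced by its tangent at 0.\<close>

definition mean_count :: "nat \<Rightarrow> real \<Rightarrow> nat \<Rightarrow> real" where
  "mean_count k t n = real n ^ (k - 1) * (lam ^ k * dirichlet_coeff (m n) k * threshold k t n powr (real k * m n))"

text \<open>Because \<open>s n * m n = 1\<close>, the factor \<open>lam powr (- s n)\<close> of the
  threshold cancels \<open>lam ^ k\<close>. To first order the deviation contributes
  \<open>exp (k * m n * d)\<close>, which is \<open>exp t\<close> times the exact inverse of
  \<open>n ^ (k - 1) * exp (- \<gamma> * (k - 1) * m n) * m n powr ((k - 1) / 2)\<close>.\<close>

lemma mean_count_tendsto:
  assumes rate: "(\<lambda>n. (s n * ln (real n) - \<gamma>) / sqrt (s n)) \<longlonglongrightarrow> 0" and k: "k \<ge> 1"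
  shows "mean_count k t \<longlonglongrightarrow> a_const k * exp t"
proof -
  let ?d = "deviation k t"
  have "(\<lambda>n. real k * m n * (ln (1 + ?d n) - ?d n)) \<longlonglongrightarrow> 0"
  proof (rule Lim_null_comparison)
    have "eventually (\<lambda>n. \<bar>?d n\<bar> < 1/2) sequentially"
      using tendstoD[OF deviation_tendsto(1)[OF rate k, of t], of "1/2"] by (simp add: dist_real_def)
    then show "eventually (\<lambda>n. norm (real k * m n * (ln (1 + ?d n) - ?d n)) \<le> 2 * real k * (m n * (?d n)\<^sup>2)) sequentially"
      using m_pos
    proof eventually_elim
      case (elim n)
      have "\<bar>ln (1 + ?d n) - ?d n\<bar> \<le> 2 * (?d n)\<^sup>2"
        using elim by (intro abs_ln_one_plus_x_minus_x_bound) auto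
      then have "real k * m n * \<bar>ln (1 + ?d n) - ?d n\<bar> \<le> real k * m n * (2 * (?d n)\<^sup>2)"
        using elim by (intro mult_left_mono) auto
      then show ?case using elim by (simp add: abs_mult mult_ac)
    qed
    show "(\<lambda>n. 2 * real k * (m n * (?d n)\<^sup>2)) \<longlonglongrightarrow> 0"
      by (rule tendsto_mult_right_zero[OF deviation_tendsto(2)[OF rate k]])
  qed
  then have e: "(\<lambda>n. exp (t + real k * m n * (ln (1 + ?d n) - ?d n))) \<longlonglongrightarrow> exp (t + 0)"
    by (intro tendsto_intros)
  have D: "(\<lambda>n. dirichlet_coeff (m n) k * real k powr (real k * m n) * m n powr (- (real k - 1) / 2)) \<longlonglongrightarrow> a_const k"
    by (rule filterlim_compose[OF dirichlet_coeff_asymp[OF k] m_at_top])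
  have "eventually (\<lambda>n. deviation k t n > -1) sequentially"
    by (rule order_tendstoD(1)[OF deviation_tendsto(1)[OF rate k]]) simp
  then have "eventually (\<lambda>n. dirichlet_coeff (m n) k * real k powr (real k * m n) * m n powr (- (real k - 1) / 2) *
      exp (t + real k * m n * (ln (1 + ?d n) - ?d n)) = mean_count k t n) sequentially"
    using s_pos m_pos eventually_ge_at_top[of 1]
  proof eventually_elim
    case (elim n)
    have d: "1 + ?d n > 0" using elim by simp
    have g: "g_fun \<gamma> (real k) > 0" using k by (rule g_fun_pos)
    have sm: "s n * m n = 1" using elim by (simp add: m_def)
    have lnm: "ln (m n) = - ln (s n)" using elim by (simp add: m_def ln_div)
    have thr: "threshold k t n > 0" unfolding threshold_def using lam g d by simp
    have "ln (threshold k t n) = - s n * ln lam + ln (g_fun \<gamma> (real k)) + ln (1 + ?d n)"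
      unfolding threshold_def using lam g d by (simp add: ln_mult)
    also have "ln (g_fun \<gamma> (real k)) = ln (real k) - \<gamma> * (1 - 1 / real k)" by (rule ln_g_fun[OF k])
    finally have lt: "ln (threshold k t n) = - s n * ln lam + (ln (real k) - \<gamma> * (1 - 1 / real k)) + ln (1 + ?d n)" .
    define c where "c = 1 - 1 / real k"
    have "real k * m n * ln (threshold k t n) =
        - (real k * ln lam) * (s n * m n) + real k * m n * ln (real k) - \<gamma> * (real k * c) * m n + real k * m n * ln (1 + ?d n)"
      unfolding lt c_def[symmetric] by (simp add: algebra_simps)
    moreover have "real k * c = real k - 1" using k by (simp add: c_def field_simps)
    ultimately have "real k * m n * ln (threshold k t n) =
        - (real k * ln lam) * (s n * m n) + real k * m n * ln (real k) - \<gamma> * (real k - 1) * m n + real k * m n * ln (1 + ?d n)"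
      by simp
    then have lthr: "real k * m n * ln (threshold k t n) =
        - (real k * ln lam) + real k * m n * ln (real k) - \<gamma> * (real k - 1) * m n + real k * m n * ln (1 + ?d n)"
      using sm by simp
    have kd: "real k * m n * ?d n = t - (real k - 1) * (ln (real n) - \<gamma> * m n - ln (s n) / 2)"
    proof -
      have "real k * m n * ?d n = (s n * m n) * (t - centering k n)" using k by (simp add: deviation_def)
      also have "centering k n = (real k - 1) * (ln (real n) - \<gamma> * m n - ln (s n) / 2)"
        using elim by (simp add: centering_def m_def field_simps)
      finally show ?thesis using sm by simp
    qed
    have "lam ^ k * threshold k t n powr (real k * m n) * real n ^ (k - 1) =
        exp (real k * ln lam) * exp (real k * m n * ln (threshold k t n)) * exp ((real k - 1) * ln (real n))"
    proof -
      have "lam ^ k = exp (real k * ln lam)" using lam by (simp add: exp_of_nat_mult)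
      moreover have "real n ^ (k - 1) = exp ((real k - 1) * ln (real n))"
        using elim k exp_of_nat_mult[of "k - 1" "ln (real n)"] by (simp add: of_nat_diff)
      ultimately show ?thesis using thr by (simp add: powr_def)
    qed
    also have "\<dots> = real k powr (real k * m n) * m n powr (- (real k - 1) / 2) *
        exp (t + real k * m n * (ln (1 + ?d n) - ?d n))"
      unfolding powr_def using elim k lnm
      by (simp add: exp_add[symmetric] lthr right_diff_distrib[of "real k * m n"] kd) (simp add: field_simps)
    finally show ?case unfolding mean_count_def by (simp add: mult_ac)
  qed
  from Lim_transform_eventually[OF tendsto_mult[OF D e] this] show ?thesis by simp
qed

text \<open>At a level below 1 all edges of a light path have weight at most \<open>b < 1\<close>.
  Then \<open>y powr m n\<close> is uniformly small, and \<open>G\<close> may be replaced by its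
  linear part with relative error \<open>\<epsilon>\<close> per edge.\<close>

lemma prob_light_relative:
  assumes k: "k \<ge> 1" and \<epsilon>: "0 < \<epsilon>" "\<epsilon> < 1"
    and v: "v \<longlonglongrightarrow> c" "0 < c" "c < 1"
  shows "eventually (\<lambda>n. \<forall>p\<in>k_paths n k.
      (1 - \<epsilon>) ^ k * (lam ^ k * dirichlet_coeff (m n) k * v n powr (real k * m n)) \<le> light_prob n p (v n) \<and>
      light_prob n p (v n) \<le> (1 + \<epsilon>) ^ k * (lam ^ k * dirichlet_coeff (m n) k * v n powr (real k * m n))) sequentially"
proof -
  define b where "b = (1 + c) / 2"
  have b: "c < b" "b < 1" "0 < b" using v by (auto simp: b_def)
  have "eventually (\<lambda>x. \<bar>G x / x - lam\<bar> < \<epsilon> * lam) (at_right 0)"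
    using tendstoD[OF G_lin, of "\<epsilon> * lam"] \<epsilon> lam by (simp add: dist_real_def)
  then obtain d where d: "d > 0" "\<And>x. 0 < x \<Longrightarrow> x < d \<Longrightarrow> \<bar>G x / x - lam\<bar> < \<epsilon> * lam"
    by (auto simp: eventually_at_right_field)
  have "((\<lambda>x. b powr x) \<longlongrightarrow> 0) at_top" using b by real_asymp
  then have "(\<lambda>n. b powr m n) \<longlonglongrightarrow> 0" by (rule filterlim_compose[OF _ m_at_top])
  then have "eventually (\<lambda>n. b powr m n < d) sequentially" using d(1) by (rule order_tendstoD(2))
  then show ?thesis
    using order_tendstoD(2)[OF v(1) b(1)] order_tendstoD(1)[OF v(1) v(2)] m_pos eventually_ge_at_top[of 1]
  proof eventually_elim
    case (elim n)
    interpret iid_edge_weights "M n" n "X n" "\<nu> n" by (rule iid) fact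
    have G: "(1 - \<epsilon>) * lam * y powr m n \<le> measure (\<nu> n) {..y} \<and> measure (\<nu> n) {..y} \<le> (1 + \<epsilon>) * lam * y powr m n"
      if y: "0 < y" "y \<le> b" for y
    proof -
      let ?x = "y powr m n"
      have x: "?x > 0" using y by simp
      have "?x \<le> b powr m n" using y elim by (intro powr_mono2) auto
      then have "\<bar>G ?x / ?x - lam\<bar> < \<epsilon> * lam" using d(2)[OF x] elim(1) by simp
      then have "(1 - \<epsilon>) * lam \<le> G ?x / ?x" "G ?x / ?x \<le> (1 + \<epsilon>) * lam" by (auto simp: algebra_simps)
      then show ?thesis using x elim y by (simp add: cdf_\<nu> pos_le_divide_eq pos_divide_le_eq)
    qed
    show ?case
      unfolding light_prob_def
    proof
      fix p assume p: "p \<in> k_paths n k"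
      then have sa: "p \<in> sa_paths n" by (simp add: k_paths_def)
      have card: "card (path_edges p) = k" by (rule card_path_edges_k_paths[OF p])
      have E: "finite (path_edges p)" "path_edges p \<noteq> {}" "path_edges p \<subseteq> complete_edges n"
        using finite_path_edges path_edges_subset[OF sa] card k by auto
      have "((1 - \<epsilon>) * lam) ^ k * dirichlet_coeff (m n) k * v n powr (real k * m n) \<le> prob (light p (v n)) \<and>
          prob (light p (v n)) \<le> ((1 + \<epsilon>) * lam) ^ k * dirichlet_coeff (m n) k * v n powr (real k * m n)"
        unfolding prob_light[OF sa]
        using distr_sum_X_cdf_bounds[OF E, of "(1 - \<epsilon>) * lam" "(1 + \<epsilon>) * lam" "m n" b "v n"] G elim lam \<epsilon> card by auto
      then show "(1 - \<epsilon>) ^ k * (lam ^ k * dirichlet_coeff (m n) k * v n powr (real k * m n)) \<le> prob (light p (v n)) \<and>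
         prob (light p (v n)) \<le> (1 + \<epsilon>) ^ k * (lam ^ k * dirichlet_coeff (m n) k * v n powr (real k * m n))"
        by (simp add: power_mult_distrib mult_ac)
    qed
  qed
qed

text \<open>
  For two paths sharing \<open>l\<close> of their \<open>k\<close> edges, the exponential moment bound counts shared edges
  twice; compared with the number of such pairs it leaves the rate \<open>l * (1 - ln 2 - \<gamma> / k)\<close>.
\<close>

lemma pair_term_tendsto_0:
  assumes k: "k \<ge> 1" and l: "1 \<le> l" "l < k" and K: "K > 0"
    and v: "v \<longlonglongrightarrow> g_fun \<gamma> (real k)" and margin: "1 - ln 2 < \<gamma> / real k"
  shows "(\<lambda>n. real n ^ (2 * (k - 1) - l) * pair_bound K k l (v n) n) \<longlonglongrightarrow> 0"
proof -
  define r where "r = 2 * k - l"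
  \<comment> \<open>Half of the limiting decay rate, to leave room for the convergence of
    \<open>e\<close>.\<close>
  define \<beta> where "\<beta> = real l * (\<gamma> / real k - (1 - ln 2)) / 2"
  have \<beta>: "\<beta> > 0" using l margin by (simp add: \<beta>_def)
  \<comment> \<open>\<open>m n * e n\<close> is the logarithm of the pair term without its powers of
    \<open>K * sqrt (m n)\<close>, and \<open>r\<close> is the number of distinct edges of the
    pair.\<close>
  define e where "e n = (2 * (real k - 1) - real l) * (s n * ln (real n)) + 2 * real k - real r + real r * (ln (v n) - ln (real k)) - real l * ln 2" for n
  have g: "g_fun \<gamma> (real k) > 0" using k by (rule g_fun_pos)
  have r: "real r = 2 * real k - real l" using l by (simp add: r_def of_nat_diff)
  have "e \<longlonglongrightarrow> (2 * (real k - 1) - real l) * \<gamma> + 2 * real k - real r + real r * (ln (g_fun \<gamma> (real k)) - ln (real k)) - real l * ln 2"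
    unfolding e_def[abs_def] using g by (intro tendsto_intros s(3) v) auto
  also have "(2 * (real k - 1) - real l) * \<gamma> + 2 * real k - real r + real r * (ln (g_fun \<gamma> (real k)) - ln (real k)) - real l * ln 2 = - 2 * \<beta>"
    unfolding ln_g_fun[OF k] r \<beta>_def using k by (simp add: field_simps)
  finally have e: "e \<longlonglongrightarrow> - 2 * \<beta>" .
  have ev: "eventually (\<lambda>n. e n < - \<beta>) sequentially" using \<beta> by (intro order_tendstoD(2)[OF e]) auto
  have bound: "((\<lambda>x. K ^ r * (sqrt x ^ r * exp (x * (- \<beta>)))) \<longlongrightarrow> 0) at_top"
  proof -
    have "((\<lambda>x. x powr (real r / 2) * exp (x * (- \<beta>))) \<longlongrightarrow> 0) at_top"
      using \<beta> by real_asymp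
    moreover have "eventually (\<lambda>x. x powr (real r / 2) * exp (x * (- \<beta>)) = sqrt x ^ r * exp (x * (- \<beta>))) at_top"
      using eventually_gt_at_top[of 0]
    proof eventually_elim
      case (elim x)
      have "sqrt x ^ r = (x powr (1/2)) powr real r" using elim by (simp add: powr_half_sqrt powr_realpow)
      then show ?case by (simp add: powr_powr)
    qed
    ultimately have "((\<lambda>x. sqrt x ^ r * exp (x * (- \<beta>))) \<longlongrightarrow> 0) at_top" by (rule Lim_transform_eventually)
    from tendsto_mult_right_zero[OF this] show ?thesis .
  qed
  show ?thesis
  proof (rule Lim_null_comparison[OF _ filterlim_compose[OF bound m_at_top]])
    show "eventually (\<lambda>n. norm (real n ^ (2 * (k - 1) - l) * pair_bound K k l (v n) n) \<le>
      K ^ r * (sqrt (m n) ^ r * exp (m n * (- \<beta>)))) sequentially"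
      using ev m_pos order_tendstoD(1)[OF v g] eventually_ge_at_top[of 1]
    proof eventually_elim
      case (elim n)
      have 1: "real n ^ (2 * (k - 1) - l) = exp ((2 * (real k - 1) - real l) * (m n * (s n * ln (real n))))"
      proof -
        have "real n ^ (2 * (k - 1) - l) = exp (m n * (s n * ln (real n))) ^ (2 * (k - 1) - l)"
          using real_n_eq[OF elim(4)] by simp
        also have "\<dots> = exp (real (2 * (k - 1) - l) * (m n * (s n * ln (real n))))" by (rule exp_of_nat_mult[symmetric])
        also have "real (2 * (k - 1) - l) = 2 * (real k - 1) - real l" using l by (simp add: of_nat_diff)
        finally show ?thesis .
      qed
      have 2: "(v n / real k) powr m n = exp (m n * (ln (v n) - ln (real k)))"
        using elim k by (simp add: powr_def ln_div)
      have 3: "(K * sqrt (m n) * exp (- m n) * (v n / real k) powr m n) ^ r =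
          K ^ r * sqrt (m n) ^ r * exp (real r * (- m n + m n * (ln (v n) - ln (real k))))"
        unfolding 2 exp_of_nat_mult exp_add power_mult_distrib by simp
      have 4: "2 powr (- m n * real l) = exp (- m n * real l * ln 2)" by (simp add: powr_def)
      have "real n ^ (2 * (k - 1) - l) * (exp (2 * (real k * m n)) *
        (K * sqrt (m n) * exp (- m n) * (v n / real k) powr m n) ^ r * 2 powr (- m n * real l)) =
        K ^ r * (sqrt (m n) ^ r * (exp ((2 * (real k - 1) - real l) * (m n * (s n * ln (real n)))) * exp (2 * (real k * m n)) *
          exp (real r * (- m n + m n * (ln (v n) - ln (real k)))) * exp (- m n * real l * ln 2)))"
        unfolding 1 3 4 by (simp only: mult_ac)
      also have "exp ((2 * (real k - 1) - real l) * (m n * (s n * ln (real n)))) * exp (2 * (real k * m n)) *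
          exp (real r * (- m n + m n * (ln (v n) - ln (real k)))) * exp (- m n * real l * ln 2) = exp (m n * e n)"
        unfolding exp_add[symmetric] e_def by (simp add: algebra_simps)
      finally have eq: "real n ^ (2 * (k - 1) - l) * (exp (2 * (real k * m n)) *
        (K * sqrt (m n) * exp (- m n) * (v n / real k) powr m n) ^ r * 2 powr (- m n * real l)) =
        K ^ r * (sqrt (m n) ^ r * exp (m n * e n))" .
      have "m n * e n \<le> m n * (- \<beta>)" using elim by (intro mult_left_mono) auto
      then have "exp (m n * e n) \<le> exp (m n * (- \<beta>))" by simp
      then have "K ^ r * (sqrt (m n) ^ r * exp (m n * e n)) \<le> K ^ r * (sqrt (m n) ^ r * exp (m n * (- \<beta>)))"
        using K elim by (intro mult_left_mono) auto
      moreover have "0 \<le> K ^ r * (sqrt (m n) ^ r * exp (m n * e n))" using K elim by simp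
      ultimately show ?case unfolding pair_bound_def r_def[symmetric] eq by simp
    qed
  qed
qed

text \<open>The mean converges, so the products of probabilities over neighbouring paths are of
  order \<open>1 / n\<close>; the joint probabilities decay by \<open>pair_term_tendsto_0\<close>.
  The Poisson void probability then passes to the limit.\<close>

theorem P_threshold_tendsto:
  assumes k: "k \<ge> 2" and g: "g_fun \<gamma> (real k) < 1" and margin: "1 - ln 2 < \<gamma> / real k"
    and rate: "(\<lambda>n. (s n * ln (real n) - \<gamma>) / sqrt (s n)) \<longlonglongrightarrow> 0"
  shows "(\<lambda>n. P n {k} (threshold k t n)) \<longlonglongrightarrow> 1 - exp (- (a_const k * exp t))"
proof -
  let ?v = "threshold k t"
  have k1: "k \<ge> 1" using k by simp
  have g0: "g_fun \<gamma> (real k) > 0" using k1 by (rule g_fun_pos)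
  have v: "?v \<longlonglongrightarrow> g_fun \<gamma> (real k)" by (rule threshold_tendsto[OF rate k1])
  have v_pos: "eventually (\<lambda>n. ?v n > 0) sequentially" by (rule order_tendstoD(1)[OF v g0])
  define Q where "Q n = lam ^ k * dirichlet_coeff (m n) k * ?v n powr (real k * m n)" for n
  have Q: "(\<lambda>n. real n ^ (k - 1) * Q n) \<longlonglongrightarrow> a_const k * exp t"
    using mean_count_tendsto[OF rate k1, of t] by (simp add: mean_count_def[abs_def] Q_def)
  obtain K where "moment_constant K" using moment_constant_exists by blast
  then have K: "K > 0" and pair: "eventually (\<lambda>n. \<forall>w>0. \<forall>l. \<forall>p\<in>k_paths n k. \<forall>q\<in>k_paths n k. card (path_edges p \<inter> path_edges q) = l \<longrightarrow>
      light_pair_prob n p q w \<le> pair_bound K k l w n) sequentially"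
    using k1 unfolding moment_constant_def by blast+
  define B where "B n l = pair_bound K k l (?v n) n" for n l
  define \<mu> where "\<mu> n = (\<Sum>p\<in>k_paths n k. light_prob n p (?v n))" for n
  have card_Q: "(\<lambda>n. real (card (k_paths n k)) * Q n) \<longlonglongrightarrow> a_const k * exp t"
  proof -
    have "(\<lambda>n. real (card (k_paths n k)) / real n ^ (k - 1) * (real n ^ (k - 1) * Q n)) \<longlonglongrightarrow> 1 * (a_const k * exp t)"
      by (intro tendsto_mult card_k_paths_asymp[OF k1] Q)
    moreover have "eventually (\<lambda>n. real (card (k_paths n k)) / real n ^ (k - 1) * (real n ^ (k - 1) * Q n) = real (card (k_paths n k)) * Q n) sequentially"
      using eventually_ge_at_top[of 1] by eventually_elim simp
    ultimately show ?thesis using Lim_transform_eventually by fastforce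
  qed
  have \<mu>: "\<mu> \<longlonglongrightarrow> a_const k * exp t"
  proof (rule tendsto_of_relative_bounds[OF card_Q])
    fix \<epsilon> :: real assume \<epsilon>: "0 < \<epsilon>" "\<epsilon> < 1"
    show "eventually (\<lambda>n. (1 - \<epsilon>) ^ k * (real (card (k_paths n k)) * Q n) \<le> \<mu> n \<and> \<mu> n \<le> (1 + \<epsilon>) ^ k * (real (card (k_paths n k)) * Q n)) sequentially"
      using prob_light_relative[OF k1 \<epsilon> v g0 g]
    proof eventually_elim
      case (elim n)
      have "(\<Sum>p\<in>k_paths n k. (1 - \<epsilon>) ^ k * Q n) \<le> \<mu> n"
        unfolding \<mu>_def Q_def by (intro sum_mono) (use elim in blast)
      moreover have "\<mu> n \<le> (\<Sum>p\<in>k_paths n k. (1 + \<epsilon>) ^ k * Q n)"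
        unfolding \<mu>_def Q_def by (intro sum_mono) (use elim in blast)
      ultimately show ?case by (simp add: mult_ac)
    qed
  qed
  define err where "err n = (real k + 2) ^ (k + 1) * ((real n ^ (k - 1) * (2 ^ k * Q n))\<^sup>2 / real n +
      (\<Sum>l=1..k-1. real n ^ (2 * (k - 1) - l) * \<bar>B n l\<bar>))" for n
  have err: "err \<longlonglongrightarrow> 0"
  proof -
    have "(\<lambda>n. (2 ^ k * (real n ^ (k - 1) * Q n))\<^sup>2) \<longlonglongrightarrow> (2 ^ k * (a_const k * exp t))\<^sup>2"
      by (intro tendsto_intros Q)
    then have 1: "(\<lambda>n. (2 ^ k * (real n ^ (k - 1) * Q n))\<^sup>2 / real n) \<longlonglongrightarrow> 0"
      by (rule real_tendsto_divide_at_top) (rule filterlim_real_sequentially)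
    have 2: "(\<lambda>n. real n ^ (2 * (k - 1) - l) * \<bar>B n l\<bar>) \<longlonglongrightarrow> 0" if l: "l \<in> {1..k-1}" for l
    proof -
      have "(\<lambda>n. real n ^ (2 * (k - 1) - l) * B n l) \<longlonglongrightarrow> 0"
        unfolding B_def using l k by (intro pair_term_tendsto_0[OF k1 _ _ K v margin]) auto
      from tendsto_rabs_zero[OF this] show ?thesis by (simp add: abs_mult)
    qed
    have "err \<longlonglongrightarrow> (real k + 2) ^ (k + 1) * (0 + (\<Sum>l=1..k-1. 0))"
      unfolding err_def using 1 2 by (intro tendsto_intros) (auto simp: mult_ac)
    then show ?thesis by simp
  qed
  \<comment> \<open>With \<open>\<epsilon> = 1/2\<close> the relative bound gives at most
    \<open>2 ^ k * Q n\<close> for every single path, the uniform bound that the Poisson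
    approximation asks for.\<close>
  have half: "eventually (\<lambda>n. \<forall>p\<in>k_paths n k.
      (1 - 1/2) ^ k * (lam ^ k * dirichlet_coeff (m n) k * ?v n powr (real k * m n)) \<le> light_prob n p (?v n) \<and>
      light_prob n p (?v n) \<le> (1 + 1/2) ^ k * (lam ^ k * dirichlet_coeff (m n) k * ?v n powr (real k * m n))) sequentially"
    by (rule prob_light_relative[OF k1 _ _ v g0 g]) auto
  have bound: "eventually (\<lambda>n. \<bar>(1 - P n {k} (?v n)) - exp (- \<mu> n)\<bar> \<le> err n) sequentially"
    using half pair v_pos eventually_ge_at_top[of 2]
  proof eventually_elim
    case (elim n)
    interpret iid_edge_weights "M n" n "X n" "\<nu> n" using elim by (intro iid) auto
    have "\<bar>prob (space (M n) - some_light {k} (?v n)) - exp (- (\<Sum>p\<in>k_paths n k. prob (light p (?v n))))\<bar> \<le>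
      (real k + 2) ^ (k + 1) * ((real n ^ (k - 1) * (2 ^ k * Q n))\<^sup>2 / real n +
      (\<Sum>l=1..k-1. real n ^ (2 * (k - 1) - l) * \<bar>B n l\<bar>))"
    proof (rule prob_no_light_path_approx[OF k elim(4)])
      fix p assume p: "p \<in> k_paths n k"
      have low: "(1 - 1/2) ^ k * Q n \<le> prob (light p (?v n))" and up: "prob (light p (?v n)) \<le> (1 + 1/2) ^ k * Q n"
        using elim(1) p unfolding Q_def light_prob_def by auto
      have "0 \<le> (1 + 1/2 :: real) ^ k * Q n" using up measure_nonneg order_trans by blast
      moreover have "(1 + 1/2 :: real) ^ k > 0" by simp
      ultimately have "Q n \<ge> 0" using mult_pos_neg[of "(1 + 1/2) ^ k" "Q n"] by linarith
      then have "(1 + 1/2) ^ k * Q n \<le> 2 ^ k * Q n" by (intro mult_right_mono power_mono) auto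
      with up show "prob (light p (?v n)) \<le> 2 ^ k * Q n" by linarith
    next
      fix p q l assume "p \<in> k_paths n k" "q \<in> k_paths n k" "card (path_edges p \<inter> path_edges q) = l"
      then show "prob (light p (?v n) \<inter> light q (?v n)) \<le> B n l"
        using elim(2,3) unfolding B_def light_pair_prob_def by blast
    qed
    moreover have "prob (space (M n) - some_light {k} (?v n)) = 1 - P n {k} (?v n)"
      unfolding P_def by (rule prob_compl[OF some_light_events])
    ultimately show ?case by (simp add: err_def \<mu>_def light_prob_def)
  qed
  have A: "(\<lambda>n. (1 - P n {k} (?v n)) - exp (- \<mu> n)) \<longlonglongrightarrow> 0"
    by (rule Lim_null_comparison[OF _ err]) (use bound in simp)
  have B: "(\<lambda>n. exp (- \<mu> n)) \<longlonglongrightarrow> exp (- (a_const k * exp t))" by (intro tendsto_intros \<mu>)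
  from tendsto_diff[OF tendsto_const tendsto_add[OF A B], of 1]
  show ?thesis by simp
qed

end

section \<open>The four regimes\<close>

text \<open>The event is \<open>u \<le> \<Lambda>\<close> with \<open>u = - t - ln a\<close>, whose
  complement is an open half line; continuity of the Gumbel distribution function shows that
  \<open>u\<close> is not an atom.\<close>

lemma gumbel_cdf:
  assumes \<Lambda>: "standard_gumbel L \<Lambda>" and a: "a > 0"
  shows "cdf (distr L borel (\<lambda>\<omega>. - \<Lambda> \<omega> - ln a)) t = 1 - exp (- (a * exp t))"
proof -
  interpret prob_space L using \<Lambda> by (simp add: standard_gumbel_def)
  have [measurable]: "\<Lambda> \<in> borel_measurable L" using \<Lambda> by (simp add: standard_gumbel_def)
  define u where "u = - t - ln a"
  interpret D: real_distribution "distr L borel \<Lambda>" by (rule real_distribution_distr) simp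
  have cdf: "cdf (distr L borel \<Lambda>) x = exp (- exp (- x))" for x
  proof -
    have "cdf (distr L borel \<Lambda>) x = prob {\<omega> \<in> space L. \<Lambda> \<omega> \<le> x}"
      unfolding cdf_def by (subst measure_distr) (auto intro!: arg_cong[where f = prob])
    then show ?thesis using \<Lambda> by (simp add: standard_gumbel_def)
  qed
  have "isCont (cdf (distr L borel \<Lambda>)) u" unfolding cdf[abs_def] by (intro continuous_intros)
  then have atom: "measure (distr L borel \<Lambda>) {u} = 0" by (simp add: D.isCont_cdf)
  have "cdf (distr L borel (\<lambda>\<omega>. - \<Lambda> \<omega> - ln a)) t = prob {\<omega> \<in> space L. u \<le> \<Lambda> \<omega>}"
    unfolding cdf_def by (subst measure_distr) (auto intro!: arg_cong[where f = prob] simp: u_def)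
  also have "\<dots> = measure (distr L borel \<Lambda>) {u..}"
    by (subst measure_distr) (auto intro!: arg_cong[where f = prob])
  also have "{u..} = UNIV - ({..u} - {u})" by auto
  also have "measure (distr L borel \<Lambda>) (UNIV - ({..u} - {u})) = 1 - measure (distr L borel \<Lambda>) ({..u} - {u})"
    using D.prob_compl[of "{..u} - {u}"] by simp
  also have "measure (distr L borel \<Lambda>) ({..u} - {u}) = measure (distr L borel \<Lambda>) {..u}"
    using atom by (subst D.finite_measure_Diff) auto
  also have "measure (distr L borel \<Lambda>) {..u} = exp (- exp (- u))" using cdf[of u] by (simp add: cdf_def)
  also have "exp (- u) = a * exp t" using a by (simp add: u_def exp_add)
  finally show ?thesis .
qed

text \<open>\<open>arg_min\<close> over an infinite set is meaningful only if a minimizer exists. As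
  \<open>g_fun \<gamma> j\<close> is at least \<open>j * exp (- \<gamma>)\<close>, it is at least
  \<open>g_fun \<gamma> 1 = 1\<close> beyond \<open>exp \<gamma>\<close>, so a minimizer over an
  initial segment is global.\<close>

lemma k_opt_minimizes:
  assumes \<gamma>: "\<gamma> \<ge> 0"
  shows "k_opt \<gamma> \<ge> 1" "j \<ge> 1 \<Longrightarrow> g_fun \<gamma> (real (k_opt \<gamma>)) \<le> g_fun \<gamma> (real j)"
proof -
  define n0 where "n0 = nat \<lceil>exp \<gamma>\<rceil> + 1"
  obtain k where k: "is_arg_min (\<lambda>k. g_fun \<gamma> (real k)) (\<lambda>k. k \<in> {1..n0}) k"
    using ex_is_arg_min_if_finite[of "{1..n0}" "\<lambda>k. g_fun \<gamma> (real k)"] by (auto simp: n0_def)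
  then have k': "k \<in> {1..n0}" "\<And>j. j \<in> {1..n0} \<Longrightarrow> g_fun \<gamma> (real k) \<le> g_fun \<gamma> (real j)"
    by (auto simp: is_arg_min_linorder)
  have "g_fun \<gamma> (real k) \<le> g_fun \<gamma> (real j)" if j: "j \<ge> 1" for j
  proof (cases "j \<le> n0")
    case False
    then have "exp \<gamma> \<le> real j" unfolding n0_def by linarith
    then have "1 \<le> real j * exp (- \<gamma>)" by (simp add: exp_minus field_simps)
    also have "\<dots> \<le> g_fun \<gamma> (real j)"
      unfolding g_fun_def using \<gamma> by (intro mult_left_mono) (auto simp: algebra_simps)
    finally have "1 \<le> g_fun \<gamma> (real j)" .
    moreover have "g_fun \<gamma> (real k) \<le> g_fun \<gamma> (real 1)" by (rule k'(2)) (simp add: n0_def)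
    ultimately show ?thesis by (simp only: g_fun_1)
  qed (use j k' in auto)
  then have "is_arg_min (\<lambda>k. g_fun \<gamma> (real k)) (\<lambda>k. 1 \<le> k) k"
    using k'(1) by (auto simp: is_arg_min_linorder)
  then have "is_arg_min (\<lambda>k. g_fun \<gamma> (real k)) (\<lambda>k. 1 \<le> k) (k_opt \<gamma>)"
    unfolding k_opt_def arg_min_def by (rule someI)
  then show "k_opt \<gamma> \<ge> 1" "j \<ge> 1 \<Longrightarrow> g_fun \<gamma> (real (k_opt \<gamma>)) \<le> g_fun \<gamma> (real j)"
    by (auto simp: is_arg_min_linorder)
qed

text \<open>Let \<open>i < l\<close> both be minimizers. Minimality at \<open>i\<close> gives
  \<open>\<gamma> \<le> gamma_crit i\<close>, strictly because \<gamma> is not critical; but then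
  \<open>g_fun \<gamma>\<close> increases strictly from \<open>i\<close> on.\<close>

lemma k_opt_strict:
  assumes \<gamma>: "\<gamma> \<ge> 0" "\<gamma> \<notin> Gamma_set" and j: "j \<ge> 1" "j \<noteq> k_opt \<gamma>"
  shows "g_fun \<gamma> (real (k_opt \<gamma>)) < g_fun \<gamma> (real j)"
proof (rule ccontr)
  let ?k = "k_opt \<gamma>"
  assume "\<not> ?thesis"
  then have eq: "g_fun \<gamma> (real ?k) = g_fun \<gamma> (real j)" using k_opt_minimizes(2)[OF \<gamma>(1) j(1)] by simp
  have no_tie: False if "i \<ge> 1" "i < l" "g_fun \<gamma> (real i) = g_fun \<gamma> (real l)" "g_fun \<gamma> (real i) = g_fun \<gamma> (real ?k)" for i l
  proof -
    have "\<not> g_fun \<gamma> (real (Suc i)) < g_fun \<gamma> (real i)"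
      using k_opt_minimizes(2)[OF \<gamma>(1), of "Suc i"] that by simp
    then have "\<gamma> \<le> gamma_crit i" using g_fun_Suc_less_iff[of i \<gamma>] that by simp
    moreover have "gamma_crit i \<in> Gamma_set" using that by (simp add: Gamma_set_def)
    ultimately have "\<gamma> < gamma_crit i" using \<gamma>(2) by (cases "\<gamma> = gamma_crit i") auto
    then show False using g_fun_increasing[of i \<gamma> l] that by simp
  qed
  consider "?k < j" | "j < ?k" using j(2) by linarith
  then show False
  proof cases
    case 1
    show False by (rule no_tie[OF k_opt_minimizes(1)[OF \<gamma>(1)] 1 eq refl])
  next
    case 2
    show False by (rule no_tie[OF j(1) 2 eq[symmetric] eq[symmetric]])
  qed
qed

context complete_graph_fpp
begin

text \<open>Since \<open>s n * ln n\<close> tends to a positive limit, \<open>sqrt (s n)\<close> and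
  \<open>ln n powr (- 1 / 2)\<close> are of the same order.\<close>

lemma rate_of_smallo:
  assumes "\<gamma> > 0" and o: "(\<lambda>n. s n * ln (real n) - \<gamma>) \<in> o(\<lambda>n. ln (real n) powr (- 1 / 2))"
  shows "(\<lambda>n. (s n * ln (real n) - \<gamma>) / sqrt (s n)) \<longlonglongrightarrow> 0"
proof -
  have "(\<lambda>n. (s n * ln (real n) - \<gamma>) / ln (real n) powr (- 1 / 2) * (1 / sqrt (s n * ln (real n)))) \<longlonglongrightarrow> 0 * (1 / sqrt \<gamma>)"
    using assms by (intro tendsto_intros smalloD_tendsto[OF o] s(3)) auto
  moreover have "eventually (\<lambda>n. (s n * ln (real n) - \<gamma>) / ln (real n) powr (- 1 / 2) * (1 / sqrt (s n * ln (real n))) =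
      (s n * ln (real n) - \<gamma>) / sqrt (s n)) sequentially"
    using s_pos eventually_gt_at_top[of 1]
  proof eventually_elim
    case (elim n)
    have "ln (real n) > 0" using elim by simp
    then have "ln (real n) powr (- 1 / 2) * sqrt (s n * ln (real n)) = sqrt (s n)"
      by (simp add: powr_minus powr_half_sqrt real_sqrt_mult)
    then show ?case by simp
  qed
  ultimately show ?thesis using Lim_transform_eventually by fastforce
qed

text \<open>In terms of \<open>Z\<close> the level for a single edge is
  \<open>(1 + t * s n) powr (1 / s n)\<close>, which tends to \<open>exp t\<close>. This is how
  \<open>ln Z\<close> arises.\<close>

lemma P_edge_tendsto: "(\<lambda>n. P n {1} (1 + t * s n)) \<longlonglongrightarrow> G (exp t)"
proof -
  have "((\<lambda>x. (1 + t * x) powr (1 / x)) \<longlongrightarrow> exp t) (at_right 0)" by real_asymp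
  then have "(\<lambda>n. (1 + t * s n) powr m n) \<longlonglongrightarrow> exp t"
    unfolding m_def by (rule filterlim_compose[OF _ s_at_right])
  moreover have "isCont G (exp t)" using G_cont by (simp add: continuous_on_eq_continuous_at)
  ultimately have "(\<lambda>n. G ((1 + t * s n) powr m n)) \<longlonglongrightarrow> G (exp t)" by (rule isCont_tendsto_compose[rotated])
  moreover have "(\<lambda>n. 1 + t * s n) \<longlonglongrightarrow> 1 + t * 0" by (intro tendsto_intros s_tendsto_0)
  then have "eventually (\<lambda>n. 1 + t * s n > 0) sequentially" by (rule order_tendstoD(1)) simp
  then have "eventually (\<lambda>n. G ((1 + t * s n) powr m n) = P n {1} (1 + t * s n)) sequentially"
    using eventually_ge_at_top[of 2] by eventually_elim (rule P_one_edge[symmetric])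
  ultimately show ?thesis by (rule Lim_transform_eventually)
qed

lemma P_edge_beyond_1:
  assumes "\<epsilon> > 0"
  shows "(\<lambda>n. P n {1} (1 + \<epsilon>)) \<longlonglongrightarrow> 1"
proof -
  have "filterlim (\<lambda>x. (1 + \<epsilon>) powr x) at_top at_top" using assms by real_asymp
  then have "filterlim (\<lambda>n. (1 + \<epsilon>) powr m n) at_top sequentially" by (rule filterlim_compose[OF _ m_at_top])
  then have "(\<lambda>n. G ((1 + \<epsilon>) powr m n)) \<longlonglongrightarrow> 1" by (rule filterlim_compose[OF G_at_top])
  moreover have "eventually (\<lambda>n. G ((1 + \<epsilon>) powr m n) = P n {1} (1 + \<epsilon>)) sequentially"
    using eventually_ge_at_top[of 2]
  proof eventually_elim
    case (elim n)
    show ?case by (rule P_one_edge[symmetric]) (use elim assms in auto)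
  qed
  ultimately show ?thesis by (rule Lim_transform_eventually)
qed

lemma cdf_ln_Z: "cdf (distr N borel (\<lambda>\<omega>. ln (Z \<omega>))) t = G (exp t)"
proof -
  interpret N: prob_space N by (rule N)
  note [measurable] = Z(1)
  have "cdf (distr N borel (\<lambda>\<omega>. ln (Z \<omega>))) t = measure N {\<omega> \<in> space N. ln (Z \<omega>) \<le> t}"
    unfolding cdf_def by (subst measure_distr) (auto intro!: arg_cong[where f = "measure N"])
  also have "\<dots> = measure N {\<omega> \<in> space N. Z \<omega> \<le> exp t}"
  proof (rule N.finite_measure_eq_AE)
    show "AE \<omega> in N. \<omega> \<in> {\<omega> \<in> space N. ln (Z \<omega>) \<le> t} \<longleftrightarrow> \<omega> \<in> {\<omega> \<in> space N. Z \<omega> \<le> exp t}"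
      using Z(2)
    proof eventually_elim
      case (elim \<omega>)
      then show ?case using ln_le_cancel_iff[OF elim, of "exp t"] by simp
    qed
  qed measurable
  finally show ?thesis by (simp add: G_eq)
qed

lemma weight_cdf_eq_cdf:
  assumes n: "n \<ge> 2" and f: "f \<in> borel_measurable borel" and iff: "\<And>x. f x \<le> t \<longleftrightarrow> x \<le> w"
  shows "cdf (distr (M n) borel (\<lambda>\<omega>. f (min_weight n (\<lambda>e. X n e \<omega>)))) t = weight_cdf n w"
proof -
  note [measurable] = min_weight_measurable_M[OF n] f
  show ?thesis unfolding cdf_def weight_cdf_def
    by (subst measure_distr) (auto intro!: arg_cong[where f = "measure (M n)"] simp: iff)
qed

text \<open>Below \<open>gamma_crit 1\<close> the function g increases from 1 on, so every length
  other than 1 is negligible at levels tending to 1 and only the direct edge counts.\<close>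

theorem subcritical:
  assumes \<gamma>: "\<gamma> < 2 * ln 2"
  shows "weak_conv_m (\<lambda>n. distr (M n) borel (\<lambda>\<omega>. (min_weight n (\<lambda>e. X n e \<omega>) - 1) / s n)) (distr N borel (\<lambda>\<omega>. ln (Z \<omega>)))"
    and "(\<lambda>n. hop_prob n {1}) \<longlonglongrightarrow> 1"
proof -
  have g: "1 < g_fun \<gamma> (real j)" if "j \<in> {1..} - {1}" for j
    using g_fun_increasing[of 1 \<gamma> j] that \<gamma> by (simp add: gamma_crit_1[simplified] g_fun_1[simplified])
  have w: "(\<lambda>n. 1 + t * s n) \<longlonglongrightarrow> 1" for t
    using tendsto_add[OF tendsto_const[of 1] tendsto_mult_right_zero[OF s_tendsto_0, of t]] by simp
  have 0: "(\<lambda>n. P n ({1..} - {1}) (1 + t * s n)) \<longlonglongrightarrow> 0" for t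
    by (rule P_tendsto_0[OF _ zero_less_one g w]) auto
  show "weak_conv_m (\<lambda>n. distr (M n) borel (\<lambda>\<omega>. (min_weight n (\<lambda>e. X n e \<omega>) - 1) / s n)) (distr N borel (\<lambda>\<omega>. ln (Z \<omega>)))"
    unfolding weak_conv_m_def weak_conv_def
  proof (intro allI impI)
    fix t
    have "(\<lambda>n. weight_cdf n (1 + t * s n)) \<longlonglongrightarrow> G (exp t)"
      by (rule weight_cdf_tendsto[OF _ P_edge_tendsto 0]) auto
    moreover have "eventually (\<lambda>n. weight_cdf n (1 + t * s n) =
        cdf (distr (M n) borel (\<lambda>\<omega>. (min_weight n (\<lambda>e. X n e \<omega>) - 1) / s n)) t) sequentially"
      using s_pos eventually_ge_at_top[of 2]
    proof eventually_elim
      case (elim n)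
      show ?case
        by (rule weight_cdf_eq_cdf[OF elim(2), symmetric]) (use elim in \<open>auto simp: pos_divide_le_eq\<close>)
    qed
    ultimately show "(\<lambda>n. cdf (distr (M n) borel (\<lambda>\<omega>. (min_weight n (\<lambda>e. X n e \<omega>) - 1) / s n)) t) \<longlonglongrightarrow>
        cdf (distr N borel (\<lambda>\<omega>. ln (Z \<omega>))) t"
      unfolding cdf_ln_Z by (rule Lim_transform_eventually)
  qed
  show "(\<lambda>n. hop_prob n {1}) \<longlonglongrightarrow> 1"
  proof (rule hop_prob_tendsto_1)
    fix \<eta> :: real assume \<eta>: "\<eta> > 0"
    have "((\<lambda>t. G (exp t)) \<longlongrightarrow> 1) at_top" by (rule filterlim_compose[OF G_at_top exp_at_top])
    then have "eventually (\<lambda>t. 1 - \<eta> < G (exp t)) at_top" using \<eta> by (intro order_tendstoD(1)) auto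
    then obtain t where "1 - \<eta> < G (exp t)" by (auto simp: eventually_at_top_linorder)
    then show "\<exists>K w L. K \<subseteq> {1..} \<and> (\<lambda>n. P n K (w n)) \<longlonglongrightarrow> L \<and> 1 - \<eta> < L \<and> (\<lambda>n. P n ({1..} - {1}) (w n)) \<longlonglongrightarrow> 0"
      using P_edge_tendsto[of t] 0[of t] by (intro exI[of _ "{1}"] exI[of _ "\<lambda>n. 1 + t * s n"] exI[of _ "G (exp t)"]) auto
  qed
qed

text \<open>If \<open>P n K\<close> tends to 1 at every level above \<open>c\<close>, a fixed level
  can be used that lies above \<open>c\<close> and yet makes the lengths outside \<open>J\<close>
  negligible.\<close>

lemma hop_prob_tendsto_1_at_minimum:
  assumes K: "K \<subseteq> {1..}" and c: "c > 0" and upper: "\<And>\<epsilon>. \<epsilon> > 0 \<Longrightarrow> (\<lambda>n. P n K (c + \<epsilon>)) \<longlonglongrightarrow> 1"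
    and less: "\<And>j. j \<in> {1..} - J \<Longrightarrow> c < g_fun \<gamma> (real j)"
  shows "(\<lambda>n. hop_prob n J) \<longlonglongrightarrow> 1"
proof (rule hop_prob_tendsto_1)
  fix \<eta> :: real assume \<eta>: "\<eta> > 0"
  obtain w where w: "w > c" "(\<lambda>n. P n ({1..} - J) w) \<longlonglongrightarrow> 0"
    using P_tendsto_0_beyond[of "{1..} - J" c] c less by blast
  then show "\<exists>K w L. K \<subseteq> {1..} \<and> (\<lambda>n. P n K (w n)) \<longlonglongrightarrow> L \<and> 1 - \<eta> < L \<and> (\<lambda>n. P n ({1..} - J) (w n)) \<longlonglongrightarrow> 0"
    using K upper[of "w - c"] \<eta> by (intro exI[of _ K] exI[of _ "\<lambda>_. w"] exI[of _ 1]) auto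
qed

text \<open>Lengths 1 and 2 tie with value 1. The direct edge alone gives the upper bound on the
  minimal weight, and all lengths from 3 on are strictly worse.\<close>

theorem critical:
  assumes \<gamma>: "\<gamma> = 2 * ln 2"
  shows "conv_in_prob M (\<lambda>n \<omega>. min_weight n (\<lambda>e. X n e \<omega>)) 1" "(\<lambda>n. hop_prob n {1, 2}) \<longlonglongrightarrow> 1"
proof -
  have crit: "\<gamma> = gamma_crit 1" using \<gamma> gamma_crit_1 by simp
  have g2: "g_fun \<gamma> (real 2) = 1"
    using g_fun_less_Suc_iff[of 1 \<gamma>] g_fun_Suc_less_iff[of 1 \<gamma>] crit g_fun_1[of \<gamma>] by (simp add: numeral_2_eq_2)
  have g3: "1 < g_fun \<gamma> (real j)" if "j \<in> {1..} - {1, 2}" for j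
    using g_fun_increasing[of 2 \<gamma> j] that gamma_crit_less[of 1 2] crit g2 by auto
  show "conv_in_prob M (\<lambda>n \<omega>. min_weight n (\<lambda>e. X n e \<omega>)) 1"
  proof (rule conv_in_prob_min_weight[of "{1}", OF _ zero_less_one P_edge_beyond_1])
    show "1 \<le> g_fun \<gamma> (real j)" if "j \<ge> 1" for j
      using g_fun_1[of \<gamma>] g2 g3[of j] that by (cases "j = 1"; cases "j = 2") auto
  qed auto
  show "(\<lambda>n. hop_prob n {1, 2}) \<longlonglongrightarrow> 1"
    by (rule hop_prob_tendsto_1_at_minimum[of "{1}", OF _ zero_less_one P_edge_beyond_1 g3]) auto
qed

lemma exp_neg_exp_small:
  fixes a \<eta> :: real
  assumes "a > 0" "\<eta> > 0"
  obtains t where "exp (- (a * exp t)) < \<eta>"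
proof -
  have "((\<lambda>t. exp (- (a * exp t))) \<longlongrightarrow> 0) at_top" using assms by real_asymp
  then have "eventually (\<lambda>t. exp (- (a * exp t)) < \<eta>) at_top" using assms by (intro order_tendstoD(2)) auto
  then show ?thesis using that by (auto simp: eventually_at_top_linorder)
qed

definition rescaled :: "nat \<Rightarrow> nat \<Rightarrow> real \<Rightarrow> real" where
  "rescaled k n x = real k / (g_fun \<gamma> (real k) * s n) * (lam powr s n * x - g_fun \<gamma> (real k)) + centering k n"

theorem unique_minimizer:
  assumes o: "(\<lambda>n. s n * ln (real n) - \<gamma>) \<in> o(\<lambda>n. ln (real n) powr (- 1 / 2))"
    and \<gamma>: "\<gamma> \<notin> Gamma_set" "\<gamma> > 2 * ln 2" and \<Lambda>: "standard_gumbel L \<Lambda>" and k_def: "k = k_opt \<gamma>"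
  shows "weak_conv_m (\<lambda>n. distr (M n) borel (\<lambda>\<omega>. rescaled k n (min_weight n (\<lambda>e. X n e \<omega>))))
      (distr L borel (\<lambda>\<omega>. - \<Lambda> \<omega> - ln (a_const k)))"
    and "(\<lambda>n. hop_prob n {k}) \<longlonglongrightarrow> 1"
proof -
  have \<gamma>0: "\<gamma> > 0" using \<gamma>(2) by (smt (verit) ln_gt_zero)
  have k1: "k \<ge> 1" and min: "\<And>j. j \<ge> 1 \<Longrightarrow> g_fun \<gamma> (real k) \<le> g_fun \<gamma> (real j)"
    unfolding k_def using k_opt_minimizes \<gamma>0 by auto
  have less: "g_fun \<gamma> (real k) < g_fun \<gamma> (real j)" if "j \<in> {1..} - {k}" for j
    unfolding k_def using k_opt_strict[of \<gamma> j] \<gamma> \<gamma>0 that k_def by auto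
  have g2: "g_fun \<gamma> (real 2) < 1"
    using g_fun_Suc_less_iff[of 1 \<gamma>] \<gamma>(2) gamma_crit_1 g_fun_1[of \<gamma>] by (simp add: numeral_2_eq_2)
  have g: "g_fun \<gamma> (real k) < 1" using min[of 2] g2 by simp
  have k2: "k \<ge> 2"
  proof (rule ccontr)
    assume "\<not> k \<ge> 2"
    then have "k = 1" using k1 by simp
    then show False using g g_fun_1[of \<gamma>] by simp
  qed
  \<comment> \<open>Optimality is compared with the left neighbour only: it yields
    \<open>gamma_crit (k - 1) \<le> \<gamma>\<close>, which is what the margin for overlapping pairs
    needs.\<close>
  have "\<not> g_fun \<gamma> (real (k - 1)) < g_fun \<gamma> (real (Suc (k - 1)))"
  proof -
    have "k - 1 \<ge> 1" "Suc (k - 1) = k" using k2 by auto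
    then show ?thesis using min[of "k - 1"] by (metis not_less)
  qed
  moreover have "k - 1 \<ge> 1" using k2 by simp
  ultimately have "gamma_crit (k - 1) \<le> \<gamma>" using g_fun_less_Suc_iff[of "k - 1" \<gamma>] by linarith
  then have margin: "1 - ln 2 < \<gamma> / real k" using gamma_div_k_gt[of "k - 1" \<gamma>] k2 by simp
  have g0: "g_fun \<gamma> (real k) > 0" using k1 by (rule g_fun_pos)
  note rate = rate_of_smallo[OF \<gamma>0 o]
  note lim = P_threshold_tendsto[OF k2 g margin rate]
  have 0: "(\<lambda>n. P n ({1..} - {k}) (threshold k t n)) \<longlonglongrightarrow> 0" for t
    by (rule P_tendsto_0[OF _ g0 less threshold_tendsto[OF rate k1]]) auto
  have a: "a_const k > 0" by (rule a_const_pos[OF k1])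
  show "weak_conv_m (\<lambda>n. distr (M n) borel (\<lambda>\<omega>. rescaled k n (min_weight n (\<lambda>e. X n e \<omega>))))
      (distr L borel (\<lambda>\<omega>. - \<Lambda> \<omega> - ln (a_const k)))"
    unfolding weak_conv_m_def weak_conv_def gumbel_cdf[OF \<Lambda> a]
  proof (intro allI impI)
    fix t
    have "(\<lambda>n. weight_cdf n (threshold k t n)) \<longlonglongrightarrow> 1 - exp (- (a_const k * exp t))"
      by (rule weight_cdf_tendsto[OF _ lim 0]) (use k1 in auto)
    moreover have "eventually (\<lambda>n. weight_cdf n (threshold k t n) = cdf (distr (M n) borel (\<lambda>\<omega>. rescaled k n (min_weight n (\<lambda>e. X n e \<omega>)))) t) sequentially"
      using s_pos eventually_ge_at_top[of 2]
    proof eventually_elim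
      case (elim n)
      let ?g = "g_fun \<gamma> (real k)"
      show ?case
      proof (rule weight_cdf_eq_cdf[OF elim(2), symmetric])
        fix x
        have "real k / (?g * s n) * (lam powr s n * x - ?g) + centering k n \<le> t \<longleftrightarrow>
            real k / (?g * s n) * (lam powr s n * x - ?g) \<le> t - centering k n" by linarith
        also have "\<dots> \<longleftrightarrow> lam powr s n * x - ?g \<le> ?g * deviation k t n"
          using g0 elim(1) k1 by (simp add: deviation_def field_simps)
        also have "\<dots> \<longleftrightarrow> lam powr s n * x \<le> ?g * (1 + deviation k t n)" by (simp add: algebra_simps)
        also have "\<dots> \<longleftrightarrow> x \<le> threshold k t n"
          using lam by (simp add: threshold_def powr_minus field_simps)
        finally show "rescaled k n x \<le> t \<longleftrightarrow> x \<le> threshold k t n"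
          unfolding rescaled_def .
      qed (simp add: rescaled_def[abs_def])
    qed
    ultimately show "(\<lambda>n. cdf (distr (M n) borel (\<lambda>\<omega>. rescaled k n (min_weight n (\<lambda>e. X n e \<omega>)))) t) \<longlonglongrightarrow> 1 - exp (- (a_const k * exp t))"
      by (rule Lim_transform_eventually)
  qed
  show "(\<lambda>n. hop_prob n {k}) \<longlonglongrightarrow> 1"
  proof (rule hop_prob_tendsto_1)
    fix \<eta> :: real assume \<eta>: "\<eta> > 0"
    obtain t where "exp (- (a_const k * exp t)) < \<eta>" using exp_neg_exp_small[OF a \<eta>] by blast
    then show "\<exists>K w L. K \<subseteq> {1..} \<and> (\<lambda>n. P n K (w n)) \<longlonglongrightarrow> L \<and> 1 - \<eta> < L \<and> (\<lambda>n. P n ({1..} - {k}) (w n)) \<longlonglongrightarrow> 0"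
      using lim[of t] 0[of t] k1
      by (intro exI[of _ "{k}"] exI[of _ "threshold k t"] exI[of _ "1 - exp (- (a_const k * exp t))"]) auto
  qed
qed

text \<open>Lengths \<open>k\<close> and \<open>k + 1\<close> tie. At any level above the minimum
  the Poisson limit for length \<open>k\<close> alone, with \<open>t\<close> large, makes light
  paths almost certain; as the two lengths are not compared, the hopcount is only located in
  \<open>{k, k + 1}\<close>.\<close>

theorem two_minimizers:
  assumes o: "(\<lambda>n. s n * ln (real n) - \<gamma>) \<in> o(\<lambda>n. ln (real n) powr (- 1 / 2))"
    and k: "k \<ge> 2" and \<gamma>: "\<gamma> = gamma_crit k"
  shows "conv_in_prob M (\<lambda>n \<omega>. min_weight n (\<lambda>e. X n e \<omega>)) (g_fun \<gamma> (real k))"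
    and "(\<lambda>n. hop_prob n {k, k + 1}) \<longlonglongrightarrow> 1"
proof -
  let ?g = "g_fun \<gamma> (real k)"
  have k1: "k \<ge> 1" using k by simp
  have below: "gamma_crit (k - 1) < \<gamma>" using gamma_crit_less[of "k - 1" k] k \<gamma> by simp
  have "gamma_crit 1 \<le> gamma_crit k" by (rule gamma_crit_le) (use k in auto)
  moreover have "ln 2 > (0::real)" by simp
  ultimately have \<gamma>0: "\<gamma> > 0" using \<gamma> gamma_crit_1 by linarith
  have left: "?g < g_fun \<gamma> (real j)" if "1 \<le> j" "j < k" for j
    using g_fun_decreasing[of j "k - 1" \<gamma>] that below by simp
  have gk: "g_fun \<gamma> (real (Suc k)) = ?g"
    using g_fun_less_Suc_iff[OF k1, of \<gamma>] g_fun_Suc_less_iff[OF k1, of \<gamma>] \<gamma> by simp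
  have right: "?g < g_fun \<gamma> (real j)" if "Suc k < j" for j
    using g_fun_increasing[of "Suc k" \<gamma> j] that gamma_crit_less_Suc[OF k1] \<gamma> gk by simp
  have less: "?g < g_fun \<gamma> (real j)" if "j \<in> {1..} - {k, k + 1}" for j
    using left[of j] right[of j] that by (cases "j < k") auto
  have ge: "?g \<le> g_fun \<gamma> (real j)" if "j \<ge> 1" for j
    using less[of j] gk that by (cases "j = k"; cases "j = k + 1") auto
  have g: "?g < 1" using left[of 1] k g_fun_1[of \<gamma>] by simp
  have g0: "?g > 0" using k1 by (rule g_fun_pos)
  have margin: "1 - ln 2 < \<gamma> / real k" using gamma_div_k_gt[of "k - 1" \<gamma>] k below by simp
  note rate = rate_of_smallo[OF \<gamma>0 o]
  note lim = P_threshold_tendsto[OF k g margin rate]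
  have a: "a_const k > 0" by (rule a_const_pos[OF k1])
  have upper: "(\<lambda>n. P n {k} (?g + \<epsilon>)) \<longlonglongrightarrow> 1" if \<epsilon>: "\<epsilon> > 0" for \<epsilon>
  proof (rule order_tendstoI)
    fix b :: real assume "b < 1"
    then obtain t where t: "exp (- (a_const k * exp t)) < 1 - b" using exp_neg_exp_small[OF a, of "1 - b"] by auto
    then have "eventually (\<lambda>n. b < P n {k} (threshold k t n)) sequentially"
      by (intro order_tendstoD(1)[OF lim]) simp
    moreover have "eventually (\<lambda>n. threshold k t n < ?g + \<epsilon>) sequentially"
      using \<epsilon> by (intro order_tendstoD(2)[OF threshold_tendsto[OF rate k1]]) simp
    ultimately show "eventually (\<lambda>n. b < P n {k} (?g + \<epsilon>)) sequentially"
      using eventually_ge_at_top[of "1::nat"]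
    proof eventually_elim
      case (elim n)
      have "P n {k} (threshold k t n) \<le> P n {k} (?g + \<epsilon>)" using elim by (intro P_mono) auto
      then show ?case using elim by simp
    qed
  next
    fix b :: real assume b: "1 < b"
    have "eventually (\<lambda>n. n \<ge> (1::nat)) sequentially" by (rule eventually_ge_at_top)
    then show "eventually (\<lambda>n. P n {k} (?g + \<epsilon>) < b) sequentially"
      by eventually_elim (rule le_less_trans[OF prob_P(2) b])
  qed
  show "conv_in_prob M (\<lambda>n \<omega>. min_weight n (\<lambda>e. X n e \<omega>)) ?g"
    by (rule conv_in_prob_min_weight[of "{k}", OF _ g0 upper ge]) (use k1 in auto)
  show "(\<lambda>n. hop_prob n {k, k + 1}) \<longlonglongrightarrow> 1"
    by (rule hop_prob_tendsto_1_at_minimum[of "{k}", OF _ g0 upper less]) (use k1 in auto)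
qed

end

text \<open>Inside the interval \<open>deriv G\<close> is the derivative \<open>f'\<close> given by
  \<open>C2_on\<close>, and \<open>f'\<close> is continuous at 0. Hence \<open>lam\<close> is the
  one-sided derivative of \<open>G\<close> at 0, that is, the limit of
  \<open>G x / x\<close>.\<close>

lemma C2_on_quotient_tendsto:
  assumes x: "xhat > 0" and C2: "C2_on {0..xhat} G" and G0: "G 0 = 0"
    and lam: "(deriv G \<longlongrightarrow> lam) (at_right 0)"
  shows "((\<lambda>x. G x / x) \<longlongrightarrow> lam) (at_right 0)"
proof -
  obtain f' f'' where f': "\<And>x. x \<in> {0..xhat} \<Longrightarrow> (G has_real_derivative f' x) (at x within {0..xhat})"
    and f'': "\<And>x. x \<in> {0..xhat} \<Longrightarrow> (f' has_real_derivative f'' x) (at x within {0..xhat})"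
    using C2 unfolding C2_on_def by blast
  have at: "at 0 within {0..xhat} = at_right 0" using x by (rule at_within_Icc_at_right)
  have "continuous (at 0 within {0..xhat}) f'"
    using f''[of 0] x by (intro DERIV_continuous) auto
  then have f'_lim: "(f' \<longlongrightarrow> f' 0) (at_right 0)" by (simp add: continuous_within at)
  have "eventually (\<lambda>y. y \<in> {0<..<xhat}) (at_right 0)" using x by (rule eventually_at_right_real)
  then have "eventually (\<lambda>y. f' y = deriv G y) (at_right 0)"
  proof eventually_elim
    case (elim y)
    then have "(G has_real_derivative f' y) (at y)"
      using f'[of y] by (simp add: at_within_Icc_at)
    then show ?case by (rule DERIV_imp_deriv[symmetric])
  qed
  with f'_lim have "(deriv G \<longlongrightarrow> f' 0) (at_right 0)" by (rule Lim_transform_eventually)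
  then have "lam = f' 0" using lam tendsto_unique trivial_limit_at_right_real by blast
  moreover have "((\<lambda>y. (G y - G 0) / (y - 0)) \<longlongrightarrow> f' 0) (at_right 0)"
    using f'[of 0] x by (simp add: has_field_derivative_iff at)
  ultimately show ?thesis using G0 by simp
qed

theorem theorem1p4:
  fixes N :: "'b measure" and Z :: "'b \<Rightarrow> real" and G :: "real \<Rightarrow> real"
    and xhat lam \<gamma> :: real and s :: "nat \<Rightarrow> real"
    and M :: "nat \<Rightarrow> 'a measure" and X :: "nat \<Rightarrow> nat set \<Rightarrow> 'a \<Rightarrow> real"
    and W :: "nat \<Rightarrow> 'a \<Rightarrow> real" and H :: "nat \<Rightarrow> 'a \<Rightarrow> nat"
    and L :: "'c measure" and \<Lambda> :: "'c \<Rightarrow> real"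
  assumes N: "prob_space N"
    and Z: "Z \<in> borel_measurable N" "AE \<omega> in N. Z \<omega> > 0"
    and G_def: "G = cdf (distr N borel Z)"
    and G_cont: "continuous_on UNIV G"
    and G_C2: "xhat > 0" "C2_on {0..xhat} G"
    and lam: "(deriv G \<longlongrightarrow> lam) (at_right 0)" "lam > 0"
    and s: "\<And>n. n \<ge> 1 \<Longrightarrow> s n > 0" "\<gamma> \<ge> 0" "(\<lambda>n. s n * ln (real n)) \<longlonglongrightarrow> \<gamma>"
    and M: "\<And>n. n \<ge> 1 \<Longrightarrow> prob_space (M n)"
    and X_indep: "\<And>n. n \<ge> 1 \<Longrightarrow>
          prob_space.indep_vars (M n) (\<lambda>_. borel) (X n) (complete_edges n)"
    and X_distr: "\<And>n e. n \<ge> 1 \<Longrightarrow> e \<in> complete_edges n \<Longrightarrow>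
          distr (M n) borel (X n e) = distr N borel (\<lambda>\<omega>. Z \<omega> powr s n)"
    and W_def: "\<And>n \<omega>. W n \<omega> = min_weight n (\<lambda>e. X n e \<omega>)"
    and H_def: "\<And>n \<omega>. H n \<omega> = hopcount n (\<lambda>e. X n e \<omega>)"
    and \<Lambda>: "standard_gumbel L \<Lambda>"
  shows
    "(\<gamma> < 2 * ln 2 \<longrightarrow>
        weak_conv_m (\<lambda>n. distr (M n) borel (\<lambda>\<omega>. (W n \<omega> - 1) / s n))
                    (distr N borel (\<lambda>\<omega>. ln (Z \<omega>))) \<and>
        (\<lambda>n. measure (M n) {\<omega> \<in> space (M n). H n \<omega> = 1}) \<longlonglongrightarrow> 1) \<and>
     (\<gamma> = 2 * ln 2 \<longrightarrow>
        conv_in_prob M W 1 \<and>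
        (\<lambda>n. measure (M n) {\<omega> \<in> space (M n). H n \<omega> \<in> {1, 2}}) \<longlonglongrightarrow> 1) \<and>
     ((\<lambda>n. s n * ln (real n) - \<gamma>) \<in> o(\<lambda>n. ln (real n) powr (- 1 / 2)) \<and>
      \<gamma> \<notin> Gamma_set \<and> \<gamma> > 2 * ln 2 \<longrightarrow>
        (let k = k_opt \<gamma> in
          weak_conv_m
            (\<lambda>n. distr (M n) borel (\<lambda>\<omega>.
               real k / (g_fun \<gamma> (real k) * s n) * (lam powr s n * W n \<omega> - g_fun \<gamma> (real k))
               + (real k - 1) / s n * (s n * ln (real n) - \<gamma> - s n * ln (s n) / 2)))
            (distr L borel (\<lambda>\<omega>. - \<Lambda> \<omega> - ln (a_const k))) \<and>
          (\<lambda>n. measure (M n) {\<omega> \<in> space (M n). H n \<omega> = k}) \<longlonglongrightarrow> 1)) \<and>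
     (\<forall>k\<ge>2. (\<lambda>n. s n * ln (real n) - \<gamma>) \<in> o(\<lambda>n. ln (real n) powr (- 1 / 2)) \<and>
        \<gamma> = gamma_crit k \<longrightarrow>
        conv_in_prob M W (g_fun \<gamma> (real k)) \<and>
        (\<lambda>n. measure (M n) {\<omega> \<in> space (M n). H n \<omega> \<in> {k, k + 1}}) \<longlonglongrightarrow> 1)"
proof -
  have G0: "G 0 = 0"
  proof -
    interpret N: prob_space N by (rule N)
    have "G 0 = measure N {\<omega> \<in> space N. Z \<omega> \<le> 0}"
      unfolding G_def cdf_def using Z(1) by (subst measure_distr) (auto intro!: arg_cong[where f = "measure N"])
    moreover have "{\<omega> \<in> space N. Z \<omega> \<le> 0} \<in> sets N" using Z(1) by measurable
    moreover have "AE \<omega> in N. \<omega> \<notin> {\<omega> \<in> space N. Z \<omega> \<le> 0}" using Z(2) by eventually_elim auto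
    ultimately show ?thesis by (simp add: N.prob_eq_0)
  qed
  interpret complete_graph_fpp N Z G lam \<gamma> s M X
    by (rule complete_graph_fpp.intro; (fact | rule C2_on_quotient_tendsto[OF G_C2 G0 lam(1)]))
  have W: "W = (\<lambda>n \<omega>. min_weight n (\<lambda>e. X n e \<omega>))" using W_def by (intro ext)
  have H: "measure (M n) {\<omega> \<in> space (M n). H n \<omega> \<in> J} = hop_prob n J" for n J
    by (simp add: hop_prob_def H_def)
  have H1: "measure (M n) {\<omega> \<in> space (M n). H n \<omega> = j} = hop_prob n {j}" for n j
    by (simp add: hop_prob_def H_def)
  show ?thesis
    unfolding W H H1 Let_def
    using subcritical critical unique_minimizer[OF _ _ _ \<Lambda> refl] two_minimizers
    by (simp only: rescaled_def centering_def) blast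
qed

end
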